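(* Let $p$ and $z$ be negative real numbers, and let $(\tilde R_1)_\alpha^\beta$ and $(P_1)^\alpha_\beta$ be the B-model and A-model large radius limit $R$-matrix blocks of the football $\mathcal F(m,r)$ at the fixed point with isotropy $\mathbb Z/r$, as defined in the context, with variables $\mu=\frac{p}{rz}$ and $\lambda$ respectively. Then, if $\lambda$ and $\mu$ are identified, $$(\tilde R_1)_\alpha^\beta=(P_1)_\beta^\alpha\qquad\text{for } 0\le\alpha,\beta\le r-1.$$
   Context: **The target.** $\mathcal F(m,r)=(\mathbb C^2\setminus\{(0,0)\})/G$, $G=\{(t_1,t_2)\in(\mathbb C^* )^2: t_1^rt_2^{-m}=1\}$, with the action of $T=(\mathbb C^* )^2$ by $(\lambda_1,\lambda_2)\cdot[z_1,z_2]=[\lambda_1z_1,\lambda_2z_2]$. **A-model.** $Q_1=\mathcal F(m,r)\setminus\{[0:1]\}$ is the chart with isotropy group $\mathbb Z/r$; $T$ acts on it by $(\lambda_1,\lambda_2)\circ z=(\lambda_2^{m/r}\lambda_1)z$, with weight written $w_1=\lambda_1\lambda_2^{m/r}$. Put $\lambda=\frac{w_1}{z}=\frac{\lambda_1\lambda_2^{m/r}}{z}$ and $\omega_{\alpha,\beta}=e^{2\pi i(\alpha-\beta)/r}$. With $B_k(s)$ the Bernoulli polynomials, the block at this chart of the A-model $R$-matrix at $t=0$, $q=0$ (from orbifold quantum Riemann–Roch) is $$(P_1)_\beta^\alpha=\frac1r\sum_{h=0}^{r-1}\omega_{\alpha,\beta}^{-h}\exp\Big[\sum_{t\ge1}\frac{(-1)^{t}}{t(t+1)}B_{t+1}\big(\tfrac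 hr\big)\Big(\frac{z}{w_1}\Big)^{t}\Big],$$ which, using the expansion $\log\Gamma(z+s)=(z+s-\frac12)\log z-z+\frac12\log2\pi+\sum_{t\ge1}\frac{(-1)^tB_{t+1}(s)}{t(t+1)}\frac1{z^t}$, is written as $$(P_1)_\beta^\alpha=\frac{e^\lambda}{r\sqrt{2\pi\lambda}}\sum_{h=0}^{r-1}\omega_{\alpha,\beta}^{-h}\,\Gamma\big(\lambda+\tfrac hr\big)\,\lambda^{1-\lambda-\frac hr}.$$ **B-model.** With $Y=e^y$, the superpotential is $W(Y)=\sum_{\ell=-m}^{r}\tilde q_\ell Y^\ell-\sum_{\ell=-m}^{r} w_\ell\log(\tilde q_\ell Y^\ell)$, $\tilde q_r=1$, and $p=\sum_{\ell=-m}^{r}\ell w_\ell$ (the parameters $w_\ell$, $-m\le\ell\le r$, are those of the superpotential, not the chart weight above). With $P_\beta$ the critical points of $W$ (assumed distinct) and $\Delta^\beta=\partial^2W/\partial y^2$ at $P_\beta$, $$\tilde R_\alpha^\beta(\tilde q)=\frac{\sqrt{-z}}{2\sqrt\pi}\int_{\gamma_\beta}e^{\frac{W(P_\beta)-W(Y)}{z}}\,d\xi_{\alpha,0},\qquad \xi_{\alpha,0}=\frac1{\sqrt{-1}}\sqrt{\frac2{\Delta^\alpha}}\,\frac{P_\alpha}{Y-P_\alpha},\qquad \gamma_\beta=W^{-1}\big(W(P_\beta)+[0,+\infty)\big).$$ Adding a constant to $W$ does not change $\tilde R$. $(\tilde R_1)_\alpha^\beta$, $0\le\alpha,\beta\le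 r-1$, is the submatrix of the first $r$ rows and columns of $\lim_{\tilde q\to0}\tilde R_\alpha^\beta(\tilde q)$ (all $\tilde q_\ell\to0$, $\ell\ne r$). In this limit $W$ is replaced by $\widetilde W(Y)=Y^r-p\log Y$, with critical points $P_\beta=(p/r)^{1/r}e^{2\pi i\beta/r}$, $\beta=0,\dots,r-1$, $\Delta^\alpha=rp$ and $\gamma_\beta=(0,+\infty)\cdot P_\beta$; with $\mu=\frac{p}{rz}$ the block is evaluated as $\frac{e^\mu}{r\sqrt{2\pi\mu}}\sum_{h=0}^{r-1}\Gamma(\mu+\tfrac hr)\,\mu^{1-\mu-\frac hr}\,\omega_{\alpha,\beta}^{-h}$.
   Formalization: For z<0 the thimble is taken over W(P_β)+(−∞,0], since the displayed one diverges; diagonal integrals, divergent at the double pole, are Hadamard finite parts; the Bernoulli series has sign (−1)^{t+1} and is read as the asymptotic expansion of the Gamma form; Stokes values of q are excluded. *)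

theory Defs
  imports
    "HOL-Complex_Analysis.Complex_Analysis"
    "HOL-Computational_Algebra.Formal_Power_Series"
    "HOL-Library.Landau_Symbols"
begin

section \<open>The A-model block\<close>

definition root_omega :: "nat \<Rightarrow> nat \<Rightarrow> nat \<Rightarrow> complex" where
  "root_omega r \<alpha> \<beta> = exp (2 * of_real pi * \<i> * (of_nat \<alpha> - of_nat \<beta>) / of_nat r)"

text \<open>The tangent weight at the fixed point with isotropy group of order \<open>r\<close>, with the
  principal branch of the fractional power.\<close>

definition chart_weight :: "nat \<Rightarrow> nat \<Rightarrow> complex \<Rightarrow> complex \<Rightarrow> complex" where
  "chart_weight m r u1 u2 = u1 * u2 powr (of_nat m / of_nat r)"

definition P_block :: "nat \<Rightarrow> complex \<Rightarrow> nat \<Rightarrow> nat \<Rightarrow> complex" where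
  "P_block r lam \<alpha> \<beta> =
     exp lam / (of_nat r * csqrt (2 * of_real pi * lam)) *
     (\<Sum>h<r. root_omega r \<alpha> \<beta> powi (- int h) * Gamma (lam + of_nat h / of_nat r)
              * lam powr (1 - lam - of_nat h / of_nat r))"

definition bernoulli_poly :: "nat \<Rightarrow> complex \<Rightarrow> complex" where
  "bernoulli_poly k s = fact k * fps_nth (fps_X * fps_exp s / (fps_exp 1 - 1)) k"

text \<open>The orbifold quantum Riemann--Roch expression, a (divergent) power series in
  \<open>1 / lam = z / w\<^sub>1\<close>.  The sign \<open>(-1)\<^sup>t\<^sup>+\<^sup>1\<close> is the one of the Stirling expansion
  \<open>log \<Gamma> (\<lambda> + s) \<sim> (\<lambda> + s - 1/2) log \<lambda> - \<lambda> + log (2\<pi>) / 2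
    + (\<Sum>t\<ge>1. (-1)\<^sup>t\<^sup>+\<^sup>1 B\<^sub>t\<^sub>+\<^sub>1(s) / (t (t + 1) \<lambda>\<^sup>t))\<close>;
  for \<open>s = 0\<close> its leading term is \<open>1 / (12 \<lambda>)\<close>, since \<open>B\<^sub>2(0) = 1/6\<close>.  With \<open>(-1)\<^sup>t\<close>
  instead, the series would not be the expansion of the Gamma function expression.\<close>

definition P_series :: "nat \<Rightarrow> nat \<Rightarrow> nat \<Rightarrow> complex fps" where
  "P_series r \<alpha> \<beta> =
     fps_const (1 / of_nat r) *
     (\<Sum>h<r. fps_const (root_omega r \<alpha> \<beta> powi (- int h)) *
        (fps_exp 1 oo Abs_fps (\<lambda>t. if t = 0 then 0 else
           (-1) ^ (t + 1) / (of_nat t * of_nat (t + 1))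
             * bernoulli_poly (t + 1) (of_nat h / of_nat r))))"

section \<open>The B-model superpotential\<close>

text \<open>Parameters: \<open>w l\<close> and \<open>q l\<close> for \<open>-m \<le> l \<le> r\<close>.  All functions of \<open>Y = e\<^sup>y\<close> are taken on
  the \<open>y\<close>-plane, where \<open>log (q l * Y\<^sup>l) = Ln (q l) + l y\<close> is single-valued.  The choice of
  the logarithm of \<open>q l\<close> only changes \<open>W\<close> by a constant.\<close>

definition W :: "nat \<Rightarrow> nat \<Rightarrow> (int \<Rightarrow> complex) \<Rightarrow> (int \<Rightarrow> complex) \<Rightarrow> complex \<Rightarrow> complex" where
  "W m r w q y = (\<Sum>l\<in>{- int m..int r}. q l * exp (of_int l * y))
               - (\<Sum>l\<in>{- int m..int r}. w l * (Ln (q l) + of_int l * y))"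

definition p_of :: "nat \<Rightarrow> nat \<Rightarrow> (int \<Rightarrow> complex) \<Rightarrow> complex" where
  "p_of m r w = (\<Sum>l\<in>{- int m..int r}. of_int l * w l)"

definition crit_points ::
  "nat \<Rightarrow> nat \<Rightarrow> (int \<Rightarrow> complex) \<Rightarrow> (int \<Rightarrow> complex) \<Rightarrow> complex set" where
  "crit_points m r w q = exp ` {y. deriv (W m r w q) y = 0}"

definition P_lim :: "nat \<Rightarrow> nat \<Rightarrow> (int \<Rightarrow> complex) \<Rightarrow> nat \<Rightarrow> complex" where
  "P_lim m r w \<beta> = (p_of m r w / of_nat r) powr (1 / of_nat r)
                   * exp (2 * of_real pi * \<i> * of_nat \<beta> / of_nat r)"

text \<open>As \<open>q l \<rightarrow> 0\<close> for \<open>l \<noteq> r\<close>, exactly \<open>r\<close> of the \<open>m + r\<close> critical points have nonzero limits,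
  namely \<open>P_lim m r w \<beta>\<close>.  They are numbered accordingly.\<close>

definition P_crit ::
  "nat \<Rightarrow> nat \<Rightarrow> (int \<Rightarrow> complex) \<Rightarrow> (int \<Rightarrow> complex) \<Rightarrow> nat \<Rightarrow> complex" where
  "P_crit m r w q \<beta> =
     arg_min (\<lambda>P. dist P (P_lim m r w \<beta>)) (\<lambda>P. P \<in> crit_points m r w q)"

definition Delta ::
  "nat \<Rightarrow> nat \<Rightarrow> (int \<Rightarrow> complex) \<Rightarrow> (int \<Rightarrow> complex) \<Rightarrow> nat \<Rightarrow> complex" where
  "Delta m r w q \<alpha> = (deriv ^^ 2) (W m r w q) (Ln (P_crit m r w q \<alpha>))"

text \<open>In the limit \<open>Delta\<close> becomes \<open>r * p\<close>, which is negative for \<open>p < 0\<close>, so that \<open>2 / Delta\<close>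
  approaches the cut of \<^const>\<open>csqrt\<close>.  The branch of the square root of \<open>x\<close> used here is
  \<open>\<i> * csqrt (- x)\<close>: it is continuous near the negative axis and equals \<open>csqrt x\<close> on it.\<close>

definition xi ::
  "nat \<Rightarrow> nat \<Rightarrow> (int \<Rightarrow> complex) \<Rightarrow> (int \<Rightarrow> complex) \<Rightarrow> nat \<Rightarrow> complex \<Rightarrow> complex" where
  "xi m r w q \<alpha> Y =
     1 / \<i> * (\<i> * csqrt (- (2 / Delta m r w q \<alpha>)))
       * (P_crit m r w q \<alpha> / (Y - P_crit m r w q \<alpha>))"

section \<open>Thimbles and the R-matrix\<close>

text \<open>The thimble \<open>\<gamma>\<^sub>\<beta>\<close>, lifted to the \<open>y\<close>-plane and parametrised by the square root of
  \<open>\<bar>W - W(P\<^sub>\<beta>)\<bar>\<close>.  Then \<open>(W(P\<^sub>\<beta>) - W) / z = - t\<^sup>2 / \<bar>z\<bar>\<close>.  For \<open>z > 0\<close> this is the branch of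
  \<open>W\<^sup>-\<^sup>1(W(P\<^sub>\<beta>) + [0,\<infinity>))\<close> through \<open>P\<^sub>\<beta>\<close>; for \<open>z < 0\<close> the values of \<open>W\<close> run through
  \<open>W(P\<^sub>\<beta>) + (-\<infinity>,0]\<close>, which is what convergence of the integral requires and what makes the
  limiting thimble \<open>(0,\<infinity>) P\<^sub>\<beta>\<close> when \<open>p\<close> and \<open>z\<close> are negative.  The orientation is that of
  increasing \<open>\<bar>Y\<bar>\<close> at \<open>P\<^sub>\<beta>\<close>.  Differentiability at all \<open>t\<close> excludes thimbles running into another
  critical point.\<close>

definition thimble ::
  "nat \<Rightarrow> nat \<Rightarrow> (int \<Rightarrow> complex) \<Rightarrow> real \<Rightarrow> (int \<Rightarrow> complex) \<Rightarrow> nat \<Rightarrow> (real \<Rightarrow> complex) \<Rightarrow> bool" where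
  "thimble m r w z q \<beta> \<gamma> \<longleftrightarrow>
     exp (\<gamma> 0) = P_crit m r w q \<beta> \<and>
     (\<forall>t. \<gamma> differentiable (at t)) \<and>
     Re (vector_derivative \<gamma> (at 0)) > 0 \<and>
     (\<forall>t. W m r w q (\<gamma> t) = W m r w q (\<gamma> 0) + of_real (sgn z * t\<^sup>2))"

text \<open>The form \<open>d\<xi>\<^sub>\<alpha>\<close> has a double pole, without residue, at \<open>P\<^sub>\<alpha>\<close>, which lies on \<open>\<gamma>\<^sub>\<alpha>\<close>.  The
  integral over \<open>\<gamma>\<^sub>\<alpha>\<close> is the Hadamard finite part; as the integrand has no residue at the
  pole, this is also the integral over \<open>\<gamma>\<^sub>\<alpha>\<close> pushed off the pole to either side.  If the
  integrand is regular at \<open>0\<close>, then \<open>A = 0\<close> and the value is the ordinary integral.\<close>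

definition fp_integral :: "(real \<Rightarrow> complex) \<Rightarrow> complex" where
  "fp_integral g =
     (let A = Lim (at 0) (\<lambda>t. of_real (t\<^sup>2) * g t)
      in Lim (at_right 0) (\<lambda>\<epsilon>. integral {t. \<epsilon> \<le> \<bar>t\<bar>} g - 2 * A / of_real \<epsilon>))"

definition R_matrix ::
  "nat \<Rightarrow> nat \<Rightarrow> (int \<Rightarrow> complex) \<Rightarrow> real \<Rightarrow> (int \<Rightarrow> complex) \<Rightarrow> nat \<Rightarrow> nat \<Rightarrow> complex" where
  "R_matrix m r w z q \<alpha> \<beta> =
     (let \<gamma> = (SOME \<gamma>. thimble m r w z q \<beta> \<gamma>)
      in of_real (sqrt (- z) / (2 * sqrt pi)) *
         fp_integral (\<lambda>t. exp ((W m r w q (\<gamma> 0) - W m r w q (\<gamma> t)) / of_real z)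
           * vector_derivative (\<lambda>s. xi m r w q \<alpha> (exp (\<gamma> s))) (at t)))"

definition q_lim :: "nat \<Rightarrow> int \<Rightarrow> complex" where
  "q_lim r l = (if l = int r then 1 else 0)"

text \<open>The critical points are assumed distinct, and \<open>\<gamma>\<^sub>\<beta>\<close> must not run into another critical
  point.  The latter excludes only exceptional (Stokes) values of \<open>q\<close> near the limit point.\<close>

definition q_domain ::
  "nat \<Rightarrow> nat \<Rightarrow> (int \<Rightarrow> complex) \<Rightarrow> real \<Rightarrow> nat \<Rightarrow> (int \<Rightarrow> complex) set" where
  "q_domain m r w z \<beta> =
     {q. q (int r) = 1 \<and> (\<forall>l. q l \<noteq> 0 \<longleftrightarrow> l \<in> {- int m..int r}) \<and>
         card (crit_points m r w q) = m + r \<and> (\<exists>\<gamma>. thimble m r w z q \<beta> \<gamma>)}"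

text \<open>The limit is taken in the product topology on \<^typ>\<open>int \<Rightarrow> complex\<close>, that is, all
  \<open>q l\<close> with \<open>l \<noteq> r\<close> tend to \<open>0\<close>.\<close>

definition R_block ::
  "nat \<Rightarrow> nat \<Rightarrow> (int \<Rightarrow> complex) \<Rightarrow> real \<Rightarrow> nat \<Rightarrow> nat \<Rightarrow> complex" where
  "R_block m r w z \<alpha> \<beta> =
     Lim (at (q_lim r) within q_domain m r w z \<beta>) (\<lambda>q. R_matrix m r w z q \<alpha> \<beta>)"

end

theory Submission
  imports Defs "HOL-Real_Asymp.Real_Asymp" "HOL-Computational_Algebra.Fundamental_Theorem_Algebra"
begin

text \<open>
  Fix a critical point \<open>P\<^sub>\<beta> = exp y\<^sub>0\<close> and put \<open>c\<^sub>l = q\<^sub>l P\<^sub>\<beta>\<^sup>l\<close>.  Criticality says \<open>\<Sum> l c\<^sub>l = p\<close>, so the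
  logarithmic terms of the superpotential are absorbed:
  \<open>W (y\<^sub>0 + v) - W y\<^sub>0 = \<Sum> c\<^sub>l (exp (l v) - 1 - l v)\<close>, the phase of the deformation \<open>c\<close>
  (\<open>W_shift\<close>).  For negative \<open>z\<close> a thimble becomes a curve \<open>g\<close> with \<open>g 0 = 0\<close> along which the
  phase equals \<open>- t\<^sup>2\<close>, and \<open>\<xi>\<^sub>\<alpha>\<close> becomes a constant times \<open>\<rho> / (exp g - \<rho>)\<close> with
  \<open>\<rho> = P\<^sub>\<alpha> / P\<^sub>\<beta>\<close>.  At the large radius limit \<open>c\<^sub>r\<close> tends to \<open>p / r\<close> and all other \<open>c\<^sub>l\<close> tend to
  \<open>0\<close>.

  One integration by parts replaces the finite part of the integral of \<open>exp (t\<^sup>2 / z) d\<xi>\<^sub>\<alpha>\<close> by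
  the absolutely convergent integral of \<open>- (2 t / z) exp (t\<^sup>2 / z) \<xi>\<^sub>\<alpha>\<close>
  (\<open>fp_integral_thimble\<close>).  The boundary terms at \<open>0\<close> are exactly compensated by the finite part,
  because \<open>t / (exp (g t) - \<rho>)\<close> is differentiable at \<open>0\<close> even if \<open>\<rho> = 1\<close>.  After this step only
  the position of the thimble matters and not its length.  This is essential: as \<open>q\<close> tends to its
  limit, \<open>m\<close> critical points collapse to \<open>Y = 0\<close>, and nothing is known about the shape of the
  thimble there.  It suffices that the part with large \<open>\<bar>t\<bar>\<close> stays away from \<open>P\<^sub>\<alpha>\<close>, and this
  holds since the real part of the phase is bounded on each vertical line (\<open>eventually_far\<close>).  On
  bounded ranges of \<open>t\<close> the thimbles converge to the real curve \<open>X\<close> with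
  \<open>(- p / r) (exp (r X) - 1 - r X) = t\<^sup>2\<close>, because in the strip \<open>\<bar>Im v\<bar> \<le> \<pi> / r\<close> the limiting
  phase takes values in \<open>(-\<infinity>, 0]\<close> only at real points (\<open>limit_phase_real\<close>,
  \<open>thimble_cluster\<close>).  Dominated convergence gives the limit of the R-matrix.

  In the limiting integral the substitution \<open>t = T x\<close>, where \<open>T\<close> is the inverse of \<open>X\<close>, turns
  \<open>- (2 t / z) dt\<close> into \<open>(p / z) (exp (r x) - 1) dx\<close>.  As \<open>\<omega>\<close>, the limit of \<open>\<rho>\<close>, is an \<open>r\<close>-th
  root of unity, the denominator cancels:
  \<open>(exp (r x) - 1) \<omega> / (exp x - \<omega>) = \<Sum>h<r. \<omega>\<^sup>-\<^sup>h exp (h x)\<close>, and each summand is an Euler integral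
  for \<open>\<Gamma> (\<mu> + h / r)\<close> (\<open>kernel_limit_integral\<close>).

  The limit is taken over a set that really accumulates at the limit point: if all
  \<open>q\<^sub>l P\<^sub>\<beta>\<^sup>l\<close> are negative reals, then on the ray through \<open>P\<^sub>\<beta>\<close> the increment of \<open>W\<close> is real
  and concave in \<open>log \<bar>Y\<bar>\<close>, so that this ray is the thimble; one coefficient is varied to make the critical points
  distinct (\<open>q_lim_islimpt_q_domain\<close>).

  The comparison with the power series of the A-model is Stirling's expansion with a shift.  The
  remainder \<open>\<psi>\<close> of order \<open>N\<close> satisfies \<open>\<psi> (x + 1) - \<psi> x = O (x powr - (N + 2))\<close> by an identity
  between Bernoulli polynomials, and it tends to \<open>0\<close> along \<open>x + n\<close>; hence it is
  \<open>O (x powr - (N + 1))\<close> by telescoping.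
\<close>

section \<open>Formal Stirling series and Bernoulli polynomials\<close>

text \<open>Comparison of coefficients in \<open>(e\<^sup>X - 1) B = X e\<^sup>s\<^sup>X\<close>, where \<open>B\<close> is the exponential generating
  function of the Bernoulli polynomials.  This is their only property that is used below.\<close>

lemma bernoulli_poly_sum:
  "(\<Sum>k\<le>n. of_nat (Suc n choose k) * bernoulli_poly k s) = of_nat (Suc n) * s ^ n"
proof -
  define B where "B = fps_X * fps_exp s / (fps_exp 1 - 1 :: complex fps)"
  define E where "E = (fps_exp 1 - 1 :: complex fps)"
  have E_nth: "fps_nth E j = (if j = 0 then 0 else 1 / fact j)" for j
    by (simp add: E_def)
  have E0: "E \<noteq> 0"
    using E_nth[of 1] by auto
  have sE: "subdegree E = 1"
    by (rule subdegreeI) (auto simp: E_nth)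
  have "B * E = fps_X * fps_exp s"
  proof -
    have nz: "fps_X * fps_exp s \<noteq> (0 :: complex fps)"
      by (metis fps_exp_neq_0 fps_X_neq_zero mult_eq_0_iff)
    have "subdegree (fps_X * fps_exp s :: complex fps) = 1"
      by (rule subdegreeI) auto
    hence "E dvd fps_X * fps_exp s"
      using nz E0 sE by (simp add: fps_dvd_iff)
    thus ?thesis
      unfolding B_def E_def[symmetric] by simp
  qed
  hence "fps_nth (B * E) (Suc n) = s ^ n / fact n"
    by simp
  also have "fps_nth (B * E) (Suc n) = (\<Sum>k\<le>Suc n. fps_nth B k * fps_nth E (Suc n - k))"
    by (simp add: fps_mult_nth atMost_atLeast0)
  also have "\<dots> = (\<Sum>k\<le>n. fps_nth B k / fact (Suc n - k))"
    by (simp add: E_nth Suc_diff_le)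
  finally have "(\<Sum>k\<le>n. fps_nth B k / fact (Suc n - k)) * fact (Suc n) = s ^ n / fact n * fact (Suc n)"
    by simp
  also have "s ^ n / fact n * fact (Suc n) = of_nat (Suc n) * s ^ n"
    by (simp add: field_simps)
  also have "(\<Sum>k\<le>n. fps_nth B k / fact (Suc n - k)) * fact (Suc n) =
      (\<Sum>k\<le>n. of_nat (Suc n choose k) * bernoulli_poly k s)"
    unfolding sum_distrib_right
    by (intro sum.cong refl)
       (auto simp: binomial_fact bernoulli_poly_def B_def[symmetric] Suc_diff_le field_simps simp del: fact_Suc)
  finally show ?thesis .
qed

definition stirling_coeff :: "complex \<Rightarrow> nat \<Rightarrow> complex" where
  "stirling_coeff s t = (if t = 0 then 0 else
     (-1) ^ (t + 1) / (of_nat t * of_nat (t + 1)) * bernoulli_poly (t + 1) s)"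

definition stirling_poly :: "complex \<Rightarrow> nat \<Rightarrow> complex \<Rightarrow> complex" where
  "stirling_poly s N u = (\<Sum>t\<in>{1..N}. stirling_coeff s t * u ^ t)"

lemma bernoulli_poly_0: "bernoulli_poly 0 s = 1"
  using bernoulli_poly_sum[of 0 s] by simp

lemma bernoulli_poly_1: "bernoulli_poly 1 s = s - 1 / 2"
  using bernoulli_poly_sum[of 1 s] by (simp add: bernoulli_poly_0 field_simps)

text \<open>Multiplying by \<open>n (n + 1)\<close> turns \<open>(n - 1 choose t - 1) / (t (t + 1))\<close> into
  \<open>(n + 1 choose t + 1)\<close>, and the sum becomes the recursion for Bernoulli polynomials with its first
  two terms missing.  The left-hand side is the coefficient of \<open>u\<^sup>n\<close> in the difference of the
  Stirling series at \<open>u / (1 + u)\<close> and at \<open>u\<close>.\<close>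

lemma stirling_coeff_sum:
  assumes "n \<ge> 1"
  shows "(\<Sum>t\<in>{1..<n}. stirling_coeff s t * ((-1) ^ (n - t) * of_nat ((n - 1) choose (t - 1)))) =
     (-1) ^ (n + 1) * (s ^ n / of_nat n - (s + 1/2) / of_nat n + 1 / of_nat (n + 1))"
proof -
  have "stirling_coeff s t * ((-1) ^ (n - t) * of_nat ((n - 1) choose (t - 1))) =
      (-1) ^ (n + 1) / (of_nat n * of_nat (n + 1)) *
      (of_nat (Suc n choose Suc t) * bernoulli_poly (Suc t) s)" if t: "t \<in> {1..<n}" for t
  proof -
    obtain t' n' where tn: "t = Suc t'" "n = Suc n'"
      using t by (cases t; cases n) auto
    have "Suc n' * (n' choose t') = Suc t' * (Suc n' choose Suc t')"
      using Suc_times_binomial_eq[of n' t'] by (metis mult.commute)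
    moreover have "Suc (Suc n') * (Suc n' choose Suc t') = Suc (Suc t') * (Suc (Suc n') choose Suc (Suc t'))"
      using Suc_times_binomial_eq[of "Suc n'" "Suc t'"] by (metis mult.commute)
    ultimately have eq: "(Suc n' * Suc (Suc n')) * (n' choose t') =
      (Suc t' * Suc (Suc t')) * (Suc (Suc n') choose Suc (Suc t'))"
      by (metis mult.assoc mult.left_commute)
    have "of_nat ((Suc n' * Suc (Suc n')) * (n' choose t')) =
      (of_nat ((Suc t' * Suc (Suc t')) * (Suc (Suc n') choose Suc (Suc t'))) :: complex)"
      unfolding eq ..
    hence eq2: "of_nat (n' choose t') / (of_nat (Suc t') * of_nat (Suc (Suc t'))) =
      (of_nat (Suc (Suc n') choose Suc (Suc t')) / (of_nat (Suc n') * of_nat (Suc (Suc n'))) :: complex)"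
      unfolding of_nat_mult by (simp add: divide_eq_eq eq_divide_eq del: of_nat_Suc binomial_Suc_Suc) (simp only: mult_ac)
    have sg: "(-1) ^ (t + 1) * (-1) ^ (n - t) = ((-1) ^ (n + 1) :: complex)"
      using t by (simp flip: power_add)
    have "stirling_coeff s t * ((-1) ^ (n - t) * of_nat ((n - 1) choose (t - 1))) =
      ((-1) ^ (t + 1) * (-1) ^ (n - t)) * (of_nat (n' choose t') / (of_nat (Suc t') * of_nat (Suc (Suc t')))) *
       bernoulli_poly (Suc t) s"
      unfolding stirling_coeff_def tn by simp
    also have "\<dots> = (-1) ^ (n + 1) * (of_nat (Suc (Suc n') choose Suc (Suc t')) / (of_nat (Suc n') * of_nat (Suc (Suc n')))) *
       bernoulli_poly (Suc t) s"
      unfolding sg eq2 ..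
    finally show ?thesis
      by (simp add: tn del: of_nat_Suc binomial_Suc_Suc)
  qed
  hence "(\<Sum>t\<in>{1..<n}. stirling_coeff s t * ((-1) ^ (n - t) * of_nat ((n - 1) choose (t - 1)))) =
     (-1) ^ (n + 1) / (of_nat n * of_nat (n + 1)) *
      (\<Sum>t\<in>{1..<n}. of_nat (Suc n choose Suc t) * bernoulli_poly (Suc t) s)"
    by (simp add: sum_distrib_left)
  also have "(\<Sum>t\<in>{1..<n}. of_nat (Suc n choose Suc t) * bernoulli_poly (Suc t) s) =
     (\<Sum>k\<in>{2..n}. of_nat (Suc n choose k) * bernoulli_poly k s)"
    by (rule sum.reindex_bij_witness[of _ "\<lambda>k. k - 1" Suc]) auto
  also have "\<dots> = (\<Sum>k\<le>n. of_nat (Suc n choose k) * bernoulli_poly k s) - 1 - of_nat (n + 1) * (s - 1/2)"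
  proof -
    have "{..n} = insert 0 (insert 1 {2..n})" using assms by auto
    thus ?thesis by (simp add: bernoulli_poly_0 bernoulli_poly_1[simplified])
  qed
  also have "\<dots> = of_nat (n + 1) * s ^ n - 1 - of_nat (n + 1) * (s - 1/2)"
    by (simp add: bernoulli_poly_sum)
  finally have "(\<Sum>t\<in>{1..<n}. stirling_coeff s t * ((-1) ^ (n - t) * of_nat ((n - 1) choose (t - 1)))) =
     (-1) ^ (n + 1) * ((of_nat (n + 1) * s ^ n - 1 - of_nat (n + 1) * (s - 1/2)) / (of_nat n * of_nat (n + 1)))"
    by simp
  also have "(of_nat (n + 1) * s ^ n - 1 - of_nat (n + 1) * (s - 1/2)) / (of_nat n * of_nat (n + 1)) =
     s ^ n / of_nat n - (s + 1/2) / of_nat n + 1 / of_nat (n + 1)"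
  proof -
    have nz: "(of_nat n :: complex) \<noteq> 0" "(of_nat (n + 1) :: complex) \<noteq> 0"
      using assms by (simp_all only: of_nat_eq_0_iff)
    have n1: "(of_nat (n + 1) :: complex) = of_nat n + 1" by simp
    have "(of_nat n + 1 :: complex) \<noteq> 0" using nz n1 by metis
    thus ?thesis using nz(1) unfolding n1 by (simp add: divide_simps) (simp add: algebra_simps)
  qed
  finally show ?thesis .
qed

lemma has_fps_expansion_Ln_1_plus:
  "(\<lambda>u. Ln (1 + c * u)) has_fps_expansion Abs_fps (\<lambda>n. (-1) ^ Suc n / of_nat n * c ^ n)"
proof (rule has_fps_expansionI)
  have "((\<lambda>u. norm (c * u)) \<longlongrightarrow> 0) (nhds 0)"
    by (auto intro!: tendsto_eq_intros simp: filterlim_ident)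
  hence "eventually (\<lambda>u. norm (c * u) < 1) (nhds 0)"
    by (rule order_tendstoD) auto
  thus "eventually (\<lambda>u. (\<lambda>n. fps_nth (Abs_fps (\<lambda>n. (-1) ^ Suc n / of_nat n * c ^ n)) n * u ^ n) sums Ln (1 + c * u)) (nhds 0)"
  proof eventually_elim
    case (elim u)
    show ?case using Ln_series[OF elim] by (simp add: power_mult_distrib mult_ac)
  qed
qed

lemma has_fps_expansion_shifted_power:
  "(\<lambda>u. (u / (1 + u)) ^ t) has_fps_expansion (fps_X ^ t * fps_binomial (- of_nat t) :: complex fps)"
proof -
  have "(\<lambda>u. u ^ t * (1 + u) powr (- of_nat t)) has_fps_expansion (fps_X ^ t * fps_binomial (- of_nat t) :: complex fps)"
    by (intro fps_expansion_intros)
  moreover have "eventually (\<lambda>u::complex. u \<in> ball 0 1) (nhds 0)"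
    by (intro eventually_nhds_in_open) auto
  hence "eventually (\<lambda>u::complex. u ^ t * (1 + u) powr (- of_nat t) = (u / (1 + u)) ^ t) (nhds 0)"
  proof eventually_elim
    case (elim u)
    hence "1 + u \<noteq> 0"
      by (metis add_eq_0_iff2 dist_0_norm mem_ball norm_minus_cancel norm_one order_less_irrefl)
    thus ?case by (simp add: powr_minus powr_nat' field_simps)
  qed
  ultimately show ?thesis by (subst (asm) has_fps_expansion_cong) auto
qed

lemma shifted_power_nth:
  assumes "t \<ge> 1"
  shows "fps_nth (fps_X ^ t * fps_binomial (- of_nat t) :: complex fps) n =
    (if n < t then 0 else (-1) ^ (n - t) * of_nat ((n - 1) choose (t - 1)))"
proof (cases "n < t")
  case False
  have "((- of_nat t :: complex) gchoose (n - t)) = (-1) ^ (n - t) * ((of_nat t + of_nat (n - t) - 1) gchoose (n - t))"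
    by (simp add: gbinomial_minus)
  also have "(of_nat t + of_nat (n - t) - 1 :: complex) = of_nat (n - 1)"
    using False assms by (simp add: of_nat_diff)
  also have "(of_nat (n - 1) gchoose (n - t) :: complex) = of_nat ((n - 1) choose (n - t))"
    by (simp add: binomial_gbinomial)
  also have "(n - 1) choose (n - t) = (n - 1) choose (t - 1)"
    using False assms by (subst binomial_symmetric) (auto intro: arg_cong2)
  finally show ?thesis using False by (simp add: fps_X_power_mult_nth)
qed (simp add: fps_X_power_mult_nth)

lemma has_fps_expansion_bigo:
  fixes F :: "complex fps"
  assumes "f has_fps_expansion F" and "\<And>n. n < M \<Longrightarrow> fps_nth F n = 0"
  shows "f \<in> O[at 0](\<lambda>u. u ^ M)"
proof (cases "F = 0")
  case True
  hence "eventually (\<lambda>z. f z = 0) (nhds 0)" using assms has_fps_expansion_0_iff by blast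
  hence "eventually (\<lambda>z. f z = 0) (at 0)" by (simp add: eventually_nhds_conv_at)
  thus ?thesis by (simp add: bigo_def) (auto elim!: eventually_mono intro!: exI[of _ 1])
next
  case False
  hence "M \<le> subdegree F" using assms(2) by (meson leI nth_subdegree_nonzero)
  hence "(\<lambda>x. if x = 0 then fps_nth F M else f x / x ^ M) has_fps_expansion fps_shift M F"
    by (intro fps_expansion_intros assms) auto
  hence "isCont (\<lambda>x. if x = 0 then fps_nth F M else f x / x ^ M) 0"
    by (rule has_fps_expansion_imp_continuous)
  hence "((\<lambda>x. if x = 0 then fps_nth F M else f x / x ^ M) \<longlongrightarrow> fps_nth F M) (at 0)"
    by (simp add: isCont_def)
  also have "?this \<longleftrightarrow> ((\<lambda>x. f x / x ^ M) \<longlongrightarrow> fps_nth F M) (at 0)"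
    by (intro filterlim_cong refl) (auto simp: eventually_at_filter)
  finally have lim: "((\<lambda>x. f x / x ^ M) \<longlongrightarrow> fps_nth F M) (at 0)" .
  have "eventually (\<lambda>u::complex. u ^ M \<noteq> 0) (at 0)"
    by (rule eventually_mono[OF eventually_neq_at_within[of 0]]) simp
  with lim show ?thesis by (rule bigoI_tendsto)
qed

text \<open>In the variable \<open>u = 1 / x\<close> the shift \<open>x \<mapsto> x + 1\<close> is \<open>u \<mapsto> u / (1 + u)\<close>, and the
  logarithmic terms form \<open>u\<close> times the difference of \<open>log \<Gamma> (x + s) - (x + s - 1/2) log x + x\<close>
  between \<open>x + 1\<close> and \<open>x\<close>.  The factor \<open>u\<close> makes all terms analytic at \<open>0\<close>.\<close>

lemma stirling_shift_bigo:
  fixes s :: complex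
  shows "(\<lambda>u. u * (stirling_poly s N (u / (1 + u)) - stirling_poly s N u)
            - (u * Ln (1 + s * u) - (1 + (s + 1/2) * u) * Ln (1 + u) + u))
         \<in> O[at 0](\<lambda>u. u ^ (N + 3))"
proof -
  define L where "L = (\<lambda>c::complex. Abs_fps (\<lambda>n. (-1) ^ Suc n / of_nat n * c ^ n))"
  define F where "F = fps_X * ((\<Sum>t\<in>{1..N}. fps_const (stirling_coeff s t) * (fps_X ^ t * fps_binomial (- of_nat t)))
      - (\<Sum>t\<in>{1..N}. fps_const (stirling_coeff s t) * fps_X ^ t))
      - (fps_X * L s - (1 + fps_const (s + 1/2) * fps_X) * L 1 + fps_X)"
  have L1: "(\<lambda>u. Ln (1 + u)) has_fps_expansion L 1"
    using has_fps_expansion_Ln_1_plus[of 1] by (simp add: L_def)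
  have Ls: "(\<lambda>u. Ln (1 + s * u)) has_fps_expansion L s"
    using has_fps_expansion_Ln_1_plus[of s] by (simp add: L_def)
  have "(\<lambda>u. u * (stirling_poly s N (u / (1 + u)) - stirling_poly s N u)
            - (u * Ln (1 + s * u) - (1 + (s + 1/2) * u) * Ln (1 + u) + u)) has_fps_expansion F"
    unfolding F_def stirling_poly_def
    by (intro fps_expansion_intros L1 Ls has_fps_expansion_shifted_power)
  moreover have "fps_nth F n = 0" if "n < N + 3" for n
  proof (cases n)
    case 0
    thus ?thesis by (simp add: F_def L_def)
  next
    case (Suc k)
    have dist: "(1 + fps_const (s + 1/2) * fps_X) * L 1 = L 1 + fps_X * (fps_const (s + 1/2) * L 1)"
      by (simp add: algebra_simps)
    have F_nth: "fps_nth F (Suc k) =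
      (\<Sum>t\<in>{1..N}. stirling_coeff s t * (if k < t then 0 else (-1) ^ (k - t) * of_nat ((k - 1) choose (t - 1))))
      - (\<Sum>t\<in>{1..N}. stirling_coeff s t * (if k = t then 1 else 0))
      - (fps_nth (L s) k - fps_nth (L 1) (Suc k) - (s + 1/2) * fps_nth (L 1) k + (if k = 0 then 1 else 0))"
      unfolding F_def dist
      by (simp add: fps_sum_nth shifted_power_nth fps_X_power_nth del: fps_const_add)
    show ?thesis
    proof (cases "k = 0")
      case True
      thus ?thesis using Suc F_nth by (simp add: L_def)
    next
      case False
      have "(\<Sum>t\<in>{1..N}. stirling_coeff s t * (if k < t then 0 else (-1) ^ (k - t) * of_nat ((k - 1) choose (t - 1))))
        - (\<Sum>t\<in>{1..N}. stirling_coeff s t * (if k = t then 1 else 0))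
        = (\<Sum>t\<in>{1..N}. if t \<in> {1..<k} then stirling_coeff s t * ((-1) ^ (k - t) * of_nat ((k - 1) choose (t - 1))) else 0)"
        unfolding sum_subtractf[symmetric] by (intro sum.cong) auto
      also have "\<dots> = (\<Sum>t\<in>{1..<k}. stirling_coeff s t * ((-1) ^ (k - t) * of_nat ((k - 1) choose (t - 1))))"
        using that Suc by (subst sum.inter_restrict[symmetric]) (auto intro!: sum.cong)
      also have "\<dots> = (-1) ^ (k + 1) * (s ^ k / of_nat k - (s + 1/2) / of_nat k + 1 / of_nat (k + 1))"
        using False by (intro stirling_coeff_sum) auto
      also have "\<dots> = fps_nth (L s) k - fps_nth (L 1) (Suc k) - (s + 1/2) * fps_nth (L 1) k"
        using False by (simp add: L_def field_simps)
      finally show ?thesis using F_nth Suc False by simp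
    qed
  qed
  ultimately show ?thesis by (rule has_fps_expansion_bigo)
qed

section \<open>Stirling expansion of the Gamma function\<close>

text \<open>The quantity whose limit is \<open>log (2 \<pi>) / 2\<close> and whose asymptotic expansion is the Stirling
  series.\<close>

definition stirling_log :: "real \<Rightarrow> real \<Rightarrow> real" where
  "stirling_log s x = ln (Gamma (x + s)) - (x + s - 1/2) * ln x + x"

lemma stirling_log_step:
  assumes "x > 0" "s \<ge> 0"
  shows "stirling_log s (x + 1) - stirling_log s x =
    ln (x + s) - (x + s + 1/2) * ln (x + 1) + (x + s - 1/2) * ln x + 1"
proof -
  have "x + s \<notin> \<int>\<^sub>\<le>\<^sub>0" using assms by (auto dest: nonpos_Ints_nonpos)
  hence "Gamma (x + 1 + s) = (x + s) * Gamma (x + s)"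
    using Gamma_plus1[of "x + s"] by (simp add: add_ac)
  moreover have "Gamma (x + s) \<noteq> 0" using Gamma_real_pos[of "x + s"] assms by linarith
  ultimately have "ln (Gamma (x + 1 + s)) = ln (x + s) + ln (Gamma (x + s))"
    using assms by (simp add: ln_mult)
  thus ?thesis by (simp add: stirling_log_def algebra_simps)
qed

definition stirling_remainder :: "real \<Rightarrow> nat \<Rightarrow> real \<Rightarrow> complex" where
  "stirling_remainder s N x =
     of_real (stirling_log s x - ln (2 * pi) / 2) - stirling_poly (of_real s) N (1 / of_real x)"

lemma filterlim_inverse_of_real_at_0:
  "filterlim (\<lambda>x::real. 1 / complex_of_real x) (at 0) at_top"
proof (rule filterlim_atI)
  have "((\<lambda>x::real. complex_of_real (1 / x)) \<longlongrightarrow> of_real 0) at_top"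
    by (intro tendsto_of_real) real_asymp
  thus "((\<lambda>x::real. 1 / complex_of_real x) \<longlongrightarrow> 0) at_top" by simp
  show "eventually (\<lambda>x::real. 1 / complex_of_real x \<noteq> 0) at_top"
    using eventually_gt_at_top[of 0] by eventually_elim auto
qed

text \<open>The formal identity evaluated at \<open>u = 1 / x\<close>: dividing by the extra factor \<open>u\<close> lowers the
  order from \<open>N + 3\<close> to \<open>N + 2\<close>.\<close>

lemma stirling_remainder_step:
  fixes s :: real
  assumes s: "s \<ge> 0"
  obtains C x0 where "C > 0" "x0 \<ge> 2"
    "\<And>x. x \<ge> x0 \<Longrightarrow> norm (stirling_remainder s N (x + 1) - stirling_remainder s N x) \<le> C / x ^ (N + 2)"
proof -
  define E where "E = (\<lambda>u::complex. u * (stirling_poly s N (u / (1 + u)) - stirling_poly s N u)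
            - (u * Ln (1 + s * u) - (1 + (s + 1/2) * u) * Ln (1 + u) + u))"
  have "E \<in> O[at 0](\<lambda>u. u ^ (N + 3))"
    using stirling_shift_bigo[of "of_real s" N] by (simp add: E_def)
  then obtain C where C: "C > 0" "eventually (\<lambda>u. norm (E u) \<le> C * norm (u ^ (N + 3))) (at 0)"
    by (elim landau_o.bigE)
  have "eventually (\<lambda>x::real. norm (E (1 / of_real x)) \<le> C * norm ((1 / complex_of_real x) ^ (N + 3))) at_top"
    using eventually_compose_filterlim[OF C(2) filterlim_inverse_of_real_at_0] .
  then obtain x1 where x1: "\<And>x. x \<ge> x1 \<Longrightarrow> norm (E (1 / of_real x)) \<le> C * norm ((1 / complex_of_real x) ^ (N + 3))"
    unfolding eventually_at_top_linorder by blast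
  show ?thesis
  proof (rule that[of C "max x1 2"])
    fix x :: real assume x: "x \<ge> max x1 2"
    have sh: "1 / complex_of_real x / (1 + 1 / complex_of_real x) = 1 / of_real (x + 1)"
    proof -
      have "complex_of_real (1 / x / (1 + 1 / x)) = of_real (1 / (x + 1))"
        using x by (simp add: field_simps)
      thus ?thesis by simp
    qed
    have ln1: "Ln (1 + of_real s * (1 / complex_of_real x)) = of_real (ln (x + s) - ln x)"
    proof -
      have eq: "(1 + of_real s * (1 / complex_of_real x)) = of_real ((x + s) / x)"
        using x by (simp add: field_simps)
      have "(x + s) / x > 0" using x s by (intro divide_pos_pos) auto
      from Ln_of_real[OF this] show ?thesis using x s unfolding eq by (simp add: ln_div)
    qed
    have ln2: "Ln (1 + (1 / complex_of_real x)) = of_real (ln (x + 1) - ln x)"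
    proof -
      have eq: "(1 + (1 / complex_of_real x)) = of_real ((x + 1) / x)"
        using x by (simp add: field_simps)
      have "(x + 1) / x > 0" using x by (intro divide_pos_pos) auto
      from Ln_of_real[OF this] show ?thesis using x unfolding eq by (simp add: ln_div)
    qed
    have "stirling_remainder s N (x + 1) - stirling_remainder s N x =
      of_real (ln (x + s) - (x + s + 1/2) * ln (x + 1) + (x + s - 1/2) * ln x + 1)
       - (stirling_poly (of_real s) N (1 / of_real (x + 1)) - stirling_poly (of_real s) N (1 / of_real x))"
      using stirling_log_step[of x s] x s
      by (simp add: stirling_remainder_def algebra_simps flip: of_real_add of_real_diff of_real_mult)
    also have "\<dots> = - of_real x * E (1 / of_real x)"
      unfolding E_def sh ln1 ln2 using x by (simp add: field_simps)
    finally have "norm (stirling_remainder s N (x + 1) - stirling_remainder s N x) = x * norm (E (1 / of_real x))"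
      using x by (simp add: norm_mult)
    also have "\<dots> \<le> x * (C * norm ((1 / complex_of_real x) ^ (N + 3)))"
      using x x1[of x] by (intro mult_left_mono) auto
    also have "norm ((1 / complex_of_real x) ^ (N + 3)) = 1 / x ^ (N + 3)"
      using x by (simp add: norm_power norm_divide power_one_over)
    also have "x * (C * (1 / x ^ (N + 3))) = C / x ^ (N + 2)"
      using x by (simp add: norm_power norm_divide field_simps power_add power2_eq_square power3_eq_cube)
    finally show "norm (stirling_remainder s N (x + 1) - stirling_remainder s N x) \<le> C / x ^ (N + 2)" .
  qed (use C in auto)
qed

text \<open>The tail \<open>\<Sum> 1 / (x + i)\<^sup>N\<^sup>+\<^sup>2\<close> is at most \<open>x\<^sup>-\<^sup>N\<close> times the telescoping sum of
  \<open>1 / (x + i - 1) - 1 / (x + i)\<close>.\<close>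

lemma telescoping_bound:
  fixes f :: "real \<Rightarrow> complex"
  assumes step: "\<And>x. x \<ge> x0 \<Longrightarrow> norm (f (x + 1) - f x) \<le> C / x ^ (N + 2)"
    and lim: "\<And>x. x \<ge> x0 \<Longrightarrow> (\<lambda>n. f (x + real n)) \<longlonglongrightarrow> 0"
    and "x0 \<ge> 2" "C > 0" "x \<ge> x0"
  shows "norm (f x) \<le> 2 * C / x ^ (N + 1)"
proof -
  have x: "x \<ge> 2" using assms by simp
  have bound: "norm (f (x + real n) - f x) \<le> C / x ^ N * (1 / (x - 1) - 1 / (x + real n - 1))" for n
  proof (induction n)
    case (Suc n)
    have "norm (f (x + real (Suc n)) - f x) \<le> norm (f (x + real n + 1) - f (x + real n)) + norm (f (x + real n) - f x)"
      using norm_triangle_ineq[of "f (x + real n + 1) - f (x + real n)" "f (x + real n) - f x"]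
      by (simp add: add_ac)
    also have "norm (f (x + real n + 1) - f (x + real n)) \<le> C / (x + real n) ^ (N + 2)"
      using assms by (intro step) auto
    also have "\<dots> = C / ((x + real n) ^ N * (x + real n)\<^sup>2)"
      by (simp only: power_add)
    also have "\<dots> \<le> C / (x ^ N * (x + real n)\<^sup>2)"
      using x \<open>C > 0\<close> by (intro divide_left_mono mult_right_mono power_mono mult_pos_pos zero_less_power) auto
    also have "\<dots> = C / x ^ N * (1 / (x + real n)\<^sup>2)" by simp
    also have "\<dots> \<le> C / x ^ N * (1 / (x + real n - 1) - 1 / (x + real n))"
    proof (intro mult_left_mono)
      define y where "y = x + real n"
      have y: "y \<ge> 2" using x by (simp add: y_def)
      have "1 / y\<^sup>2 \<le> 1 / ((y - 1) * y)"
        using y by (intro divide_left_mono) (auto simp: power2_eq_square)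
      also have "\<dots> = 1 / (y - 1) - 1 / y" using y by (simp add: field_simps)
      finally show "1 / (x + real n)\<^sup>2 \<le> 1 / (x + real n - 1) - 1 / (x + real n)" by (simp add: y_def)
    qed (use x \<open>C > 0\<close> in auto)
    finally show ?case using Suc.IH by (simp add: algebra_simps)
  qed simp
  have "norm (f (x + real n) - f x) \<le> C / x ^ N * (1 / (x - 1))" for n
  proof -
    have "C / x ^ N * (1 / (x - 1) - 1 / (x + real n - 1)) \<le> C / x ^ N * (1 / (x - 1))"
      using x \<open>C > 0\<close> by (intro mult_left_mono) auto
    thus ?thesis using bound[of n] by linarith
  qed
  moreover have "(\<lambda>n. norm (f (x + real n) - f x)) \<longlonglongrightarrow> norm (0 - f x)"
    by (intro tendsto_intros lim assms)
  ultimately have "norm (0 - f x) \<le> C / x ^ N * (1 / (x - 1))"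
    by (intro tendsto_upperbound) auto
  also have "\<dots> \<le> C / x ^ N * (2 / x)"
    using x \<open>C > 0\<close> by (intro mult_left_mono) (auto simp: field_simps)
  finally show ?thesis by (simp add: field_simps)
qed

text \<open>The logarithm of Euler's limit formula for the Gamma function.\<close>

lemma ln_Gamma_ratio_tendsto:
  fixes z :: real
  assumes "z > 0"
  shows "(\<lambda>n. ln (Gamma (z + real (Suc n))) - ln (Gamma (real (Suc n))) - z * ln (real n)) \<longlonglongrightarrow> 0"
proof -
  have "(\<lambda>n. ln (Gamma z) - ln (Gamma_series z n)) \<longlonglongrightarrow> ln (Gamma z) - ln (Gamma z)"
    by (intro tendsto_intros less_imp_neq[THEN not_sym] Gamma_real_pos assms)
  moreover have "eventually (\<lambda>n. ln (Gamma z) - ln (Gamma_series z n) =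
      ln (Gamma (z + real (Suc n))) - ln (Gamma (real (Suc n))) - z * ln (real n)) sequentially"
    using eventually_gt_at_top[of 0]
  proof eventually_elim
    case (elim n)
    have z: "z \<notin> \<int>\<^sub>\<le>\<^sub>0" using assms by (auto dest: nonpos_Ints_nonpos)
    have G: "Gamma z \<noteq> 0" "Gamma (z + real (Suc n)) \<noteq> 0" "Gamma (real (Suc n)) \<noteq> 0"
      using assms Gamma_real_pos[of z] Gamma_real_pos[of "z + real (Suc n)"] Gamma_real_pos[of "real (Suc n)"]
      by linarith+
    have "Gamma_series z n = Gamma (real (Suc n)) * exp (z * ln (real n)) * Gamma z / Gamma (z + real (Suc n))"
      by (simp add: Gamma_series_def pochhammer_Gamma[OF z] Gamma_fact[symmetric] add_ac)
    thus ?case using G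
      by (simp add: ln_mult ln_div del: of_nat_Suc)
  qed
  ultimately show ?thesis by (simp add: filterlim_cong del: of_nat_Suc)
qed

lemma stirling_log_shift:
  assumes "x \<ge> 0" "s \<ge> 0" "x + s > 0"
  shows "(\<lambda>n. stirling_log s (x + real (Suc n)) - stirling_log 0 (real (Suc n))) \<longlonglongrightarrow> 0"
proof -
  have "(\<lambda>n. (x + s) * ln (real n) - (x + real n + s + 1/2) * ln (x + real n + 1) + (real n + 1/2) * ln (real n + 1) + x)
     \<longlonglongrightarrow> 0"
    by real_asymp
  from tendsto_add[OF ln_Gamma_ratio_tendsto[OF assms(3)] this]
  show ?thesis
    by (simp add: stirling_log_def algebra_simps)
qed

text \<open>Successive differences at integers are \<open>O (n\<^sup>-\<^sup>2)\<close>, so a limit \<open>c\<close> exists for \<open>s = 0\<close> along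
  the integers; Euler's formula transports it to all \<open>x\<close> and \<open>s\<close>.  The value of \<open>c\<close> comes from
  Legendre's duplication formula, in which \<open>c + c - c\<close> equals \<open>log (2 \<pi>) / 2\<close>.\<close>

lemma stirling_log_tendsto:
  assumes "x \<ge> 0" "s \<ge> 0" "x + s > 0"
  shows "(\<lambda>n. stirling_log s (x + real n)) \<longlonglongrightarrow> ln (2 * pi) / 2"
proof -
  obtain C x0 where C: "C > 0" "x0 \<ge> 2"
    "\<And>x. x \<ge> x0 \<Longrightarrow> norm (stirling_remainder 0 0 (x + 1) - stirling_remainder 0 0 x) \<le> C / x ^ (0 + 2)"
    using stirling_remainder_step[of 0 0] by (metis order_refl)
  have st: "\<bar>stirling_log 0 (x + 1) - stirling_log 0 x\<bar> \<le> C / x ^ 2" if "x \<ge> x0" for x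
  proof -
    have "stirling_remainder 0 0 (x + 1) - stirling_remainder 0 0 x =
        of_real (stirling_log 0 (x + 1) - stirling_log 0 x)"
      by (simp add: stirling_remainder_def stirling_poly_def)
    hence "norm (stirling_remainder 0 0 (x + 1) - stirling_remainder 0 0 x) =
        \<bar>stirling_log 0 (x + 1) - stirling_log 0 x\<bar>"
      by (simp only: norm_of_real)
    thus ?thesis using C(3)[OF that] by (simp add: power2_eq_square)
  qed
  have "summable (\<lambda>n. stirling_log 0 (real (Suc n)) - stirling_log 0 (real n))"
  proof (rule summable_comparison_test_ev)
    show "eventually (\<lambda>n. norm (stirling_log 0 (real (Suc n)) - stirling_log 0 (real n)) \<le> C * inverse (real n ^ 2)) sequentially"
      using eventually_ge_at_top[of "nat \<lceil>x0\<rceil>"]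
    proof eventually_elim
      case (elim n)
      hence "real n \<ge> x0" by linarith
      from st[OF this] show ?case by (simp add: field_simps)
    qed
    show "summable (\<lambda>n. C * inverse (real n ^ 2))"
      by (intro summable_mult inverse_power_summable) auto
  qed
  hence "convergent (\<lambda>n. \<Sum>i<n. stirling_log 0 (real (Suc i)) - stirling_log 0 (real i))"
    by (simp add: summable_iff_convergent)
  hence "convergent (\<lambda>n. stirling_log 0 (real n) - stirling_log 0 0)"
    by (simp add: sum_lessThan_telescope[of "\<lambda>n. stirling_log 0 (real n)", simplified])
  then obtain l where "(\<lambda>n. stirling_log 0 (real n) - stirling_log 0 0) \<longlonglongrightarrow> l"
    by (auto simp: convergent_def)
  from tendsto_add[OF this tendsto_const[of "stirling_log 0 0"]]
  obtain c where c: "(\<lambda>n. stirling_log 0 (real n)) \<longlonglongrightarrow> c" by auto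
  have gen: "(\<lambda>n. stirling_log s (x + real n)) \<longlonglongrightarrow> c" if "x \<ge> 0" "s \<ge> 0" "x + s > 0" for x s
  proof -
    have "(\<lambda>n. stirling_log s (x + real (Suc n))) \<longlonglongrightarrow> c"
      using tendsto_add[OF stirling_log_shift[OF that] LIMSEQ_Suc[OF c]] by (simp del: of_nat_Suc)
    thus ?thesis by (rule LIMSEQ_imp_Suc)
  qed
  have half: "(\<lambda>n. stirling_log (1/2) (real n)) \<longlonglongrightarrow> c" using gen[of 0 "1/2"] by simp
  have dbl: "(\<lambda>n. stirling_log 0 (real (2 * n))) \<longlonglongrightarrow> c"
    by (rule filterlim_compose[OF c]) (simp add: filterlim_at_top_mult_tendsto_pos filterlim_subseq strict_mono_def)
  \<comment> \<open>Duplication formula at \<open>z = n\<close>, where all three terms have the same limit.\<close>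
  have "(\<lambda>n. stirling_log 0 (real n) + stirling_log (1/2) (real n) - stirling_log 0 (real (2 * n))) \<longlonglongrightarrow> c + c - c"
    by (intro tendsto_intros c half dbl)
  moreover have "eventually (\<lambda>n. stirling_log 0 (real n) + stirling_log (1/2) (real n) - stirling_log 0 (real (2 * n))
      = ln (2 * pi) / 2) sequentially"
    using eventually_gt_at_top[of 0]
  proof eventually_elim
    case (elim n)
    define y where "y = real n"
    have y: "y > 0" using elim by (simp add: y_def)
    have ny: "complex_of_real y \<notin> \<int>\<^sub>\<le>\<^sub>0" "complex_of_real y + 1 / 2 \<notin> \<int>\<^sub>\<le>\<^sub>0"
      using y by (auto dest!: nonpos_Ints_nonpos simp: complex_nonpos_Reals_iff elim!: nonpos_Ints_cases simp: complex_eq_iff)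
    have "Gamma (complex_of_real y) * Gamma (complex_of_real y + 1/2) =
        exp ((1 - 2 * complex_of_real y) * of_real (ln 2)) * of_real (sqrt pi) * Gamma (2 * complex_of_real y)"
      by (rule Gamma_legendre_duplication[OF ny])
    hence "complex_of_real (Gamma y * Gamma (y + 1/2)) =
        of_real (exp ((1 - 2 * y) * ln 2) * sqrt pi * Gamma (2 * y))"
      by (simp flip: Gamma_complex_of_real exp_of_real)
    hence "Gamma y * Gamma (y + 1/2) = exp ((1 - 2 * y) * ln 2) * sqrt pi * Gamma (2 * y)"
      by (simp only: of_real_eq_iff)
    hence "ln (Gamma y * Gamma (y + 1/2)) = ln (exp ((1 - 2 * y) * ln 2) * sqrt pi * Gamma (2 * y))"
      by simp
    moreover have "Gamma y > 0" "Gamma (y + 1/2) > 0" "Gamma (2 * y) > 0" using y by auto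
    ultimately have "ln (Gamma y) + ln (Gamma (y + 1/2)) = (1 - 2 * y) * ln 2 + ln pi / 2 + ln (Gamma (2 * y))"
      by (simp add: ln_mult ln_sqrt)
    moreover have "ln (2 * y) = ln 2 + ln y" "ln (2 * pi) = ln 2 + ln pi" using y by (simp_all add: ln_mult)
    ultimately show ?case
      unfolding stirling_log_def of_nat_mult y_def[symmetric] by (simp add: algebra_simps)
  qed
  ultimately have "(\<lambda>n::nat. ln (2 * pi) / 2) \<longlonglongrightarrow> c + c - c"
    by (rule Lim_transform_eventually)
  hence "(\<lambda>n::nat. ln (2 * pi) / 2) \<longlonglongrightarrow> c" by simp
  hence "c = ln (2 * pi) / 2" using LIMSEQ_unique tendsto_const by blast
  thus ?thesis using gen[OF assms] by (simp only:)
qed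

lemma stirling_remainder_bound:
  assumes s: "s \<ge> 0"
  obtains C x0 where "C > 0" "x0 \<ge> 2"
    "\<And>x. x \<ge> x0 \<Longrightarrow> norm (stirling_remainder s N x) \<le> C / x ^ (N + 1)"
proof -
  obtain C x0 where C: "C > 0" "x0 \<ge> 2"
    "\<And>x. x \<ge> x0 \<Longrightarrow> norm (stirling_remainder s N (x + 1) - stirling_remainder s N x) \<le> C / x ^ (N + 2)"
    using stirling_remainder_step[OF s, of N] by metis
  have lim: "(\<lambda>n. stirling_remainder s N (x + real n)) \<longlonglongrightarrow> 0" if x: "x \<ge> x0" for x
  proof -
    have inf: "(\<lambda>n. 1 / complex_of_real (x + real n)) \<longlonglongrightarrow> 0"
    proof -
      have "(\<lambda>n. complex_of_real (1 / (x + real n))) \<longlonglongrightarrow> of_real 0"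
        by (intro tendsto_of_real) real_asymp
      thus ?thesis by simp
    qed
    have "(\<lambda>n. stirling_remainder s N (x + real n)) \<longlonglongrightarrow>
       of_real (ln (2 * pi) / 2 - ln (2 * pi) / 2) - (\<Sum>t\<in>{1..N}. stirling_coeff (of_real s) t * 0 ^ t)"
      unfolding stirling_remainder_def stirling_poly_def
      using x C s by (intro tendsto_intros inf stirling_log_tendsto) auto
    moreover have "(\<Sum>t\<in>{1..N}. stirling_coeff (of_real s) t * 0 ^ t) = 0"
      by (intro sum.neutral) auto
    ultimately show ?thesis by simp
  qed
  show ?thesis
    using telescoping_bound[OF C(3) lim C(2,1)] C by (intro that[of "2 * C" x0]) auto
qed

section \<open>Asymptotic expansion of the A-model block\<close>

lemma fps_power_nth_cong:
  fixes A B :: "'a :: comm_ring_1 fps"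
  assumes "\<And>j. j \<le> k \<Longrightarrow> fps_nth A j = fps_nth B j" "j \<le> k"
  shows "fps_nth (A ^ i) j = fps_nth (B ^ i) j"
  using assms(2)
proof (induction i arbitrary: j)
  case (Suc i)
  have "fps_nth (A ^ Suc i) j = (\<Sum>l=0..j. fps_nth A l * fps_nth (A ^ i) (j - l))"
    by (simp add: fps_mult_nth)
  also have "\<dots> = (\<Sum>l=0..j. fps_nth B l * fps_nth (B ^ i) (j - l))"
    using Suc.prems by (intro sum.cong refl arg_cong2[of _ _ _ _ "(*)"] assms Suc.IH) auto
  finally show ?case by (simp add: fps_mult_nth)
qed simp

lemma fps_compose_nth_cong:
  fixes A B F :: "'a :: comm_ring_1 fps"
  assumes "\<And>j. j \<le> k \<Longrightarrow> fps_nth A j = fps_nth B j"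
  shows "fps_nth (F oo A) k = fps_nth (F oo B) k"
  unfolding fps_compose_nth using fps_power_nth_cong[OF assms] by simp

text \<open>A coefficient of \<open>exp \<circ> S\<close> depends only on the coefficients of \<open>S\<close> up to the same index.  Hence
  the truncated Stirling polynomial, which converges, has the same leading coefficients after
  exponentiation as the divergent series.\<close>

lemma exp_stirling_poly_expansion:
  "(\<lambda>u. exp (stirling_poly s N u) - (\<Sum>k<N. fps_nth (fps_exp 1 oo Abs_fps (stirling_coeff s)) k * u ^ k))
     \<in> O[at 0](\<lambda>u. u ^ N)"
proof -
  define S where "S = (\<Sum>t\<in>{1..N}. fps_const (stirling_coeff s t) * fps_X ^ t)"
  have S_nth: "fps_nth S k = (if k \<le> N then stirling_coeff s k else 0)" for k
  proof -
    have "fps_nth S k = (\<Sum>t\<in>{1..N}. if t = k then stirling_coeff s t else 0)"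
      unfolding S_def fps_sum_nth by (intro sum.cong refl) (auto simp: fps_X_power_nth)
    also have "\<dots> = (if k \<le> N then stirling_coeff s k else 0)"
      by (simp add: sum.delta stirling_coeff_def)
    finally show ?thesis .
  qed
  have "stirling_poly s N has_fps_expansion S"
    unfolding S_def stirling_poly_def by (intro fps_expansion_intros)
  moreover have "fps_nth S 0 = 0" by (simp add: S_nth stirling_coeff_def)
  ultimately have "(exp \<circ> stirling_poly s N) has_fps_expansion (fps_exp 1 oo S)"
    by (intro has_fps_expansion_compose has_fps_expansion_exp1)
  hence "(\<lambda>u. exp (stirling_poly s N u) - (\<Sum>k<N. fps_nth (fps_exp 1 oo Abs_fps (stirling_coeff s)) k * u ^ k))
     has_fps_expansion (fps_exp 1 oo S) - (\<Sum>k<N. fps_const (fps_nth (fps_exp 1 oo Abs_fps (stirling_coeff s)) k) * fps_X ^ k)"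
    by (intro fps_expansion_intros) (simp add: o_def)
  moreover have "fps_nth ((fps_exp 1 oo S) - (\<Sum>k<N. fps_const (fps_nth (fps_exp 1 oo Abs_fps (stirling_coeff s)) k) * fps_X ^ k)) n = 0"
    if n: "n < N" for n
  proof -
    have "fps_nth (\<Sum>k<N. fps_const (fps_nth (fps_exp 1 oo Abs_fps (stirling_coeff s)) k) * fps_X ^ k) n =
      (\<Sum>k<N. if k = n then fps_nth (fps_exp 1 oo Abs_fps (stirling_coeff s)) k else 0)"
      unfolding fps_sum_nth by (intro sum.cong refl) (auto simp: fps_X_power_nth)
    also have "\<dots> = fps_nth (fps_exp 1 oo Abs_fps (stirling_coeff s)) n"
      using n by (simp add: sum.delta)
    also have "\<dots> = fps_nth (fps_exp 1 oo S) n"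
      using n by (intro fps_compose_nth_cong) (auto simp: S_nth)
    finally show ?thesis by simp
  qed
  ultimately show ?thesis by (rule has_fps_expansion_bigo)
qed

text \<open>With \<open>P\<close> the truncated series and \<open>R\<close> the remainder, \<open>exp (P + R)\<close> is
  \<open>exp P + exp P (exp R - 1)\<close>; the first summand is expanded as a convergent series and the second
  is of the order of \<open>R\<close>.\<close>

lemma exp_stirling_log_expansion:
  assumes s: "s \<ge> 0"
  shows "(\<lambda>x::real. exp (of_real (stirling_log s x - ln (2 * pi) / 2))
            - (\<Sum>k<N. fps_nth (fps_exp 1 oo Abs_fps (stirling_coeff (of_real s))) k / of_real x ^ k))
         \<in> O[at_top](\<lambda>x. 1 / of_real x ^ N :: complex)"
proof -
  define P where "P = (\<lambda>x::real. stirling_poly (of_real s) N (1 / of_real x))"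
  define R where "R = stirling_remainder s N"
  obtain C x0 where C: "C > 0" "x0 \<ge> 2"
    "\<And>x. x \<ge> x0 \<Longrightarrow> norm (R x) \<le> C / x ^ (N + 1)"
    using stirling_remainder_bound[OF s, of N] unfolding R_def by metis
  have Rsmall: "(R \<longlongrightarrow> 0) at_top"
  proof (rule Lim_null_comparison)
    show "eventually (\<lambda>x. norm (R x) \<le> C / x ^ (N + 1)) at_top"
      using eventually_ge_at_top[of x0] by eventually_elim (rule C)
    have "((\<lambda>x::real. C * (1 / x) ^ (N + 1)) \<longlongrightarrow> C * 0 ^ (N + 1)) at_top"
      by (intro tendsto_intros) real_asymp
    thus "((\<lambda>x::real. C / x ^ (N + 1)) \<longlongrightarrow> 0) at_top" by (simp add: power_one_over)
  qed
  have RO: "R \<in> O[at_top](\<lambda>x. 1 / of_real x ^ N)"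
  proof (rule bigoI[of _ C])
    show "eventually (\<lambda>x. norm (R x) \<le> C * norm (1 / complex_of_real x ^ N)) at_top"
      using eventually_ge_at_top[of x0]
    proof eventually_elim
      case (elim x)
      have "norm (R x) \<le> C / x ^ (N + 1)" using C elim by simp
      also have "\<dots> \<le> C / x ^ N"
        using C elim by (intro divide_left_mono power_increasing) auto
      finally show ?case using C elim by (simp add: norm_divide norm_power)
    qed
  qed
  have "isCont (\<lambda>v::complex. if v = 0 then 1 else (exp v - 1) / v) 0"
    unfolding isCont_def using lim_exp_minus_1 by (subst filterlim_cong[OF refl refl]) (auto simp: eventually_at_filter)
  hence "((\<lambda>x. if R x = 0 then 1 else (exp (R x) - 1) / R x) \<longlongrightarrow> 1) at_top"
    using isCont_tendsto_compose[OF _ Rsmall] by force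
  hence "(\<lambda>x. if R x = 0 then 1 else (exp (R x) - 1) / R x) \<in> O[at_top](\<lambda>_. 1)"
    by (intro bigoI_tendsto[of _ _ 1]) auto
  from landau_o.big.mult[OF this RO]
  have eR: "(\<lambda>x. exp (R x) - 1) \<in> O[at_top](\<lambda>x. 1 / of_real x ^ N)"
    by (subst (asm) landau_o.big.in_cong[of _ "\<lambda>x. exp (R x) - 1"]) (auto intro!: always_eventually)
  have "((\<lambda>x::real. 1 / complex_of_real x) \<longlongrightarrow> 0) at_top"
    using filterlim_inverse_of_real_at_0 by (simp add: filterlim_at)
  hence "((\<lambda>x. exp (P x)) \<longlongrightarrow> exp (\<Sum>t\<in>{1..N}. stirling_coeff (of_real s) t * 0 ^ t)) at_top"
    unfolding P_def stirling_poly_def by (intro tendsto_intros)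
  hence "(\<lambda>x. exp (P x)) \<in> O[at_top](\<lambda>_. 1)"
    by (intro bigoI_tendsto) auto
  from landau_o.big.mult[OF this eR]
  have part1: "(\<lambda>x. exp (P x) * (exp (R x) - 1)) \<in> O[at_top](\<lambda>x. 1 / of_real x ^ N)" by simp
  have part2: "(\<lambda>x. exp (P x) - (\<Sum>k<N. fps_nth (fps_exp 1 oo Abs_fps (stirling_coeff (of_real s))) k / of_real x ^ k))
     \<in> O[at_top](\<lambda>x. 1 / of_real x ^ N)"
    using landau_o.big.compose[OF exp_stirling_poly_expansion filterlim_inverse_of_real_at_0, of "of_real s" N]
    by (simp add: P_def power_one_over)
  have "exp (of_real (stirling_log s x - ln (2 * pi) / 2)) = exp (P x) * exp (R x)" for x
    unfolding exp_add[symmetric] by (simp add: P_def R_def stirling_remainder_def)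
  hence "(\<lambda>x::real. exp (of_real (stirling_log s x - ln (2 * pi) / 2))
            - (\<Sum>k<N. fps_nth (fps_exp 1 oo Abs_fps (stirling_coeff (of_real s))) k / of_real x ^ k))
     = (\<lambda>x. exp (P x) * (exp (R x) - 1) +
       (exp (P x) - (\<Sum>k<N. fps_nth (fps_exp 1 oo Abs_fps (stirling_coeff (of_real s))) k / of_real x ^ k)))"
    by (simp add: algebra_simps)
  thus ?thesis using sum_in_bigo(1)[OF part1 part2] by simp
qed

lemma P_block_of_real:
  assumes "x > 0" "r \<ge> 1"
  shows "P_block r (of_real x) \<alpha> \<beta> = 1 / of_nat r *
    (\<Sum>h<r. root_omega r \<alpha> \<beta> powi (- int h) * exp (of_real (stirling_log (real h / real r) x - ln (2 * pi) / 2)))"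
proof -
  have eq: "exp (complex_of_real x) / csqrt (2 * of_real pi * of_real x) *
      (Gamma (of_real x + of_nat h / of_nat r) * of_real x powr (1 - of_real x - of_nat h / of_nat r)) =
      exp (of_real (stirling_log (real h / real r) x - ln (2 * pi) / 2))" for h
  proof -
    define s where "s = real h / real r"
    have s: "s \<ge> 0" by (simp add: s_def)
    have G: "Gamma (x + s) > 0" using s assms by (intro Gamma_real_pos) auto
    have "exp (stirling_log s x - ln (2 * pi) / 2) =
       Gamma (x + s) * exp (x - (x + s - 1/2) * ln x - ln (2 * pi) / 2)"
    proof -
      have "stirling_log s x - ln (2 * pi) / 2 = ln (Gamma (x + s)) + (x - (x + s - 1/2) * ln x - ln (2 * pi) / 2)"
        by (simp add: stirling_log_def)
      thus ?thesis by (simp only: exp_add exp_ln[OF G])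
    qed
    also have "x - (x + s - 1/2) * ln x - ln (2 * pi) / 2 = x + (1 - x - s) * ln x - (ln (2 * pi) + ln x) / 2"
      by (simp add: field_simps)
    also have "\<dots> = x + (1 - x - s) * ln x - ln (sqrt (2 * pi * x))"
      using assms by (simp add: ln_sqrt ln_mult)
    also have "exp \<dots> = exp x * x powr (1 - x - s) / sqrt (2 * pi * x)"
      using assms by (simp add: exp_add exp_diff powr_def)
    finally have real: "exp (stirling_log s x - ln (2 * pi) / 2) =
       exp x / sqrt (2 * pi * x) * (Gamma (x + s) * x powr (1 - x - s))" by simp
    have "csqrt (2 * of_real pi * of_real x) = of_real (sqrt (2 * pi * x))"
      using assms of_real_sqrt[of "2 * pi * x"] by simp
    moreover have "of_real x + of_nat h / of_nat r = complex_of_real (x + s)"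
      by (simp add: s_def)
    moreover have "1 - of_real x - of_nat h / of_nat r = complex_of_real (1 - x - s)"
      by (simp add: s_def)
    ultimately have "exp (complex_of_real x) / csqrt (2 * of_real pi * of_real x) *
      (Gamma (of_real x + of_nat h / of_nat r) * of_real x powr (1 - of_real x - of_nat h / of_nat r)) =
      of_real (exp x / sqrt (2 * pi * x) * (Gamma (x + s) * x powr (1 - x - s)))"
      using assms by (simp only: Gamma_complex_of_real exp_of_real powr_of_real of_real_mult of_real_divide)
    thus ?thesis unfolding real[symmetric] by (simp only: exp_of_real s_def)
  qed
  have "P_block r (of_real x) \<alpha> \<beta> = 1 / of_nat r *
    (\<Sum>h<r. root_omega r \<alpha> \<beta> powi (- int h) * (exp (complex_of_real x) / csqrt (2 * of_real pi * of_real x) *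
      (Gamma (of_real x + of_nat h / of_nat r) * of_real x powr (1 - of_real x - of_nat h / of_nat r))))"
    unfolding P_block_def sum_distrib_left by (intro sum.cong refl) simp
  thus ?thesis unfolding eq .
qed

lemma P_block_expansion:
  assumes r: "r \<ge> 1"
  shows "(\<lambda>x::real. P_block r (of_real x) \<alpha> \<beta> - (\<Sum>k<N. fps_nth (P_series r \<alpha> \<beta>) k / of_real x ^ k))
             \<in> O[at_top](\<lambda>x. 1 / of_real x ^ N)"
proof -
  define S where "S = (\<lambda>h. fps_exp 1 oo Abs_fps (stirling_coeff (of_nat h / of_nat r)))"
  define e where "e = (\<lambda>h x. exp (complex_of_real (stirling_log (real h / real r) x - ln (2 * pi) / 2)))"
  define \<omega> where "\<omega> = (\<lambda>h. root_omega r \<alpha> \<beta> powi (- int h))"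
  have P_nth: "fps_nth (P_series r \<alpha> \<beta>) k = 1 / of_nat r * (\<Sum>h<r. \<omega> h * fps_nth (S h) k)" for k
    unfolding P_series_def S_def \<omega>_def stirling_coeff_def by (simp add: fps_sum_nth)
  have "(\<lambda>x::real. e h x - (\<Sum>k<N. fps_nth (S h) k / of_real x ^ k)) \<in> O[at_top](\<lambda>x. 1 / of_real x ^ N)" for h
    using exp_stirling_log_expansion[of "real h / real r" N] unfolding S_def e_def by simp
  moreover have cmult: "(\<lambda>x. c * f x) \<in> O[F](g)" if "f \<in> O[F](g)" for c :: complex and f g and F :: "real filter"
    using that by (cases "c = 0") auto
  ultimately have "(\<lambda>x::real. 1 / of_nat r * (\<Sum>h<r. \<omega> h * (e h x - (\<Sum>k<N. fps_nth (S h) k / of_real x ^ k))))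
     \<in> O[at_top](\<lambda>x. 1 / of_real x ^ N)"
    by (intro cmult big_sum_in_bigo)
  moreover have "eventually (\<lambda>x::real. 1 / of_nat r * (\<Sum>h<r. \<omega> h * (e h x - (\<Sum>k<N. fps_nth (S h) k / of_real x ^ k)))
     = P_block r (of_real x) \<alpha> \<beta> - (\<Sum>k<N. fps_nth (P_series r \<alpha> \<beta>) k / of_real x ^ k)) at_top"
    using eventually_gt_at_top[of 0]
  proof eventually_elim
    case (elim x)
    have "(\<Sum>k<N. fps_nth (P_series r \<alpha> \<beta>) k / of_real x ^ k) =
       (\<Sum>k<N. \<Sum>h<r. 1 / of_nat r * (\<omega> h * (fps_nth (S h) k / of_real x ^ k)))"
      unfolding P_nth sum_distrib_left sum_divide_distrib by simp
    also have "\<dots> = (\<Sum>h<r. \<Sum>k<N. 1 / of_nat r * (\<omega> h * (fps_nth (S h) k / of_real x ^ k)))"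
      by (rule sum.swap)
    also have "\<dots> = 1 / of_nat r * (\<Sum>h<r. \<omega> h * (\<Sum>k<N. fps_nth (S h) k / of_real x ^ k))"
      unfolding sum_distrib_left ..
    finally show ?case
      unfolding P_block_of_real[OF elim r] e_def \<omega>_def
      by (simp add: right_diff_distrib sum_subtractf)
  qed
  ultimately show ?thesis using landau_o.big.in_cong by fastforce
qed

section \<open>The phase at a critical point\<close>

definition exp_quot :: "complex \<Rightarrow> complex" where
  "exp_quot v = (if v = 0 then 1 else (exp v - 1) / v)"

text \<open>The value \<open>1 / 2\<close> at \<open>0\<close> makes this an entire function; it is the second order remainder of the
  exponential series divided by \<open>v\<^sup>2\<close>.\<close>

definition exp_quot2 :: "complex \<Rightarrow> complex" where
  "exp_quot2 v = (if v = 0 then 1 / 2 else (exp v - 1 - v) / v ^ 2)"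

lemma exp_quot_mult: "v * exp_quot v = exp v - 1"
  by (simp add: exp_quot_def)

lemma exp_quot2_mult: "v ^ 2 * exp_quot2 v = exp v - 1 - v"
  by (simp add: exp_quot2_def)

lemma holomorphic_exp_quot: "exp_quot holomorphic_on A"
proof -
  have "exp_quot field_differentiable (at v)" for v
  proof (cases "v = 0")
    case True
    have "(\<lambda>v::complex. exp v - 1) has_fps_expansion fps_exp 1 - 1"
      by (intro fps_expansion_intros)
    moreover have "1 \<le> subdegree (fps_exp 1 - 1 :: complex fps)"
      by (intro subdegree_geI) (auto dest: arg_cong[of _ _ "\<lambda>f. fps_nth f 1"])
    ultimately have "(\<lambda>v. if v = 0 then 1 else (exp v - 1) / v ^ 1) has_fps_expansion fps_shift 1 (fps_exp 1 - 1 :: complex fps)"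
      by (rule has_fps_expansion_shift) simp
    moreover have "(\<lambda>v. if v = 0 then 1 else (exp v - 1) / v ^ 1) = exp_quot"
      by (simp add: exp_quot_def fun_eq_iff)
    ultimately have "exp_quot analytic_on {0}"
      by (metis has_fps_expansion_imp_analytic_0)
    thus ?thesis using True analytic_on_imp_differentiable_at by blast
  next
    case False
    have quot: "(\<lambda>v. (exp v - 1) / v) field_differentiable (at v)"
      using False by (intro derivative_intros field_differentiable_within_exp) auto
    have "eventually (\<lambda>v. exp_quot v = (exp v - 1) / v) (nhds v)"
      using t1_space_nhds[OF False] by eventually_elim (simp add: exp_quot_def)
    from DERIV_cong_ev[OF refl this refl] show ?thesis
      using quot unfolding field_differentiable_def by simp
  qed
  thus ?thesis by (simp add: field_differentiable_at_within holomorphic_on_def)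
qed

lemma holomorphic_exp_quot2: "exp_quot2 holomorphic_on A"
proof -
  have "exp_quot2 field_differentiable (at v)" for v
  proof (cases "v = 0")
    case True
    have "(\<lambda>v::complex. exp v - 1 - v) has_fps_expansion fps_exp 1 - 1 - fps_X"
      by (intro fps_expansion_intros)
    moreover have "2 \<le> subdegree (fps_exp 1 - 1 - fps_X :: complex fps)"
      by (intro subdegree_geI) (auto dest: arg_cong[of _ _ "\<lambda>f. fps_nth f 2"] simp: less_Suc_eq numeral_2_eq_2)
    ultimately have "(\<lambda>v. if v = 0 then 1/2 else (exp v - 1 - v) / v ^ 2) has_fps_expansion fps_shift 2 (fps_exp 1 - 1 - fps_X :: complex fps)"
      by (rule has_fps_expansion_shift) simp
    moreover have "(\<lambda>v. if v = 0 then 1/2 else (exp v - 1 - v) / v ^ 2) = exp_quot2"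
      by (simp add: exp_quot2_def fun_eq_iff)
    ultimately have "exp_quot2 analytic_on {0}"
      by (metis has_fps_expansion_imp_analytic_0)
    thus ?thesis using True analytic_on_imp_differentiable_at by blast
  next
    case False
    have quot: "(\<lambda>v. (exp v - 1 - v) / v ^ 2) field_differentiable (at v)"
      using False by (intro derivative_intros field_differentiable_within_exp) auto
    have "eventually (\<lambda>v. exp_quot2 v = (exp v - 1 - v) / v ^ 2) (nhds v)"
      using t1_space_nhds[OF False] by eventually_elim (simp add: exp_quot2_def)
    from DERIV_cong_ev[OF refl this refl] show ?thesis
      using quot unfolding field_differentiable_def by simp
  qed
  thus ?thesis by (simp add: field_differentiable_at_within holomorphic_on_def)
qed

lemma tendsto_exp_quot [tendsto_intros]:
  "(f \<longlongrightarrow> a) F \<Longrightarrow> ((\<lambda>x. exp_quot (f x)) \<longlongrightarrow> exp_quot a) F"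
  using continuous_on_tendsto_compose[OF holomorphic_on_imp_continuous_on[OF holomorphic_exp_quot[of UNIV]]] by auto

lemma tendsto_exp_quot2 [tendsto_intros]:
  "(f \<longlongrightarrow> a) F \<Longrightarrow> ((\<lambda>x. exp_quot2 (f x)) \<longlongrightarrow> exp_quot2 a) F"
  using continuous_on_tendsto_compose[OF holomorphic_on_imp_continuous_on[OF holomorphic_exp_quot2[of UNIV]]] by auto

text \<open>The increment of the superpotential from a critical point \<open>P\<close>, in the logarithmic coordinate
  centred there, where \<open>c l = q l * P powi l\<close>.  All parameters \<open>w\<close> have been eliminated by means of
  criticality.\<close>

definition phase :: "nat \<Rightarrow> nat \<Rightarrow> (int \<Rightarrow> complex) \<Rightarrow> complex \<Rightarrow> complex" where
  "phase m r c v = (\<Sum>l\<in>{- int m..int r}. c l * (exp (of_int l * v) - 1 - of_int l * v))"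

text \<open>The phase has a double zero at \<open>0\<close>; this is the entire quotient by \<open>v\<^sup>2\<close>.\<close>

definition phase_quot :: "nat \<Rightarrow> nat \<Rightarrow> (int \<Rightarrow> complex) \<Rightarrow> complex \<Rightarrow> complex" where
  "phase_quot m r c v = (\<Sum>l\<in>{- int m..int r}. c l * of_int l ^ 2 * exp_quot2 (of_int l * v))"

lemma phase_eq: "phase m r c v = v ^ 2 * phase_quot m r c v"
  unfolding phase_def phase_quot_def sum_distrib_left
  by (intro sum.cong refl, subst exp_quot2_mult[symmetric]) (simp add: power_mult_distrib)

lemma holomorphic_phase_quot: "phase_quot m r c holomorphic_on A"
  unfolding phase_quot_def
  by (intro holomorphic_intros holomorphic_on_compose[OF _ holomorphic_exp_quot2, unfolded o_def])

lemma tendsto_phase_quot: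
  assumes "\<And>l. ((\<lambda>x. c x l) \<longlongrightarrow> d l) F" "(f \<longlongrightarrow> a) F"
  shows "((\<lambda>x. phase_quot m r (c x) (f x)) \<longlongrightarrow> phase_quot m r d a) F"
  unfolding phase_quot_def by (intro tendsto_intros assms)

lemma tendsto_phase:
  assumes "\<And>l. ((\<lambda>x. c x l) \<longlongrightarrow> d l) F" "(f \<longlongrightarrow> a) F"
  shows "((\<lambda>x. phase m r (c x) (f x)) \<longlongrightarrow> phase m r d a) F"
  unfolding phase_def by (intro tendsto_intros assms)

text \<open>Squaring \<open>1 + x / 2 \<le> exp (x / 2)\<close> gains the positive term \<open>x\<^sup>2 / 4\<close>.\<close>

lemma exp_gt_1_plus: "x \<noteq> 0 \<Longrightarrow> 1 + x < exp (x :: real)"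
proof -
  assume x: "x \<noteq> 0"
  have h: "1 + x / 2 \<le> exp (x / 2)" by simp
  show ?thesis
  proof (cases "1 + x / 2 \<ge> 0")
    case True
    hence "(1 + x / 2) ^ 2 \<le> exp (x / 2) ^ 2" using h by (intro power_mono)
    also have "exp (x / 2) ^ 2 = exp x" by (simp flip: exp_double)
    finally have "1 + x + x ^ 2 / 4 \<le> exp x" by (simp add: power2_eq_square algebra_simps)
    moreover have "x ^ 2 > 0" using x by simp
    ultimately show ?thesis by linarith
  next
    case False
    moreover have "exp x > 0" by simp
    ultimately show ?thesis by linarith
  qed
qed

lemma Re_exp_quot2_of_real_pos: "Re (exp_quot2 (of_real u)) > 0"
proof (cases "u = 0")
  case False
  have "exp_quot2 (of_real u) = of_real ((exp u - 1 - u) / u ^ 2)"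
    using False by (simp add: exp_quot2_def exp_of_real)
  moreover have "(exp u - 1 - u) / u ^ 2 > 0"
    using exp_gt_1_plus[OF False] False by (intro divide_pos_pos) auto
  ultimately show ?thesis by simp
qed (simp add: exp_quot2_def)

lemma exp_minus_linear_ge: "exp u - 1 - u \<ge> \<bar>u\<bar> - (1::real)"
proof (cases "u \<ge> 0")
  case True
  have "u ^ 2 / 2 - u + 1 / 2 = (u - 1) ^ 2 / 2" by (simp add: power2_eq_square field_simps)
  moreover have "(u - 1) ^ 2 / 2 \<ge> 0" by simp
  ultimately have "u - 1 \<le> u ^ 2 / 2" by linarith
  thus ?thesis using exp_lower_Taylor_quadratic[OF True] True by linarith
next
  case False
  have "exp u > 0" by simp
  thus ?thesis using False by linarith
qed

text \<open>For non-negative coefficients the real phase is \<open>x\<^sup>2\<close> times the positive function \<open>K\<close>, so that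
  \<open>T x = x sqrt (K x)\<close> is a smooth square root that changes sign at \<open>0\<close>.  It is strictly increasing
  because the derivative of the phase has the sign of \<open>x\<close>, and onto because the phase grows at least
  linearly in both directions.  Its inverse \<open>X\<close> parametrises a thimble that lies on a real line; it
  serves both for the limiting thimble and for the thimbles that show that the limit point is
  approached.\<close>

lemma real_phase_coordinate:
  fixes a :: "int \<Rightarrow> real"
  assumes a: "\<And>l. a l \<ge> 0" and ar: "a (int r) > 0" and r: "r \<ge> 1"
  obtains T T' X :: "real \<Rightarrow> real" where
    "\<And>x. (T has_real_derivative T' x) (at x)" "\<And>x. T' x > 0"
    "\<And>x. T x ^ 2 = (\<Sum>l\<in>{- int m..int r}. a l * (exp (of_int l * x) - 1 - of_int l * x))"
    "\<And>x. sgn (T x) = sgn x" "\<And>t. T (X t) = t" "\<And>x. X (T x) = x"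
    "\<And>t. (X has_real_derivative (1 / T' (X t))) (at t)"
proof -
  define k where "k = (\<lambda>u::real. Re (exp_quot2 (of_real u)))"
  have k_pos: "k u > 0" for u using Re_exp_quot2_of_real_pos by (simp add: k_def)
  have k_eq: "u ^ 2 * k u = exp u - 1 - u" for u
  proof -
    have "of_real u ^ 2 * exp_quot2 (of_real u) = complex_of_real (exp u - 1 - u)"
      by (simp add: exp_quot2_mult exp_of_real)
    hence "Re (of_real (u ^ 2) * exp_quot2 (of_real u)) = exp u - 1 - u" by simp
    thus ?thesis unfolding k_def by (simp del: of_real_power)
  qed
  have k_diff: "k differentiable (at u)" for u
  proof -
    have "exp_quot2 field_differentiable (at (of_real u))"
      using holomorphic_exp_quot2[of UNIV] by (simp add: holomorphic_on_def)
    then obtain D where "(exp_quot2 has_field_derivative D) (at (of_real u))"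
      by (auto simp: field_differentiable_def)
    hence "((\<lambda>u. exp_quot2 (of_real u)) has_vector_derivative D) (at u)"
      by (rule has_vector_derivative_real_field)
    hence "((\<lambda>u. Re (exp_quot2 (of_real u))) has_vector_derivative Re D) (at u)"
      by (rule bounded_linear.has_vector_derivative[OF bounded_linear_Re])
    thus ?thesis unfolding k_def
      by (meson differentiableI_vector)
  qed
  define H where "H = (\<lambda>x::real. \<Sum>l\<in>{- int m..int r}. a l * (exp (of_int l * x) - 1 - of_int l * x))"
  define K where "K = (\<lambda>x::real. \<Sum>l\<in>{- int m..int r}. a l * of_int l ^ 2 * k (of_int l * x))"
  have H_eq: "H x = x ^ 2 * K x" for x
    unfolding H_def K_def sum_distrib_left
    by (intro sum.cong refl) (simp add: k_eq[symmetric] power_mult_distrib)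
  have r_in: "int r \<in> {- int m..int r}" by simp
  have K_pos: "K x > 0" for x
    unfolding K_def
    by (rule sum_pos2[OF _ r_in]) (use a ar r k_pos in \<open>auto intro!: mult_pos_pos mult_nonneg_nonneg less_imp_le[OF k_pos]\<close>)
  have K_diff: "K differentiable (at x)" for x
  proof -
    have "(\<lambda>x. k (of_int l * x)) differentiable (at x)" for l
      using differentiable_chain_at[of "\<lambda>x. of_int l * x" x k] k_diff by (simp add: o_def)
    thus ?thesis unfolding K_def by (intro differentiable_sum differentiable_mult) auto
  qed
  define T where "T = (\<lambda>x. x * sqrt (K x))"
  define T' where "T' = (\<lambda>x. deriv T x)"
  have T_deriv: "(T has_real_derivative T' x) (at x)" for x
  proof -
    obtain D where "(K has_real_derivative D) (at x)" using K_diff real_differentiable_def by blast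
    hence "\<exists>D'. (T has_real_derivative D') (at x)"
      unfolding T_def using K_pos[of x] by (intro exI) (auto intro!: derivative_eq_intros)
    thus ?thesis unfolding T'_def by (metis DERIV_imp_deriv)
  qed
  have T_sq: "T x ^ 2 = H x" for x
    using K_pos[of x] by (simp add: T_def H_eq power_mult_distrib)
  have T_sgn: "sgn (T x) = sgn x" for x
    using K_pos[of x] by (simp add: T_def sgn_mult)
  have T0: "T 0 = 0" by (simp add: T_def)
  have T'_pos: "T' x > 0" for x
  proof (cases "x = 0")
    case True
    obtain D where "(K has_real_derivative D) (at 0)" using K_diff real_differentiable_def by blast
    hence "(T has_real_derivative sqrt (K 0)) (at 0)"
      unfolding T_def using K_pos[of 0] by (auto intro!: derivative_eq_intros)
    hence "T' 0 = sqrt (K 0)" using T_deriv DERIV_unique by blast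
    thus ?thesis using True K_pos[of 0] by simp
  next
    case False
    \<comment> \<open>Differentiating \<open>T\<^sup>2 = H\<close> gives \<open>2 T T\' = H\'\<close>, and both \<open>T x\<close> and \<open>H\'\<close> have the sign of \<open>x\<close>.\<close>
    define H' where "H' = (\<Sum>l\<in>{- int m..int r}. a l * (of_int l * (exp (of_int l * x) - 1)))"
    have "(H has_real_derivative H') (at x)"
      unfolding H_def H'_def by (auto intro!: derivative_eq_intros sum.cong simp: algebra_simps)
    moreover have "((\<lambda>x. T x ^ 2) has_real_derivative 2 * T x * T' x) (at x)"
      using T_deriv by (auto intro!: derivative_eq_intros)
    ultimately have eq: "2 * T x * T' x = H'"
      using DERIV_unique unfolding T_sq by blast
    have sg: "(y * (exp y - 1) :: real) \<ge> 0" "y \<noteq> 0 \<Longrightarrow> (y * (exp y - 1) :: real) > 0" for y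
      by (cases "y > 0"; cases "y = 0"; auto intro: mult_neg_neg simp: zero_le_mult_iff zero_less_mult_iff)+
    have "0 < x * H'"
    proof -
      have "x * H' = (\<Sum>l\<in>{- int m..int r}. a l * ((of_int l * x) * (exp (of_int l * x) - 1)))"
        unfolding H'_def sum_distrib_left by (intro sum.cong) (auto simp: algebra_simps)
      also have "\<dots> > 0"
      proof (rule sum_pos2[OF _ r_in])
        have "real_of_int (int r) * x \<noteq> 0" using r False by simp
        from sg(2)[OF this] show "0 < a (int r) * ((of_int (int r) * x) * (exp (of_int (int r) * x) - 1))"
          using ar by (rule mult_pos_pos[rotated])
        show "0 \<le> a l * ((of_int l * x) * (exp (of_int l * x) - 1))" for l
          by (intro mult_nonneg_nonneg[OF a sg(1)])
      qed simp
      finally show ?thesis .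
    qed
    hence "0 < 2 * (x * T x) * T' x" using eq by (simp add: mult_ac)
    moreover have "x * T x > 0" using False K_pos[of x] by (simp add: T_def power2_eq_square[symmetric] flip: mult.assoc)
    ultimately show ?thesis by (metis mult_pos_pos zero_less_mult_pos zero_less_numeral)
  qed
  have T_less: "T x < T y" if "x < y" for x y
    by (rule DERIV_pos_imp_increasing[OF that]) (rule exI, rule conjI, rule T_deriv, rule T'_pos)
  have inj: "inj T" by (intro strict_mono_imp_inj_on strict_monoI T_less)
  have H_ge: "H x \<ge> a (int r) * (\<bar>x\<bar> - 1)" for x
  proof -
    have "a (int r) * (\<bar>x\<bar> - 1) \<le> a (int r) * (\<bar>real_of_int (int r) * x\<bar> - 1)"
    proof (intro mult_left_mono diff_right_mono)
      have "1 * \<bar>x\<bar> \<le> real r * \<bar>x\<bar>" using r by (intro mult_right_mono) auto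
      thus "\<bar>x\<bar> \<le> \<bar>real_of_int (int r) * x\<bar>" by (simp add: abs_mult)
    qed (use ar in auto)
    also have "\<dots> \<le> a (int r) * (exp (of_int (int r) * x) - 1 - of_int (int r) * x)"
      using ar by (intro mult_left_mono exp_minus_linear_ge) auto
    also have "\<dots> \<le> H x"
      unfolding H_def
    proof (rule member_le_sum[OF r_in])
      fix l :: int
      have "1 + of_int l * x \<le> exp (of_int l * x)" by (rule exp_ge_add_one_self)
      thus "0 \<le> a l * (exp (of_int l * x) - 1 - of_int l * x)"
        by (intro mult_nonneg_nonneg[OF a]) linarith
    qed simp
    finally show ?thesis .
  qed
  have surj: "\<exists>x. T x = t" for t
  proof -
    \<comment> \<open>Chosen so that the linear lower bound for \<open>H\<close> reaches \<open>t\<^sup>2\<close> at \<open>B\<close> and at \<open>- B\<close>.\<close>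
    define B where "B = t ^ 2 / a (int r) + 1"
    have B: "B > 0" using ar by (simp add: B_def add_nonneg_pos)
    hence "- B \<le> B" by simp
    have "T x ^ 2 \<ge> t ^ 2" if "\<bar>x\<bar> = B" for x
      using H_ge[of x] ar unfolding T_sq that by (simp add: B_def)
    hence "\<bar>T x\<bar> \<ge> \<bar>t\<bar>" if "\<bar>x\<bar> = B" for x
      using that by (simp add: abs_le_square_iff)
    from this[of B] this[of "- B"] have "\<bar>t\<bar> \<le> T B" "T (- B) \<le> - \<bar>t\<bar>"
      using T_less[of 0 B] T_less[of "- B" 0] B T0 by auto
    moreover have "\<forall>x. - B \<le> x \<and> x \<le> B \<longrightarrow> isCont T x" using DERIV_isCont[OF T_deriv] by simp
    moreover from calculation have "T (- B) \<le> t" "t \<le> T B" by linarith+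
    ultimately show ?thesis using IVT[of T "- B" t B] \<open>- B \<le> B\<close> by blast
  qed
  define X where "X = inv T"
  have TX: "T (X t) = t" for t unfolding X_def using surj[of t] by (intro f_inv_into_f) auto
  have XT: "X (T x) = x" for x unfolding X_def by (rule inv_f_f[OF inj])
  have cont: "continuous_on UNIV T" using DERIV_isCont[OF T_deriv] by (simp add: continuous_at_imp_continuous_on)
  have X_deriv: "(X has_real_derivative (1 / T' (X t))) (at t)" for t
  proof -
    have "DERIV X (T (X t)) :> inverse (T' (X t))"
      by (rule has_field_derivative_inverse_strong[OF T_deriv _ open_UNIV UNIV_I cont XT])
         (use T'_pos[of "X t"] in simp)
    thus ?thesis by (simp add: TX inverse_eq_divide)
  qed
  show ?thesis
    by (rule that[OF T_deriv T'_pos _ T_sgn TX XT X_deriv]) (simp add: T_sq H_def)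
qed

section \<open>Convergence of thimbles\<close>

text \<open>A thimble in the logarithmic coordinate centred at its critical point.  The sign of \<open>- t\<^sup>2\<close>
  corresponds to a negative \<open>z\<close>.\<close>

definition normal_thimble :: "nat \<Rightarrow> nat \<Rightarrow> (int \<Rightarrow> complex) \<Rightarrow> (real \<Rightarrow> complex) \<Rightarrow> bool" where
  "normal_thimble m r c g \<longleftrightarrow> g 0 = 0 \<and> (\<forall>t. g differentiable (at t)) \<and>
     Re (vector_derivative g (at 0)) > 0 \<and> (\<forall>t. phase m r c (g t) = - of_real (t\<^sup>2))"

definition lim_coeff :: "nat \<Rightarrow> real \<Rightarrow> int \<Rightarrow> complex" where
  "lim_coeff r p l = (if l = int r then of_real (p / real r) else 0)"

lemma phase_lim_coeff:
  "phase m r (lim_coeff r p) v = of_real (p / real r) * (exp (of_nat r * v) - 1 - of_nat r * v)"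
proof -
  have "phase m r (lim_coeff r p) v =
    (\<Sum>l\<in>{- int m..int r}. if l = int r then of_real (p / real r) * (exp (of_int l * v) - 1 - of_int l * v) else 0)"
    unfolding phase_def lim_coeff_def by (intro sum.cong refl) auto
  thus ?thesis by simp
qed

lemma phase_quot_lim_coeff_0:
  "r \<ge> 1 \<Longrightarrow> phase_quot m r (lim_coeff r p) 0 = of_real (p * real r / 2)"
proof -
  assume r: "r \<ge> 1"
  have "phase_quot m r (lim_coeff r p) 0 =
    (\<Sum>l\<in>{- int m..int r}. if l = int r then of_real (p / real r) * of_int l ^ 2 * (1 / 2) else 0)"
    unfolding phase_quot_def lim_coeff_def by (intro sum.cong refl) (auto simp: exp_quot2_def)
  also have "\<dots> = of_real (p * real r / 2)" using r by (simp add: power2_eq_square)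
  finally show ?thesis .
qed

text \<open>The function \<open>sin b - b cos b\<close> vanishes at \<open>0\<close> and has derivative \<open>b sin b > 0\<close>.\<close>

lemma mult_cos_less_sin:
  assumes "0 < b" "b < pi"
  shows "b * cos b < sin b"
proof -
  have "sin 0 - 0 * cos 0 < sin b - b * cos b"
  proof (rule DERIV_pos_imp_increasing_open[OF assms(1)])
    fix x :: real assume x: "0 < x" "x < b"
    have "((\<lambda>b. sin b - b * cos b) has_real_derivative x * sin x) (at x)"
      by (auto intro!: derivative_eq_intros)
    moreover have "x * sin x > 0" using x assms by (intro mult_pos_pos sin_gt_zero) auto
    ultimately show "\<exists>y. ((\<lambda>b. sin b - b * cos b) has_real_derivative y) (at x) \<and> 0 < y" by blast
  qed (intro continuous_intros)
  thus ?thesis by simp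
qed

text \<open>Suppose \<open>a > 0\<close>.  From \<open>sin a \<le> a = exp x sin a\<close> one gets \<open>x \<ge> 0\<close>, hence
  \<open>exp x cos a \<ge> 1\<close>.  Multiplying by \<open>sin a\<close> yields \<open>sin a \<le> a cos a\<close>, which is false on
  \<open>(0, \<pi>)\<close>.\<close>

lemma exp_eq_linear_imp_real:
  fixes x a s :: real
  assumes "exp x * cos a = 1 + x + s" "exp x * sin a = a" "s \<ge> 0" "\<bar>a\<bar> \<le> pi"
  shows "a = 0"
proof (rule ccontr)
  assume a: "a \<noteq> 0"
  define b where "b = \<bar>a\<bar>"
  have b: "b > 0" "b \<le> pi" using a assms by (auto simp: b_def)
  have cb: "exp x * cos b = 1 + x + s" using assms(1) by (simp add: b_def)
  have sb: "exp x * sin b = b"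
    using assms(2) by (cases "a \<ge> 0") (auto simp: b_def)
  have "b \<noteq> pi" using sb b by auto
  hence less: "b * cos b < sin b" using b by (intro mult_cos_less_sin) auto
  have "sin b \<le> b" using b by (intro sin_x_le_x) auto
  hence "exp x * sin b \<ge> sin b" using sb by simp
  moreover have "sin b > 0" using b \<open>b \<noteq> pi\<close> by (intro sin_gt_zero) auto
  ultimately have "exp x \<ge> 1" by (metis mult_le_cancel_right1 not_less_iff_gr_or_eq)
  hence "x \<ge> 0" by simp
  hence "exp x * cos b \<ge> 1" using cb assms(3) by linarith
  hence "1 * sin b \<le> (exp x * cos b) * sin b"
    using \<open>sin b > 0\<close> by (intro mult_right_mono) auto
  also have "\<dots> = (exp x * sin b) * cos b" by simp
  also have "\<dots> = b * cos b" unfolding sb ..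
  finally show False using less by simp
qed

text \<open>With \<open>r v = x + i a\<close> the equation reads \<open>exp (r v) = 1 + r v + s\<close> for a real \<open>s \<ge> 0\<close>.  This is
  the reason why the limiting thimble is the whole ray \<open>(0, \<infinity>) P\<^sub>\<beta>\<close> and why nearby thimbles cannot
  leave the strip around it.\<close>

lemma limit_phase_real:
  assumes r: "r \<ge> 1" and p: "p < 0" and eq: "phase m r (lim_coeff r p) v = - of_real (t\<^sup>2)"
    and v: "\<bar>Im v\<bar> \<le> pi / real r"
  shows "Im v = 0" and "- p / real r * (exp (real r * Re v) - 1 - real r * Re v) = t\<^sup>2"
proof -
  define s where "s = t\<^sup>2 * real r / (- p)"
  have "of_real (p / real r) * (exp (of_nat r * v) - 1 - of_nat r * v) = - of_real (t\<^sup>2)"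
    using eq by (simp only: phase_lim_coeff)
  hence "exp (of_nat r * v) - 1 - of_nat r * v = - of_real (t\<^sup>2) / of_real (p / real r)"
    using p r by (simp add: field_simps)
  also have "\<dots> = of_real s" by (simp add: s_def)
  finally have eq: "exp (of_nat r * v) = 1 + of_nat r * v + of_real s" by (simp add: algebra_simps)
  have "exp (real r * Re v) * cos (real r * Im v) = 1 + real r * Re v + s"
       "exp (real r * Re v) * sin (real r * Im v) = real r * Im v"
    using arg_cong[OF eq, of Re] arg_cong[OF eq, of Im] by (simp_all add: Re_exp Im_exp)
  moreover have "s \<ge> 0" using p by (simp add: s_def divide_nonneg_neg)
  moreover have "\<bar>real r * Im v\<bar> \<le> pi" using v r by (simp add: abs_mult field_simps)
  ultimately have "real r * Im v = 0" by (rule exp_eq_linear_imp_real)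
  thus im: "Im v = 0" using r by simp
  have "exp (real r * Re v) - 1 - real r * Re v = s"
    using arg_cong[OF eq, of Re] im by (simp add: Re_exp)
  thus "- p / real r * (exp (real r * Re v) - 1 - real r * Re v) = t\<^sup>2"
    using p r by (simp add: s_def)
qed

text \<open>Thimbles \<open>g n\<close> for deformations \<open>c n\<close> that converge to the large radius limit, together with
  the limiting thimble \<open>X\<close> and its inverse \<open>T\<close>.  The sum condition on \<open>c n\<close> is criticality of the
  base point.\<close>

locale thimble_sequence =
  fixes m r :: nat and p :: real and c :: "nat \<Rightarrow> int \<Rightarrow> complex" and g :: "nat \<Rightarrow> real \<Rightarrow> complex"
    and T T' X :: "real \<Rightarrow> real"
  assumes r: "r \<ge> 1" and p: "p < 0"
    and c_lim: "\<And>l. (\<lambda>n. c n l) \<longlonglongrightarrow> lim_coeff r p l"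
    and c_sum: "\<And>n. (\<Sum>l\<in>{- int m..int r}. of_int l * c n l) = of_real p"
    and thimble: "\<And>n. normal_thimble m r (c n) (g n)"
    and T_deriv: "\<And>x. (T has_real_derivative T' x) (at x)" and T'_pos: "\<And>x. T' x > 0"
    and T_sq: "\<And>x. T x ^ 2 = - p / real r * (exp (real r * x) - 1 - real r * x)"
    and T_sgn: "\<And>x. sgn (T x) = sgn x"
    and TX: "\<And>t. T (X t) = t" and XT: "\<And>x. X (T x) = x"
    and X_deriv: "\<And>t. (X has_real_derivative (1 / T' (X t))) (at t)"
begin

lemma g_0: "g n 0 = 0"
  and g_diff: "g n differentiable (at t)"
  and g_deriv0: "Re (vector_derivative (g n) (at 0)) > 0"
  and g_phase: "phase m r (c n) (g n t) = - of_real (t\<^sup>2)"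
  using thimble by (auto simp: normal_thimble_def)

lemma g_cont: "continuous_on A (g n)"
  by (metis continuous_at_imp_continuous_on differentiable_imp_continuous_within g_diff)

lemma X_cont: "isCont X t"
  by (rule DERIV_isCont[OF X_deriv])

lemma X_le_iff: "X s \<le> X t \<longleftrightarrow> s \<le> t"
proof -
  have "strict_mono X"
  proof (rule strict_monoI)
    fix s t :: real assume "s < t"
    thus "X s < X t"
      by (rule DERIV_pos_imp_increasing) (rule exI, rule conjI, rule X_deriv, simp add: T'_pos)
  qed
  thus ?thesis by (rule strict_mono_less_eq)
qed

lemma X_less_iff: "X s < X t \<longleftrightarrow> s < t"
  using X_le_iff[of t s] by linarith

definition Box :: "real \<Rightarrow> complex set" where
  "Box B = cbox (Complex (- B) (- (pi / real r))) (Complex B (pi / real r))"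

lemma in_Box: "v \<in> Box B \<longleftrightarrow> \<bar>Re v\<bar> \<le> B \<and> \<bar>Im v\<bar> \<le> pi / real r"
  by (auto simp: Box_def in_cbox_complex_iff)

lemma compact_Box: "compact (Box B)" by (simp add: Box_def)

text \<open>The rectangle is compact and the phases converge, so a cluster point solves the limiting equation
  in the closed strip, where solutions are real.\<close>

lemma cluster_point:
  fixes s :: "nat \<Rightarrow> nat" and t :: "nat \<Rightarrow> real"
  assumes s: "strict_mono s" and t: "\<And>k. \<bar>t k\<bar> \<le> R" and v: "\<And>k. v k \<in> Box B"
    and eq: "\<And>k. phase m r (c (s k)) (v k) = - of_real ((t k)\<^sup>2)"
  obtains \<sigma> x t0 where "strict_mono \<sigma>" "(t \<circ> \<sigma>) \<longlonglongrightarrow> t0" "\<bar>t0\<bar> \<le> R"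
    "(v \<circ> \<sigma>) \<longlonglongrightarrow> of_real x" "\<bar>x\<bar> \<le> B" "(T x)\<^sup>2 = t0\<^sup>2"
proof -
  have "seq_compact (Box B \<times> {- R..R})"
    by (intro compact_imp_seq_compact compact_Times compact_Box compact_Icc)
  hence "(\<forall>k. (v k, t k) \<in> Box B \<times> {- R..R}) \<longrightarrow>
      (\<exists>l\<in>Box B \<times> {- R..R}. \<exists>\<sigma>. strict_mono \<sigma> \<and> ((\<lambda>k. (v k, t k)) \<circ> \<sigma>) \<longlonglongrightarrow> l)"
    unfolding seq_compact_def by (rule spec)
  moreover have "\<forall>k. (v k, t k) \<in> Box B \<times> {- R..R}" using t v by (simp add: abs_le_iff minus_le_iff)
  ultimately have "\<exists>l\<in>Box B \<times> {- R..R}. \<exists>\<sigma>. strict_mono \<sigma> \<and> ((\<lambda>k. (v k, t k)) \<circ> \<sigma>) \<longlonglongrightarrow> l"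
    by (rule mp)
  then obtain l \<sigma> where l: "l \<in> Box B \<times> {- R..R}" and \<sigma>: "strict_mono \<sigma>"
    and lim: "((\<lambda>k. (v k, t k)) \<circ> \<sigma>) \<longlonglongrightarrow> l"
    by blast
  obtain v0 t0 where l_eq: "l = (v0, t0)" by force
  have v_lim: "(v \<circ> \<sigma>) \<longlonglongrightarrow> v0" and t_lim: "(t \<circ> \<sigma>) \<longlonglongrightarrow> t0"
    using tendsto_fst[OF lim] tendsto_snd[OF lim] by (simp_all add: l_eq o_def)
  have "(\<lambda>k. c (s (\<sigma> k)) l) \<longlonglongrightarrow> lim_coeff r p l" for l
    using LIMSEQ_subseq_LIMSEQ[OF c_lim strict_mono_o[OF s \<sigma>]] by (simp add: o_def)
  hence "(\<lambda>k. phase m r (c (s (\<sigma> k))) (v (\<sigma> k))) \<longlonglongrightarrow> phase m r (lim_coeff r p) v0"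
    using v_lim by (intro tendsto_phase) (auto simp: o_def)
  moreover have "(\<lambda>k. phase m r (c (s (\<sigma> k))) (v (\<sigma> k))) \<longlonglongrightarrow> - of_real (t0\<^sup>2)"
    unfolding eq using t_lim by (intro tendsto_intros) (simp add: o_def)
  ultimately have ph: "phase m r (lim_coeff r p) v0 = - of_real (t0\<^sup>2)"
    by (rule LIMSEQ_unique)
  have v0: "\<bar>Im v0\<bar> \<le> pi / real r" "\<bar>Re v0\<bar> \<le> B" using l by (auto simp: l_eq in_Box)
  have "v0 = of_real (Re v0)"
    using limit_phase_real(1)[OF r p ph v0(1)] by (simp add: complex_eq_iff)
  moreover have "(T (Re v0))\<^sup>2 = t0\<^sup>2"
    using limit_phase_real(2)[OF r p ph v0(1)] by (simp add: T_sq)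
  moreover have "\<bar>t0\<bar> \<le> R" using l by (auto simp: l_eq)
  ultimately show ?thesis using that[OF \<sigma> t_lim _ _ v0(2)] v_lim by simp
qed

text \<open>If a thimble met the boundary of the rectangle for parameters in a bounded range, then a cluster
  point on the boundary would be real and satisfy \<open>\<bar>T x\<bar> \<le> R\<close>; but the rectangle is chosen wider
  than \<open>X\<close> of this range, so such points are interior.  A connected curve starting inside that avoids
  the boundary stays inside.\<close>

lemma eventually_in_Box:
  obtains B where "eventually (\<lambda>n. \<forall>t. \<bar>t\<bar> \<le> R \<longrightarrow> g n t \<in> Box B) sequentially"
proof -
  define B where "B = \<bar>X R\<bar> + \<bar>X (- R)\<bar> + 1"
  have "eventually (\<lambda>n. \<forall>t. \<bar>t\<bar> \<le> R \<longrightarrow> g n t \<notin> frontier (Box B)) sequentially"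
  proof (rule ccontr)
    assume "\<not> ?thesis"
    then obtain s :: "nat \<Rightarrow> nat" where s: "strict_mono s" "\<forall>k. \<exists>t. \<bar>t\<bar> \<le> R \<and> g (s k) t \<in> frontier (Box B)"
      by (auto dest!: not_eventually_sequentiallyD)
    then obtain t where t: "\<And>k. \<bar>t k\<bar> \<le> R" "\<And>k. g (s k) (t k) \<in> frontier (Box B)" by metis
    have fr: "frontier (Box B) \<subseteq> Box B"
      using frontier_subset_compact compact_Box by blast
    obtain \<sigma> x t0 where cl: "strict_mono \<sigma>" "\<bar>t0\<bar> \<le> R"
      "((\<lambda>k. g (s k) (t k)) \<circ> \<sigma>) \<longlonglongrightarrow> of_real x" "(T x)\<^sup>2 = t0\<^sup>2"
      using cluster_point[of s t R "\<lambda>k. g (s k) (t k)" B] s(1) t fr g_phase by (metis subsetD)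
    have "complex_of_real x \<in> frontier (Box B)"
      using closed_sequentially[OF frontier_closed _ cl(3)] t(2) by (simp add: o_def)
    moreover have "\<bar>T x\<bar> \<le> R" using cl(2,4) by (metis abs_le_square_iff order_trans order_refl)
    hence "- R \<le> T x" "T x \<le> R" by auto
    hence "X (- R) \<le> x" "x \<le> X R" using X_le_iff[of "- R" "T x"] X_le_iff[of "T x" R] by (simp_all add: XT)
    hence "\<bar>x\<bar> < B" by (auto simp: B_def)
    hence "complex_of_real x \<in> interior (Box B)"
      using r by (auto simp: Box_def interior_cbox in_box_complex_iff)
    ultimately show False by (simp add: frontier_def)
  qed
  hence "eventually (\<lambda>n. \<forall>t. \<bar>t\<bar> \<le> R \<longrightarrow> g n t \<in> Box B) sequentially"
  proof eventually_elim
    case (elim n)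
    show ?case
    proof (intro allI impI, rule ccontr)
      fix t assume t: "\<bar>t\<bar> \<le> R" "g n t \<notin> Box B"
      have "connected (g n ` {- R..R})"
        by (intro connected_continuous_image g_cont connected_Icc)
      moreover have "0 \<in> g n ` {- R..R} \<inter> Box B"
        using t r by (auto simp: in_Box B_def image_iff intro!: bexI[of _ 0] simp: g_0)
      moreover have "t \<in> {- R..R}" using t(1) by auto
      hence "g n t \<in> g n ` {- R..R} - Box B" using t(2) by blast
      ultimately have "g n ` {- R..R} \<inter> frontier (Box B) \<noteq> {}"
        by (intro connected_Int_frontier) blast+
      thus False using elim by (auto simp: abs_le_iff minus_le_iff)
    qed
  qed
  thus ?thesis by (rule that)
qed

text \<open>On the imaginary axis \<open>v = i \<theta>\<close> one has \<open>\<theta>\<^sup>2 phase_quot = t\<^sup>2\<close>, so the quotient has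
  non-negative real part there.  Cluster points of such \<open>v\<close> are real, hence \<open>0\<close>, where the limiting
  quotient is \<open>p r / 2 < 0\<close>.\<close>

lemma eventually_Re_nonzero:
  "eventually (\<lambda>n. \<forall>t. \<bar>t\<bar> \<le> R \<longrightarrow> t \<noteq> 0 \<longrightarrow> Re (g n t) \<noteq> 0) sequentially"
proof -
  obtain B where B: "eventually (\<lambda>n. \<forall>t. \<bar>t\<bar> \<le> R \<longrightarrow> g n t \<in> Box B) sequentially"
    by (rule eventually_in_Box)
  have "eventually (\<lambda>n. \<forall>t. \<bar>t\<bar> \<le> R \<longrightarrow> t \<noteq> 0 \<longrightarrow> g n t \<in> Box B \<longrightarrow> Re (g n t) \<noteq> 0) sequentially"
  proof (rule ccontr)
    assume "\<not> ?thesis"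
    then obtain s :: "nat \<Rightarrow> nat" where s: "strict_mono s"
      "\<forall>k. \<exists>t. \<bar>t\<bar> \<le> R \<and> t \<noteq> 0 \<and> g (s k) t \<in> Box B \<and> Re (g (s k) t) = 0"
      by (auto dest!: not_eventually_sequentiallyD)
    then obtain t where t: "\<And>k. \<bar>t k\<bar> \<le> R" "\<And>k. t k \<noteq> 0" "\<And>k. g (s k) (t k) \<in> Box B"
      "\<And>k. Re (g (s k) (t k)) = 0" by metis
    define v where "v = (\<lambda>k. g (s k) (t k))"
    obtain \<sigma> x where \<sigma>: "strict_mono \<sigma>" "(v \<circ> \<sigma>) \<longlonglongrightarrow> of_real x"
      using cluster_point[of s t R v B] s(1) t g_phase unfolding v_def by metis
    have "(\<lambda>k. Re ((v \<circ> \<sigma>) k)) \<longlonglongrightarrow> Re (of_real x)" by (intro tendsto_Re \<sigma>)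
    hence "x = 0" using t(4) by (simp add: v_def LIMSEQ_const_iff)
    hence v0: "(\<lambda>k. v (\<sigma> k)) \<longlonglongrightarrow> 0" using \<sigma>(2) by (simp add: o_def)
    have "(\<lambda>k. c (s (\<sigma> k)) l) \<longlonglongrightarrow> lim_coeff r p l" for l
      using LIMSEQ_subseq_LIMSEQ[OF c_lim strict_mono_o[OF s(1) \<sigma>(1)]] by (simp add: o_def)
    hence "(\<lambda>k. phase_quot m r (c (s (\<sigma> k))) (v (\<sigma> k))) \<longlonglongrightarrow> phase_quot m r (lim_coeff r p) 0"
      by (intro tendsto_phase_quot v0)
    hence "(\<lambda>k. Re (phase_quot m r (c (s (\<sigma> k))) (v (\<sigma> k)))) \<longlonglongrightarrow> Re (phase_quot m r (lim_coeff r p) 0)"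
      by (rule tendsto_Re)
    moreover have "Re (phase_quot m r (c (s k)) (v k)) \<ge> 0" for k
    proof -
      define \<theta> where "\<theta> = Im (v k)"
      have v: "v k = \<i> * of_real \<theta>" using t(4)[of k] by (simp add: \<theta>_def complex_eq_iff v_def)
      have "phase m r (c (s k)) (v k) = - of_real ((t k)\<^sup>2)" by (simp add: v_def g_phase)
      hence eq: "of_real (\<theta>\<^sup>2) * phase_quot m r (c (s k)) (v k) = of_real ((t k)\<^sup>2)"
        unfolding phase_eq by (simp add: v power_mult_distrib)
      hence "\<theta>\<^sup>2 * Re (phase_quot m r (c (s k)) (v k)) = (t k)\<^sup>2"
        using arg_cong[OF eq, of Re] unfolding scaleR_conv_of_real[symmetric] scaleR_complex.sel Re_complex_of_real by simp
      moreover have "(t k)\<^sup>2 > 0" using t(2) by simp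
      ultimately show ?thesis by (metis less_imp_le zero_less_mult_pos zero_le_power2 not_less_iff_gr_or_eq mult_zero_left order_le_less)
    qed
    ultimately have "Re (phase_quot m r (lim_coeff r p) 0) \<ge> 0"
      by (intro LIMSEQ_le_const) auto
    moreover have "Re (phase_quot m r (lim_coeff r p) 0) = p * real r / 2"
      unfolding phase_quot_lim_coeff_0[OF r] by (rule Re_complex_of_real)
    ultimately show False using p r by (simp add: zero_le_mult_iff)
  qed
  with B show ?thesis by eventually_elim blast
qed

text \<open>The real part of \<open>g t\<close> starts with positive derivative at \<open>t = 0\<close> and cannot vanish again.  This
  separates the two square roots of \<open>t\<^sup>2\<close>.\<close>

lemma eventually_Re_sign:
  "eventually (\<lambda>n. \<forall>t. \<bar>t\<bar> \<le> R \<longrightarrow> t * Re (g n t) \<ge> 0) sequentially"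
  using eventually_Re_nonzero[of R]
proof eventually_elim
  case (elim n)
  define h where "h = (\<lambda>t. Re (g n t))"
  have h_cont: "continuous_on A h" for A
    unfolding h_def by (intro continuous_intros g_cont)
  have "(g n has_vector_derivative vector_derivative (g n) (at 0)) (at 0)"
    using g_diff vector_derivative_works by blast
  hence "(h has_real_derivative Re (vector_derivative (g n) (at 0))) (at 0)"
    unfolding h_def has_real_derivative_iff_has_vector_derivative
    by (rule bounded_linear.has_vector_derivative[OF bounded_linear_Re])
  note d = this g_deriv0[of n]
  have h0: "h 0 = 0" by (simp add: h_def g_0)
  obtain d1 where d1: "d1 > 0" "\<And>x. 0 < x \<Longrightarrow> x < d1 \<Longrightarrow> h 0 < h (0 + x)"
    using DERIV_pos_inc_right[OF d] by auto
  obtain d2 where d2: "d2 > 0" "\<And>x. 0 < x \<Longrightarrow> x < d2 \<Longrightarrow> h (0 - x) < h 0"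
    using DERIV_pos_inc_left[OF d] by auto
  show ?case
  proof (intro allI impI)
    fix t assume t: "\<bar>t\<bar> \<le> R"
    consider "t = 0" | "t > 0" | "t < 0" by linarith
    thus "t * Re (g n t) \<ge> 0"
    proof cases
      case 2
      define u where "u = min t (d1 / 2)"
      have u: "0 < u" "u \<le> t" "h u > 0" using 2 d1 d1(2)[of u] h0 by (auto simp: u_def min_def)
      have "h t \<ge> 0"
      proof (rule ccontr)
        assume "\<not> h t \<ge> 0"
        then obtain y where "u \<le> y" "y \<le> t" "h y = 0"
          using IVT2'[of h t 0 u] u h_cont by auto
        thus False using elim u t unfolding h_def by (metis abs_of_pos less_le_not_le order.strict_trans2 order.trans)
      qed
      thus ?thesis using 2 by (simp add: h_def)
    next
      case 3
      define u where "u = max t (- (d2 / 2))"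
      have u: "u < 0" "t \<le> u" "h u < 0" using 3 d2 d2(2)[of "- u"] h0 by (auto simp: u_def max_def split: if_splits)
      have "h t \<le> 0"
      proof (rule ccontr)
        assume "\<not> h t \<le> 0"
        then obtain y where y: "t \<le> y" "y \<le> u" "h y = 0"
          using IVT2'[of h u 0 t] u h_cont by auto
        hence "\<bar>y\<bar> \<le> R" "y \<noteq> 0" using u t by auto
        thus False using elim y unfolding h_def by blast
      qed
      thus ?thesis using 3 by (simp add: h_def mult_nonpos_nonpos)
    qed simp
  qed
qed

text \<open>Locally uniform convergence of the thimbles to \<open>X\<close>, in sequential form.\<close>

lemma thimble_cluster:
  fixes s :: "nat \<Rightarrow> nat" and t :: "nat \<Rightarrow> real"
  assumes s: "strict_mono s" and t: "\<And>k. \<bar>t k\<bar> \<le> R"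
  obtains \<sigma> t0 where "strict_mono \<sigma>" "(\<lambda>k. t (\<sigma> k)) \<longlonglongrightarrow> t0" "\<bar>t0\<bar> \<le> R"
    "(\<lambda>k. g (s (\<sigma> k)) (t (\<sigma> k))) \<longlonglongrightarrow> of_real (X t0)"
proof -
  obtain B where B: "eventually (\<lambda>n. \<forall>t. \<bar>t\<bar> \<le> R \<longrightarrow> g n t \<in> Box B) sequentially"
    by (rule eventually_in_Box)
  obtain N where N: "\<And>n t. n \<ge> N \<Longrightarrow> \<bar>t\<bar> \<le> R \<Longrightarrow> g n t \<in> Box B \<and> t * Re (g n t) \<ge> 0"
    using eventually_conj[OF B eventually_Re_sign[of R]] unfolding eventually_sequentially by blast
  define s' where "s' = (\<lambda>k. s (k + N))"
  define t' where "t' = (\<lambda>k. t (k + N))"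
  have s': "strict_mono s'" using s by (auto simp: s'_def strict_mono_def)
  have "s' k \<ge> N" for k using seq_suble[OF s, of "k + N"] by (simp add: s'_def)
  hence in_B: "g (s' k) (t' k) \<in> Box B" and sg: "t' k * Re (g (s' k) (t' k)) \<ge> 0" for k
    using N t by (auto simp: t'_def)
  have t': "\<bar>t' k\<bar> \<le> R" for k using t by (simp add: t'_def)
  obtain \<sigma> x t0 where cl: "strict_mono \<sigma>" "(t' \<circ> \<sigma>) \<longlonglongrightarrow> t0" "\<bar>t0\<bar> \<le> R"
    "((\<lambda>k. g (s' k) (t' k)) \<circ> \<sigma>) \<longlonglongrightarrow> of_real x" "(T x)\<^sup>2 = t0\<^sup>2"
    using cluster_point[of s' t' R "\<lambda>k. g (s' k) (t' k)" B] s' t' in_B g_phase by metis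
  have "(\<lambda>k. (t' \<circ> \<sigma>) k * Re (((\<lambda>k. g (s' k) (t' k)) \<circ> \<sigma>) k)) \<longlonglongrightarrow> t0 * Re (of_real x)"
    by (intro tendsto_intros cl)
  hence "t0 * Re (of_real x) \<ge> 0"
    by (rule LIMSEQ_le_const) (use sg in auto)
  hence nn: "t0 * x \<ge> 0" by simp
  have "T x = t0"
  proof -
    have "T x = t0 \<or> T x = - t0" using cl(5) by (simp add: power2_eq_iff)
    moreover have "t0 = 0" if eq: "T x = - t0"
    proof (rule ccontr)
      assume "t0 \<noteq> 0"
      moreover have "sgn x = - sgn t0" using T_sgn[of x] eq by (simp add: sgn_minus)
      ultimately have "t0 * x < 0" by (auto simp: sgn_if mult_less_0_iff split: if_splits)
      thus False using nn by simp
    qed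
    ultimately show ?thesis by auto
  qed
  hence x: "x = X t0" using XT by auto
  show ?thesis
  proof (rule that)
    show "strict_mono (\<lambda>k. \<sigma> k + N)" using cl(1) by (auto simp: strict_mono_def)
  qed (use cl in \<open>simp_all add: s'_def t'_def x o_def\<close>)
qed

end

text \<open>Because of criticality the linear terms of the phase add up to \<open>- p v\<close> with real \<open>p\<close>, so
  \<open>Im v\<close> enters the real part of the phase only through bounded factors.  The bound therefore
  holds however often a thimble winds around \<open>Y = 0\<close>.\<close>

lemma Re_phase_le:
  assumes "(\<Sum>l\<in>{- int m..int r}. of_int l * c l) = complex_of_real p"
  shows "\<bar>Re (phase m r c v)\<bar> \<le> (\<Sum>l\<in>{- int m..int r}. norm (c l) * (exp (\<bar>of_int l * Re v\<bar>) + 1)) + \<bar>p * Re v\<bar>"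
proof -
  have "phase m r c v = (\<Sum>l\<in>{- int m..int r}. c l * (exp (of_int l * v) - 1)) - of_real p * v"
    unfolding phase_def assms[symmetric] sum_distrib_right
    by (simp add: sum_subtractf[symmetric] algebra_simps)
  hence "\<bar>Re (phase m r c v)\<bar> \<le> \<bar>Re (\<Sum>l\<in>{- int m..int r}. c l * (exp (of_int l * v) - 1))\<bar> + \<bar>p * Re v\<bar>"
    by (simp add: abs_triangle_ineq4)
  also have "\<bar>Re (\<Sum>l\<in>{- int m..int r}. c l * (exp (of_int l * v) - 1))\<bar> \<le>
      norm (\<Sum>l\<in>{- int m..int r}. c l * (exp (of_int l * v) - 1))" by (rule abs_Re_le_cmod)
  also have "\<dots> \<le> (\<Sum>l\<in>{- int m..int r}. norm (c l) * (exp (\<bar>of_int l * Re v\<bar>) + 1))"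
  proof (rule sum_norm_le)
    fix l :: int
    have "norm (exp (of_int l * v) - 1) \<le> norm (exp (of_int l * v)) + 1"
      using norm_triangle_ineq4[of "exp (of_int l * v)" 1] by simp
    also have "norm (exp (of_int l * v)) \<le> exp (\<bar>of_int l * Re v\<bar>)"
      by (simp add: norm_exp_eq_Re)
    finally show "norm (c l * (exp (of_int l * v) - 1)) \<le> norm (c l) * (exp (\<bar>of_int l * Re v\<bar>) + 1)"
      by (simp add: norm_mult mult_left_mono)
  qed
  finally show ?thesis by simp
qed

lemma continuous_pos_lower_bound:
  fixes Q :: "real \<Rightarrow> real"
  assumes "\<And>t. isCont Q t" "\<And>t. Q t > 0"
  obtains \<delta> where "\<delta> > 0" "\<And>t. \<bar>t\<bar> \<le> R \<Longrightarrow> Q t > \<delta>"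
proof (cases "R \<ge> 0")
  case True
  have "\<exists>x\<in>{- R..R}. \<forall>y\<in>{- R..R}. Q x \<le> Q y"
    using True assms(1) by (intro continuous_attains_inf continuous_at_imp_continuous_on) auto
  then obtain x where x: "\<And>y. y \<in> {- R..R} \<Longrightarrow> Q x \<le> Q y" by blast
  have "Q t > Q x / 2" if "\<bar>t\<bar> \<le> R" for t
  proof -
    have "t \<in> {- R..R}" using that by auto
    thus ?thesis using x[of t] assms(2)[of x] by linarith
  qed
  thus ?thesis using that[of "Q x / 2"] assms(2) by simp
next
  case False
  thus ?thesis by (intro that[of 1]) auto
qed

lemma exp_quot_of_real_nonzero: "exp_quot (of_real x) \<noteq> 0"
proof (cases "x = 0")
  case False
  hence "exp x - 1 \<noteq> 0" by simp
  hence "complex_of_real (exp x - 1) \<noteq> 0" using of_real_eq_0_iff[of "exp x - 1", where 'a = complex] by blast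
  thus ?thesis using False by (simp add: exp_quot_def exp_of_real)
qed (simp add: exp_quot_def)

context thimble_sequence
begin

lemma g_tendsto: "(\<lambda>n. g n t) \<longlonglongrightarrow> of_real (X t)"
proof (rule ccontr)
  assume "\<not> ?thesis"
  then obtain e where e: "e > 0" "\<not> eventually (\<lambda>n. dist (g n t) (of_real (X t)) < e) sequentially"
    by (auto simp: tendsto_iff)
  then obtain s :: "nat \<Rightarrow> nat" where s: "strict_mono s" "\<forall>k. \<not> dist (g (s k) t) (of_real (X t)) < e"
    by (auto dest!: not_eventually_sequentiallyD)
  obtain \<sigma> t0 where \<sigma>: "(\<lambda>k. t) \<longlonglongrightarrow> t0" "(\<lambda>k. g (s (\<sigma> k)) t) \<longlonglongrightarrow> of_real (X t0)"
    by (rule thimble_cluster[OF s(1), of "\<lambda>_. t" "\<bar>t\<bar>", OF order_refl])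
  have "t0 = t" using \<sigma>(1) by (simp add: LIMSEQ_const_iff)
  hence "eventually (\<lambda>k. dist (g (s (\<sigma> k)) t) (of_real (X t)) < e) sequentially"
    using \<sigma>(2) e(1) by (auto simp: tendsto_iff)
  thus False using s(2) by (auto dest: eventually_happens)
qed

text \<open>On the lines \<open>\<bar>Re v\<bar> = L\<close> the real part of the phase is bounded by some \<open>M0 + 1\<close>, so a thimble
  cannot cross them once \<open>t\<^sup>2\<close> exceeds this bound.  At \<open>t = R\<close> and \<open>t = - R\<close> it is already beyond
  them, as it is close to \<open>X R\<close> and \<open>X (- R)\<close>.\<close>

lemma eventually_far:
  assumes L: "L > 0"
  obtains R where "eventually (\<lambda>n. \<forall>t. \<bar>t\<bar> \<ge> R \<longrightarrow> \<bar>Re (g n t)\<bar> \<ge> L) sequentially"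
proof -
  define M where "M = (\<lambda>n. (\<Sum>l\<in>{- int m..int r}. norm (c n l) * (exp (\<bar>of_int l * L\<bar>) + 1)) + \<bar>p * L\<bar>)"
  define M0 where "M0 = (\<Sum>l\<in>{- int m..int r}. norm (lim_coeff r p l) * (exp (\<bar>of_int l * L\<bar>) + 1)) + \<bar>p * L\<bar>"
  have "M \<longlonglongrightarrow> M0" unfolding M_def M0_def by (intro tendsto_intros c_lim)
  hence M_ev: "eventually (\<lambda>n. M n < M0 + 1) sequentially" by (rule order_tendstoD) simp
  have M0: "M0 \<ge> 0" unfolding M0_def by (intro add_nonneg_nonneg sum_nonneg mult_nonneg_nonneg) auto
  \<comment> \<open>Beyond the parameters at which the phase bound or the limiting thimble meets the two lines.\<close>
  define R where "R = sqrt (M0 + 1) + \<bar>T L\<bar> + \<bar>T (- L)\<bar> + 1"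
  have R: "R > T L" "- R < T (- L)" "R > sqrt (M0 + 1)" "R > 0"
    using real_sqrt_ge_zero[of "M0 + 1"] M0 unfolding R_def by linarith+
  have "X R > L" using X_less_iff[of "T L" R] R by (simp add: XT)
  have "X (- R) < - L" using X_less_iff[of "- R" "T (- L)"] R by (simp add: XT)
  have "(\<lambda>n. Re (g n t)) \<longlonglongrightarrow> X t" for t
    using tendsto_Re[OF g_tendsto[of t]] by simp
  note lim = this
  have ev1: "eventually (\<lambda>n. Re (g n R) > L) sequentially"
    using order_tendstoD(1)[OF lim \<open>X R > L\<close>] .
  have ev2: "eventually (\<lambda>n. Re (g n (- R)) < - L) sequentially"
    using order_tendstoD(2)[OF lim \<open>X (- R) < - L\<close>] .
  have "eventually (\<lambda>n. \<forall>t. \<bar>t\<bar> \<ge> R \<longrightarrow> \<bar>Re (g n t)\<bar> \<ge> L) sequentially"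
    using ev1 ev2 M_ev
  proof eventually_elim
    case (elim n)
    have ne: "\<bar>Re (g n t)\<bar> \<noteq> L" if "\<bar>t\<bar> \<ge> R" for t
    proof
      assume eq: "\<bar>Re (g n t)\<bar> = L"
      have "\<bar>real_of_int l * Re (g n t)\<bar> = \<bar>real_of_int l * L\<bar>" for l
        unfolding abs_mult eq using L by simp
      moreover have "\<bar>p * Re (g n t)\<bar> = \<bar>p * L\<bar>" unfolding abs_mult eq using L by simp
      ultimately have "\<bar>Re (phase m r (c n) (g n t))\<bar> \<le> M n"
        using Re_phase_le[OF c_sum[of n], of "g n t"] unfolding M_def by (simp only:)
      hence "t\<^sup>2 < M0 + 1" using elim by (simp add: g_phase)
      hence "\<bar>t\<bar> < sqrt (M0 + 1)" by (metis real_sqrt_abs real_sqrt_less_iff)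
      thus False using that R by linarith
    qed
    define h where "h = (\<lambda>t. Re (g n t))"
    have h_cont: "continuous_on A h" for A
      unfolding h_def by (intro continuous_intros g_cont)
    show ?case
    proof (intro allI impI, rule ccontr)
      fix t assume t: "R \<le> \<bar>t\<bar>" "\<not> \<bar>Re (g n t)\<bar> \<ge> L"
      consider "t \<ge> R" | "t \<le> - R" using t by linarith
      thus False
      proof cases
        case 1
        have "h t \<le> L" "L \<le> h R" using t elim by (auto simp: h_def)
        then obtain y where "R \<le> y" "h y = L"
          using IVT2'[of h t L R] 1 h_cont by auto
        moreover from this have "\<bar>y\<bar> \<ge> R" by linarith
        ultimately show False using ne[of y] L by (auto simp: h_def)
      next
        case 2
        have "h (- R) \<le> - L" "- L \<le> h t" using t elim by (auto simp: h_def)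
        then obtain y where "y \<le> - R" "h y = - L"
          using IVT2'[of h "- R" "- L" t] 2 h_cont by auto
        thus False using ne[of y] L R by (auto simp: h_def)
      qed
    qed
  qed
  thus ?thesis by (rule that)
qed

text \<open>A positive continuous function of the limiting thimble is bounded below on compact sets, and the
  bound survives a small deformation.\<close>

lemma eventually_bounded_below:
  fixes Q :: "nat \<Rightarrow> real \<Rightarrow> real" and q :: "real \<Rightarrow> real"
  assumes q: "\<And>t. isCont q t" "\<And>t. q t > 0"
    and Q: "\<And>s u t0. strict_mono s \<Longrightarrow> u \<longlonglongrightarrow> t0 \<Longrightarrow> (\<lambda>k. g (s k) (u k)) \<longlonglongrightarrow> of_real (X t0) \<Longrightarrow>
        (\<lambda>k. Q (s k) (u k)) \<longlonglongrightarrow> q t0"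
  obtains \<delta> where "\<delta> > 0" "eventually (\<lambda>n. \<forall>t. \<bar>t\<bar> \<le> R \<longrightarrow> Q n t \<ge> \<delta>) sequentially"
proof -
  obtain \<delta> where \<delta>: "\<delta> > 0" "\<And>t. \<bar>t\<bar> \<le> R \<Longrightarrow> q t > \<delta>"
    using continuous_pos_lower_bound[OF q] by metis
  have "eventually (\<lambda>n. \<forall>t. \<bar>t\<bar> \<le> R \<longrightarrow> Q n t \<ge> \<delta>) sequentially"
  proof (rule ccontr)
    assume "\<not> ?thesis"
    then obtain s :: "nat \<Rightarrow> nat" where s: "strict_mono s" "\<forall>k. \<exists>t. \<bar>t\<bar> \<le> R \<and> \<not> Q (s k) t \<ge> \<delta>"
      by (auto dest!: not_eventually_sequentiallyD)
    then obtain t where t: "\<And>k. \<bar>t k\<bar> \<le> R" "\<And>k. Q (s k) (t k) < \<delta>" by (metis not_le)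
    obtain \<sigma> t0 where \<sigma>: "strict_mono \<sigma>" "(\<lambda>k. t (\<sigma> k)) \<longlonglongrightarrow> t0" "\<bar>t0\<bar> \<le> R"
      "(\<lambda>k. g (s (\<sigma> k)) (t (\<sigma> k))) \<longlonglongrightarrow> of_real (X t0)"
      by (rule thimble_cluster[OF s(1) t(1)])
    have "(\<lambda>k. Q (s (\<sigma> k)) (t (\<sigma> k))) \<longlonglongrightarrow> q t0"
      using Q[of "\<lambda>k. s (\<sigma> k)" "\<lambda>k. t (\<sigma> k)" t0] \<sigma> strict_mono_o[OF s(1) \<sigma>(1)] by (simp add: o_def)
    hence "q t0 \<le> \<delta>"
      by (rule LIMSEQ_le_const2) (use t(2) less_imp_le in blast)
    thus False using \<delta>(2)[OF \<sigma>(3)] by simp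
  qed
  thus ?thesis using that \<delta>(1) by blast
qed

lemma of_real_X_cont: "isCont (\<lambda>t. complex_of_real (X t)) t"
  by (intro continuous_intros X_cont)

text \<open>If the limit of \<open>\<rho>\<close> is not a positive real, the limiting thimble stays away from the pole.  If
  \<open>\<rho> = 1\<close>, the pole is at \<open>t = 0\<close>: then \<open>\<bar>t\<bar>\<^sup>2 = \<bar>g\<bar>\<^sup>2 \<bar>phase_quot\<bar>\<close> and
  \<open>exp g - 1 = g exp_quot g\<close>, and the ratio of the two quotients is bounded below.\<close>

lemma eventually_pole_distance:
  fixes \<rho> :: "nat \<Rightarrow> complex" and \<omega> :: complex
  assumes \<rho>: "\<rho> \<longlonglongrightarrow> \<omega>" and cases: "(\<forall>n. \<rho> n = 1) \<or> (\<forall>x. \<omega> \<noteq> exp (of_real x))"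
  obtains \<delta> where "\<delta> > 0" "eventually (\<lambda>n. \<forall>t. \<bar>t\<bar> \<le> R \<longrightarrow> norm (exp (g n t) - \<rho> n) \<ge> \<delta> * \<bar>t\<bar>) sequentially"
  using cases
proof (elim disjE)
  assume \<omega>: "\<forall>x. \<omega> \<noteq> exp (complex_of_real x)"
  obtain \<delta> where \<delta>: "\<delta> > 0" "eventually (\<lambda>n. \<forall>t. \<bar>t\<bar> \<le> R \<longrightarrow> norm (exp (g n t) - \<rho> n) \<ge> \<delta>) sequentially"
  proof (rule eventually_bounded_below[of "\<lambda>t. norm (exp (complex_of_real (X t)) - \<omega>)" "\<lambda>n t. norm (exp (g n t) - \<rho> n)" R])
    show "isCont (\<lambda>t. norm (exp (complex_of_real (X t)) - \<omega>)) t" for t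
      by (intro continuous_intros X_cont)
    show "norm (exp (complex_of_real (X t)) - \<omega>) > 0" for t using \<omega> by (metis right_minus_eq zero_less_norm_iff)
    show "(\<lambda>k. norm (exp (g (s k) (u k)) - \<rho> (s k))) \<longlonglongrightarrow> norm (exp (complex_of_real (X t0)) - \<omega>)"
      if "strict_mono s" "(\<lambda>k. g (s k) (u k)) \<longlonglongrightarrow> of_real (X t0)" for s :: "nat \<Rightarrow> nat" and u t0
    proof -
      have "(\<lambda>k. \<rho> (s k)) \<longlonglongrightarrow> \<omega>"
        using LIMSEQ_subseq_LIMSEQ[OF \<rho> that(1)] by (simp add: o_def)
      thus ?thesis using that(2) by (intro tendsto_intros)
    qed
  qed
  show thesis
  proof (rule that[of "\<delta> / (\<bar>R\<bar> + 1)"])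
    show "\<delta> / (\<bar>R\<bar> + 1) > 0" using \<delta>(1) by (simp add: add_nonneg_pos)
    show "eventually (\<lambda>n. \<forall>t. \<bar>t\<bar> \<le> R \<longrightarrow> norm (exp (g n t) - \<rho> n) \<ge> \<delta> / (\<bar>R\<bar> + 1) * \<bar>t\<bar>) sequentially"
      using \<delta>(2)
    proof eventually_elim
      case (elim n)
      show ?case
      proof (intro allI impI)
        fix t assume t: "\<bar>t\<bar> \<le> R"
        have "\<delta> * \<bar>t\<bar> \<le> \<delta> * (\<bar>R\<bar> + 1)" using t \<delta>(1) by (intro mult_left_mono) auto
        hence "\<delta> / (\<bar>R\<bar> + 1) * \<bar>t\<bar> \<le> \<delta>" by (simp add: field_simps)
        thus "\<delta> / (\<bar>R\<bar> + 1) * \<bar>t\<bar> \<le> norm (exp (g n t) - \<rho> n)" using elim t by force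
      qed
    qed
  qed
next
  assume \<rho>1: "\<forall>n. \<rho> n = 1"
  define pq where "pq = (\<lambda>n t. phase_quot m r (c n) (g n t))"
  obtain \<delta> where \<delta>: "\<delta> > 0" "eventually (\<lambda>n. \<forall>t. \<bar>t\<bar> \<le> R \<longrightarrow> norm (exp_quot (g n t)) / (norm (pq n t) + 1) \<ge> \<delta>) sequentially"
  proof (rule eventually_bounded_below[of "\<lambda>t. norm (exp_quot (complex_of_real (X t))) / (norm (phase_quot m r (lim_coeff r p) (of_real (X t))) + 1)"
       "\<lambda>n t. norm (exp_quot (g n t)) / (norm (pq n t) + 1)" R])
    have lim: "(\<lambda>t. complex_of_real (X t)) \<midarrow>t\<rightarrow> complex_of_real (X t)" for t
      using of_real_X_cont by (simp add: isCont_def)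
    have nz: "norm z + 1 \<noteq> 0" for z :: complex by (metis add_nonneg_pos norm_ge_zero less_numeral_extra(1) less_irrefl)
    show "isCont (\<lambda>t. norm (exp_quot (complex_of_real (X t))) / (norm (phase_quot m r (lim_coeff r p) (of_real (X t))) + 1)) t" for t
      unfolding isCont_def by (intro tendsto_intros tendsto_phase_quot lim nz)
    show "norm (exp_quot (complex_of_real (X t))) / (norm (phase_quot m r (lim_coeff r p) (of_real (X t))) + 1) > 0" for t
      using exp_quot_of_real_nonzero by (intro divide_pos_pos add_nonneg_pos) auto
    show "(\<lambda>k. norm (exp_quot (g (s k) (u k))) / (norm (pq (s k) (u k)) + 1)) \<longlonglongrightarrow>
       norm (exp_quot (complex_of_real (X t0))) / (norm (phase_quot m r (lim_coeff r p) (of_real (X t0))) + 1)"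
      if "strict_mono s" "(\<lambda>k. g (s k) (u k)) \<longlonglongrightarrow> of_real (X t0)" for s :: "nat \<Rightarrow> nat" and u t0
    proof -
      have "(\<lambda>k. c (s k) l) \<longlonglongrightarrow> lim_coeff r p l" for l
        using LIMSEQ_subseq_LIMSEQ[OF c_lim that(1)] by (simp add: o_def)
      thus ?thesis unfolding pq_def by (intro tendsto_intros tendsto_phase_quot that nz)
    qed
  qed
  show thesis
  proof (rule that[OF \<delta>(1)])
    show "eventually (\<lambda>n. \<forall>t. \<bar>t\<bar> \<le> R \<longrightarrow> norm (exp (g n t) - \<rho> n) \<ge> \<delta> * \<bar>t\<bar>) sequentially"
      using \<delta>(2)
    proof eventually_elim
      case (elim n)
      show ?case
      proof (intro allI impI)
        fix t assume t: "\<bar>t\<bar> \<le> R"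
        have "g n t ^ 2 * pq n t = - of_real (t\<^sup>2)"
          using g_phase[of n t] unfolding phase_eq pq_def .
        hence "norm (g n t ^ 2 * pq n t) = norm (- complex_of_real (t\<^sup>2))" by (rule arg_cong)
        hence eq: "norm (g n t) ^ 2 * norm (pq n t) = t\<^sup>2"
          by (simp add: norm_mult norm_power)
        have "norm (pq n t) \<le> (norm (pq n t) + 1) ^ 2"
          by (simp add: power2_eq_square algebra_simps)
        hence "norm (g n t) ^ 2 * norm (pq n t) \<le> norm (g n t) ^ 2 * (norm (pq n t) + 1) ^ 2"
          by (intro mult_left_mono) auto
        hence "t\<^sup>2 \<le> (norm (g n t) * (norm (pq n t) + 1))\<^sup>2"
          unfolding eq power_mult_distrib .
        hence "\<bar>t\<bar> \<le> norm (g n t) * (norm (pq n t) + 1)"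
          by (metis abs_le_square_iff abs_of_nonneg add_nonneg_nonneg mult_nonneg_nonneg norm_ge_zero zero_le_one)
        hence "\<delta> * \<bar>t\<bar> \<le> \<delta> * (norm (g n t) * (norm (pq n t) + 1))"
          using \<delta>(1) by (intro mult_left_mono) auto
        also have "\<dots> = norm (g n t) * (\<delta> * (norm (pq n t) + 1))" by simp
        also have "\<dots> \<le> norm (g n t) * norm (exp_quot (g n t))"
        proof (intro mult_left_mono)
          have "\<delta> \<le> norm (exp_quot (g n t)) / (norm (pq n t) + 1)" using elim t by blast
          thus "\<delta> * (norm (pq n t) + 1) \<le> norm (exp_quot (g n t))"
            by (subst (asm) pos_le_divide_eq) (auto simp: add_nonneg_pos)
        qed auto
        also have "\<dots> = norm (exp (g n t) - \<rho> n)"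
          using \<rho>1 by (simp flip: norm_mult add: exp_quot_mult)
        finally show "\<delta> * \<bar>t\<bar> \<le> norm (exp (g n t) - \<rho> n)" .
      qed
    qed
  qed
qed

text \<open>The uniform bound for dominated convergence.  For small \<open>\<bar>t\<bar>\<close> it is the distance from the
  pole; for large \<open>\<bar>t\<bar>\<close> the modulus of \<open>exp (g t)\<close> is at least \<open>4\<close> or at most \<open>1 / 4\<close>, while that
  of \<open>\<rho>\<close> is close to \<open>1\<close>.\<close>

lemma eventually_kernel_bound:
  fixes \<rho> :: "nat \<Rightarrow> complex" and \<omega> :: complex
  assumes \<rho>: "\<rho> \<longlonglongrightarrow> \<omega>" and \<omega>: "norm \<omega> = 1" and cases: "(\<forall>n. \<rho> n = 1) \<or> (\<forall>x. \<omega> \<noteq> exp (of_real x))"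
  obtains C where "C > 0" "eventually (\<lambda>n. \<forall>t. (t \<noteq> 0 \<longrightarrow> exp (g n t) \<noteq> \<rho> n) \<and>
     norm (of_real t * (\<rho> n / (exp (g n t) - \<rho> n))) \<le> C * (1 + \<bar>t\<bar>)) sequentially"
proof -
  obtain R where R: "eventually (\<lambda>n. \<forall>t. \<bar>t\<bar> \<ge> R \<longrightarrow> \<bar>Re (g n t)\<bar> \<ge> ln 4) sequentially"
    by (rule eventually_far[of "ln 4"]) auto
  obtain \<delta> where \<delta>: "\<delta> > 0" "eventually (\<lambda>n. \<forall>t. \<bar>t\<bar> \<le> R \<longrightarrow> norm (exp (g n t) - \<rho> n) \<ge> \<delta> * \<bar>t\<bar>) sequentially"
    by (rule eventually_pole_distance[OF \<rho> cases])
  have "(\<lambda>n. norm (\<rho> n)) \<longlonglongrightarrow> 1" using tendsto_norm[OF \<rho>] \<omega> by simp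
  from order_tendstoD(1)[OF this, of "1 / 2"] order_tendstoD(2)[OF this, of 2]
  have n1: "eventually (\<lambda>n. norm (\<rho> n) > 1 / 2) sequentially" "eventually (\<lambda>n. norm (\<rho> n) < 2) sequentially"
    by simp_all
  define C where "C = 2 / \<delta> + 8"
  have C: "C > 0" "C \<ge> 2 / \<delta>" "C \<ge> 8" using \<delta>(1) by (auto simp: C_def add_nonneg_pos)
  have "eventually (\<lambda>n. \<forall>t. (t \<noteq> 0 \<longrightarrow> exp (g n t) \<noteq> \<rho> n) \<and>
     norm (of_real t * (\<rho> n / (exp (g n t) - \<rho> n))) \<le> C * (1 + \<bar>t\<bar>)) sequentially"
    using R \<delta>(2) n1
  proof eventually_elim
    case (elim n)
    show ?case
    proof
      fix t
      define D where "D = norm (exp (g n t) - \<rho> n)"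
      consider "t = 0" | "t \<noteq> 0" "\<bar>t\<bar> \<le> R" | "t \<noteq> 0" "\<bar>t\<bar> \<ge> R" by linarith
      hence "t = 0 \<or> D > 0 \<and> norm (\<rho> n) * \<bar>t\<bar> \<le> C * (1 + \<bar>t\<bar>) * D"
      proof cases
        case 2
        have "\<delta> * \<bar>t\<bar> > 0" using 2 \<delta>(1) by simp
        moreover have *: "\<delta> * \<bar>t\<bar> \<le> D" using elim 2 by (auto simp: D_def)
        ultimately have D: "D > 0" by linarith
        have "norm (\<rho> n) * \<bar>t\<bar> \<le> 2 * \<bar>t\<bar>" using elim by (intro mult_right_mono) auto
        also have "\<dots> = 2 / \<delta> * (\<delta> * \<bar>t\<bar>)" using \<delta>(1) by simp
        also have "\<dots> \<le> 2 / \<delta> * D" using * \<delta>(1) by (intro mult_left_mono) auto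
        also have "\<dots> \<le> C * (1 + \<bar>t\<bar>) * D"
        proof (intro mult_right_mono)
          have "2 / \<delta> * 1 \<le> C * (1 + \<bar>t\<bar>)" using C \<delta>(1) by (intro mult_mono) auto
          thus "2 / \<delta> \<le> C * (1 + \<bar>t\<bar>)" by simp
        qed (use D in auto)
        finally show ?thesis using D by blast
      next
        case 3
        have "\<bar>Re (g n t)\<bar> \<ge> ln 4" using elim 3 by blast
        hence "norm (exp (g n t)) \<ge> 4 \<or> norm (exp (g n t)) \<le> 1 / 4"
        proof (cases "Re (g n t) \<ge> ln 4")
          case True
          hence "exp (Re (g n t)) \<ge> exp (ln 4)" by (subst exp_le_cancel_iff)
          thus ?thesis by (simp add: norm_exp_eq_Re)
        next
          case False
          hence "Re (g n t) \<le> - ln 4" using \<open>\<bar>Re (g n t)\<bar> \<ge> ln 4\<close> by linarith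
          hence "exp (Re (g n t)) \<le> exp (- ln 4)" by (subst exp_le_cancel_iff)
          thus ?thesis by (simp add: norm_exp_eq_Re exp_minus)
        qed
        moreover have "D \<ge> \<bar>norm (exp (g n t)) - norm (\<rho> n)\<bar>"
          unfolding D_def by (rule norm_triangle_ineq3)
        ultimately have D: "D \<ge> 1 / 4" using elim(3,4) by linarith
        have "norm (\<rho> n) * \<bar>t\<bar> \<le> 2 * \<bar>t\<bar>" using elim by (intro mult_right_mono) auto
        also have "\<dots> \<le> 8 * \<bar>t\<bar> * (1 / 4)" by simp
        also have "\<dots> \<le> C * (1 + \<bar>t\<bar>) * D"
          using C D by (intro mult_mono) auto
        finally show ?thesis using D by auto
      qed auto
      moreover have "norm (of_real t * (\<rho> n / (exp (g n t) - \<rho> n))) = norm (\<rho> n) * \<bar>t\<bar> / D"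
        by (simp add: norm_mult norm_divide D_def)
      ultimately show "(t \<noteq> 0 \<longrightarrow> exp (g n t) \<noteq> \<rho> n) \<and>
        norm (of_real t * (\<rho> n / (exp (g n t) - \<rho> n))) \<le> C * (1 + \<bar>t\<bar>)"
        using C by (auto simp: D_def divide_le_eq)
    qed
  qed
  thus ?thesis using that C by blast
qed

end

section \<open>Integration by parts for finite parts\<close>

text \<open>The fundamental theorem of calculus on the complement of an interval.  In the sense of Henstock
  and Kurzweil a derivative is integrable even where it is not absolutely integrable, so that only
  the limits of \<open>G\<close> at infinity enter, and not the length of the thimble.\<close>

lemma has_integral_outside_interval:
  fixes G G' :: "real \<Rightarrow> complex"
  assumes G: "\<And>t. t \<noteq> 0 \<Longrightarrow> (G has_vector_derivative G' t) (at t)"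
    and top: "(G \<longlongrightarrow> 0) at_top" and bot: "(G \<longlongrightarrow> 0) at_bot" and e: "e > 0"
  shows "(G' has_integral (G (- e) - G e)) {t. e \<le> \<bar>t\<bar>}"
proof -
  define f where "f = (\<lambda>t. if t \<in> {t. e \<le> \<bar>t\<bar>} then G' t else 0)"
  have box: "(f has_integral ((G (- e) - G a) + (G b - G e))) {a..b}" if "a \<le> - e" "e \<le> b" for a b
  proof -
    have "(G' has_integral (G (- e) - G a)) {a..- e}"
    proof (rule fundamental_theorem_of_calculus)
      fix x assume "x \<in> {a..- e}"
      hence "x \<noteq> 0" using e by auto
      from G[OF this] show "(G has_vector_derivative G' x) (at x within {a..- e})"
        by (rule has_vector_derivative_at_within)
    qed (fact that(1))
    hence 1: "(f has_integral (G (- e) - G a)) {a..- e}"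
      by (rule has_integral_eq[rotated]) (use e in \<open>auto simp: f_def\<close>)
    have "(f has_integral 0) {- e..e}"
      by (rule has_integral_spike_finite[where S = "{- e, e}" and f = "\<lambda>_. 0"]) (auto simp: f_def)
    note 2 = this
    have "(G' has_integral (G b - G e)) {e..b}"
    proof (rule fundamental_theorem_of_calculus)
      fix x assume "x \<in> {e..b}"
      hence "x \<noteq> 0" using e by auto
      from G[OF this] show "(G has_vector_derivative G' x) (at x within {e..b})"
        by (rule has_vector_derivative_at_within)
    qed (fact that(2))
    hence 3: "(f has_integral (G b - G e)) {e..b}"
      by (rule has_integral_eq[rotated]) (use e in \<open>auto simp: f_def\<close>)
    have "(f has_integral (G (- e) - G a + 0)) {a..e}"
      using has_integral_combine[OF _ _ 1 2] that e by simp
    from has_integral_combine[OF _ _ this 3] show ?thesis using that e by simp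
  qed
  show ?thesis
    unfolding has_integral_alt' f_def[symmetric]
  proof (intro conjI allI impI)
    fix a b :: real
    have "f integrable_on {min a (- e)..max b e}"
      using box[of "min a (- e)" "max b e"] by (auto simp: integrable_on_def)
    thus "f integrable_on cbox a b"
      by (rule integrable_on_subcbox) auto
  next
    fix d :: real assume d: "d > 0"
    obtain b0 where b0: "\<And>t. t \<ge> b0 \<Longrightarrow> dist (G t) 0 < d / 2"
      using tendstoD[OF top, of "d / 2"] d by (auto simp: eventually_at_top_linorder)
    obtain a0 where a0: "\<And>t. t \<le> a0 \<Longrightarrow> dist (G t) 0 < d / 2"
      using tendstoD[OF bot, of "d / 2"] d by (auto simp: eventually_at_bot_linorder)
    define B where "B = \<bar>a0\<bar> + \<bar>b0\<bar> + e + 1"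
    show "\<exists>B>0. \<forall>a b. ball 0 B \<subseteq> cbox a b \<longrightarrow> norm (integral (cbox a b) f - (G (- e) - G e)) < d"
    proof (intro exI conjI allI impI)
      show "B > 0" using e by (simp add: B_def add_nonneg_pos)
      fix a b :: real assume sub: "ball 0 B \<subseteq> cbox a b"
      have "- (B - 1/2) \<in> ball (0::real) B" "B - 1/2 \<in> ball (0::real) B" using e by (auto simp: B_def dist_real_def)
      hence ab: "a \<le> - (B - 1/2)" "B - 1/2 \<le> b" using sub by auto
      hence le: "a \<le> - e" "e \<le> b" and "a \<le> a0" "b0 \<le> b" using e unfolding B_def by linarith+
      with box[OF le] have "integral (cbox a b) f = (G (- e) - G a) + (G b - G e)"
        unfolding box_real by (intro integral_unique)
      hence "norm (integral (cbox a b) f - (G (- e) - G e)) = norm (G b - G a)" by simp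
      also have "\<dots> \<le> norm (G b) + norm (G a)" by (rule norm_triangle_ineq4)
      also have "\<dots> < d" using a0[OF \<open>a \<le> a0\<close>] b0[OF \<open>b0 \<le> b\<close>] by simp
      finally show "norm (integral (cbox a b) f - (G (- e) - G e)) < d" .
    qed
  qed
qed

lemma exp_minus_abs_integrable: "(\<lambda>t::real. exp (- \<bar>t\<bar>)) integrable_on UNIV"
proof -
  define G where "G = (\<lambda>t::real. complex_of_real (- sgn t * exp (- \<bar>t\<bar>)))"
  have "(G has_vector_derivative of_real (exp (- \<bar>t\<bar>))) (at t)" if "t \<noteq> 0" for t
  proof (cases "t > 0")
    case True
    have "((\<lambda>t. - exp (- t)) has_real_derivative exp (- t)) (at t)"
      by (auto intro!: derivative_eq_intros)
    hence "((\<lambda>t. complex_of_real (- exp (- t))) has_vector_derivative of_real (exp (- t))) (at t)"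
      unfolding has_real_derivative_iff_has_vector_derivative
      by (rule bounded_linear.has_vector_derivative[OF bounded_linear_of_real])
    hence "(G has_vector_derivative of_real (exp (- t))) (at t)"
      by (rule has_vector_derivative_transform_within_open[of _ _ _ "{0<..}"]) (use True in \<open>auto simp: G_def\<close>)
    thus ?thesis using True by simp
  next
    case False
    hence neg: "t < 0" using that by simp
    have "((\<lambda>t. exp t) has_real_derivative exp t) (at t)"
      by (auto intro!: derivative_eq_intros)
    hence "((\<lambda>t. complex_of_real (exp t)) has_vector_derivative of_real (exp t)) (at t)"
      unfolding has_real_derivative_iff_has_vector_derivative
      by (rule bounded_linear.has_vector_derivative[OF bounded_linear_of_real])
    hence "(G has_vector_derivative of_real (exp t)) (at t)"
      by (rule has_vector_derivative_transform_within_open[of _ _ _ "{..<0}"]) (use neg in \<open>auto simp: G_def\<close>)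
    thus ?thesis using neg by simp
  qed
  moreover have "(G \<longlongrightarrow> of_real 0) at_top" unfolding G_def by (intro tendsto_of_real) real_asymp
  moreover have "(G \<longlongrightarrow> of_real 0) at_bot" unfolding G_def by (intro tendsto_of_real) real_asymp
  ultimately have "((\<lambda>t. complex_of_real (exp (- \<bar>t\<bar>))) has_integral (G (- 1) - G 1)) {t. 1 \<le> \<bar>t\<bar>}"
    by (intro has_integral_outside_interval) auto
  from has_integral_linear[OF this bounded_linear_Re]
  have 1: "(\<lambda>t. exp (- \<bar>t\<bar>)) integrable_on {t::real. 1 \<le> \<bar>t\<bar>}"
    unfolding o_def Re_complex_of_real by (rule has_integral_integrable)
  have 2: "(\<lambda>t. exp (- \<bar>t\<bar>)) integrable_on {- 1..1::real}"
    by (intro integrable_continuous_real continuous_intros)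
  have "{t::real. 1 \<le> \<bar>t\<bar>} \<inter> {- 1..1} \<subseteq> {- 1, 1}" by auto
  hence "negligible ({t::real. 1 \<le> \<bar>t\<bar>} \<inter> {- 1..1})"
    by (rule negligible_subset[rotated]) (simp add: negligible_finite)
  moreover have "{t::real. 1 \<le> \<bar>t\<bar>} \<union> {- 1..1} = UNIV" by auto
  ultimately show ?thesis using integrable_Un[OF _ 1 2] by simp
qed

text \<open>The negative of the derivative of \<open>exp (t\<^sup>2 / z)\<close>.\<close>

definition gauss_weight :: "real \<Rightarrow> real \<Rightarrow> real" where
  "gauss_weight z t = - (2 * t / z) * exp (t\<^sup>2 / z)"

text \<open>Completing the square, \<open>(\<bar>t\<bar> + z)\<^sup>2 \<ge> 0\<close>, bounds \<open>t\<^sup>2 / z\<close> by \<open>- z - 2 \<bar>t\<bar>\<close>; half of the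
  decay absorbs the factor \<open>1 + \<bar>t\<bar>\<close>.\<close>

lemma gauss_bound:
  fixes z t :: real
  assumes z: "z < 0"
  shows "(1 + \<bar>t\<bar>) * exp (t\<^sup>2 / z) \<le> exp (- z) * exp (- \<bar>t\<bar>)"
proof -
  have "t\<^sup>2 / z \<le> - z - 2 * \<bar>t\<bar>"
  proof -
    have "(\<bar>t\<bar> + z)\<^sup>2 \<ge> 0" by (rule zero_le_power2)
    hence "t\<^sup>2 + 2 * \<bar>t\<bar> * z + z\<^sup>2 \<ge> 0" by (simp add: power2_sum)
    hence "t\<^sup>2 \<ge> (- z - 2 * \<bar>t\<bar>) * z" by (simp add: power2_eq_square algebra_simps)
    thus ?thesis using z by (simp add: neg_divide_le_eq)
  qed
  hence "exp (t\<^sup>2 / z) \<le> exp (- z - 2 * \<bar>t\<bar>)" by simp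
  hence "(1 + \<bar>t\<bar>) * exp (t\<^sup>2 / z) \<le> exp \<bar>t\<bar> * exp (- z - 2 * \<bar>t\<bar>)"
    by (intro mult_mono exp_ge_add_one_self) auto
  also have "\<dots> = exp (- z) * exp (- \<bar>t\<bar>)" by (simp flip: exp_add)
  finally show ?thesis .
qed

lemma gauss_weight_integrable:
  fixes f :: "real \<Rightarrow> complex"
  assumes z: "z < 0" and C: "\<And>t. norm (of_real t * f t) \<le> C * (1 + \<bar>t\<bar>)" "C \<ge> 0"
    and f: "f \<in> borel_measurable borel"
  shows "(\<lambda>t. of_real (gauss_weight z t) * f t) absolutely_integrable_on UNIV"
    and "norm (of_real (gauss_weight z t) * f t) \<le> 2 / - z * C * exp (- z) * exp (- \<bar>t\<bar>)"
proof -
  have bd: "norm (of_real (gauss_weight z t) * f t) \<le> 2 / - z * C * exp (- z) * exp (- \<bar>t\<bar>)" for t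
  proof -
    have "norm (of_real (gauss_weight z t) * f t) = 2 / - z * exp (t\<^sup>2 / z) * norm (of_real t * f t)"
    proof -
      have "\<bar>gauss_weight z t\<bar> = 2 / - z * exp (t\<^sup>2 / z) * \<bar>t\<bar>"
        using z by (simp add: gauss_weight_def abs_mult)
      thus ?thesis by (simp add: norm_mult)
    qed
    also have "\<dots> \<le> 2 / - z * exp (t\<^sup>2 / z) * (C * (1 + \<bar>t\<bar>))"
      using z by (intro mult_left_mono C mult_nonneg_nonneg) auto
    also have "\<dots> = 2 / - z * C * ((1 + \<bar>t\<bar>) * exp (t\<^sup>2 / z))" by simp
    also have "\<dots> \<le> 2 / - z * C * (exp (- z) * exp (- \<bar>t\<bar>))"
      using z C(2) by (intro mult_left_mono gauss_bound mult_nonneg_nonneg) auto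
    finally show ?thesis by simp
  qed
  thus "norm (of_real (gauss_weight z t) * f t) \<le> 2 / - z * C * exp (- z) * exp (- \<bar>t\<bar>)" .
  have "continuous_on UNIV (\<lambda>t. complex_of_real (gauss_weight z t))"
    unfolding gauss_weight_def using z by (intro continuous_intros) auto
  hence [measurable]: "(\<lambda>t. complex_of_real (gauss_weight z t)) \<in> borel_measurable borel"
    by (rule borel_measurable_continuous_onI)
  note [measurable] = f
  have "(\<lambda>t. of_real (gauss_weight z t) * f t) \<in> borel_measurable borel" by measurable
  hence "(\<lambda>t. of_real (gauss_weight z t) * f t) \<in> borel_measurable (lebesgue_on UNIV)"
    unfolding lebesgue_on_UNIV_eq by (simp add: measurable_completion)
  moreover have "(\<lambda>t. 2 / - z * C * exp (- z) * exp (- \<bar>t\<bar>)) integrable_on UNIV"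
    by (intro integrable_on_mult_right exp_minus_abs_integrable)
  ultimately show "(\<lambda>t. of_real (gauss_weight z t) * f t) absolutely_integrable_on UNIV"
    using bd by (intro measurable_bounded_by_integrable_imp_absolutely_integrable) auto
qed

text \<open>Integration by parts for finite parts: \<open>G\<close> is the boundary term, and the last assumption says that
  its jump across the pole is what the finite part subtracts.\<close>

lemma fp_integral_eq:
  fixes G G' gi w :: "real \<Rightarrow> complex"
  assumes G: "\<And>t. t \<noteq> 0 \<Longrightarrow> (G has_vector_derivative G' t) (at t)"
    and top: "(G \<longlongrightarrow> 0) at_top" and bot: "(G \<longlongrightarrow> 0) at_bot"
    and w: "w absolutely_integrable_on UNIV"
    and gi: "\<And>t. t \<noteq> 0 \<Longrightarrow> gi t = G' t + w t"
    and A: "((\<lambda>t. of_real (t\<^sup>2) * gi t) \<longlongrightarrow> A) (at 0)"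
    and odd: "((\<lambda>e. G e - G (- e) + 2 * A / of_real e) \<longlongrightarrow> 0) (at_right 0)"
  shows "fp_integral gi = integral UNIV w"
proof -
  define J where "J = (\<lambda>e. integral {- 1..e} w)"
  have w_int: "w integrable_on S" if "S \<in> sets lebesgue" for S
    using set_integrable_subset[OF w that] set_lebesgue_integral_eq_integral(1) by blast
  have J_cont: "continuous_on {- 1..1} J"
    unfolding J_def by (intro indefinite_integral_continuous_1 w_int) simp
  hence "isCont J 0" by (rule continuous_on_interior) simp
  hence J0: "(J \<longlongrightarrow> J 0) (at 0)" by (simp add: isCont_def)
  have J1: "(J \<longlongrightarrow> J 0) (at_right 0)"
    by (rule tendsto_mono[OF _ J0]) (simp add: at_le)
  have J2: "((\<lambda>e. J (- e)) \<longlongrightarrow> J 0) (at_right 0)"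
  proof (rule filterlim_compose[OF J0])
    show "filterlim uminus (at 0) (at_right (0::real))"
      unfolding filterlim_at by (auto intro!: tendsto_eq_intros simp: eventually_at_filter)
  qed
  have eq: "integral {t. e \<le> \<bar>t\<bar>} gi - 2 * A / of_real e =
      integral UNIV w - (J e - J (- e)) - (G e - G (- e) + 2 * A / of_real e)" if e: "0 < e" "e < 1" for e
  proof -
    have lm: "{t. e \<le> \<bar>t\<bar>} \<in> sets lebesgue"
    proof -
      have "{t. e \<le> \<bar>t\<bar>} = {..- e} \<union> {e..}" by auto
      thus ?thesis by simp
    qed
    have "(gi has_integral (G (- e) - G e + integral {t. e \<le> \<bar>t\<bar>} w)) {t. e \<le> \<bar>t\<bar>}"
    proof (rule has_integral_eq[rotated])
      show "((\<lambda>t. G' t + w t) has_integral (G (- e) - G e + integral {t. e \<le> \<bar>t\<bar>} w)) {t. e \<le> \<bar>t\<bar>}"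
        by (rule has_integral_add[OF has_integral_outside_interval[OF G top bot e(1)] integrable_integral[OF w_int[OF lm]]])
    qed (use e gi in auto)
    hence 1: "integral {t. e \<le> \<bar>t\<bar>} gi = G (- e) - G e + integral {t. e \<le> \<bar>t\<bar>} w"
      by (rule integral_unique)
    have "{t. e \<le> \<bar>t\<bar>} \<inter> {- e..e} \<subseteq> {- e, e}" by auto
    hence neg: "negligible ({t. e \<le> \<bar>t\<bar>} \<inter> {- e..e})"
      by (rule negligible_subset[rotated]) (simp add: negligible_finite)
    have "{t. e \<le> \<bar>t\<bar>} \<union> {- e..e} = UNIV" by auto
    hence 2: "integral UNIV w = integral {t. e \<le> \<bar>t\<bar>} w + integral {- e..e} w"
      using integral_Un[OF w_int[OF lm] w_int neg] by simp
    have 3: "J (- e) + integral {- e..e} w = J e"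
      unfolding J_def using e by (intro Henstock_Kurzweil_Integration.integral_combine w_int) auto
    show ?thesis unfolding 1 2 using 3 by (simp add: algebra_simps)
  qed
  have "((\<lambda>e. integral UNIV w - (J e - J (- e)) - (G e - G (- e) + 2 * A / of_real e))
       \<longlongrightarrow> integral UNIV w - (J 0 - J 0) - 0) (at_right 0)"
    by (intro tendsto_intros J1 J2 odd)
  moreover have "eventually (\<lambda>e::real. 0 < e \<and> e < 1) (at_right 0)"
    by (intro eventually_at_rightI[of 0 1]) auto
  hence "eventually (\<lambda>e. integral UNIV w - (J e - J (- e)) - (G e - G (- e) + 2 * A / of_real e) =
      integral {t. e \<le> \<bar>t\<bar>} gi - 2 * A / of_real e) (at_right 0)"
  proof eventually_elim
    case (elim e)
    thus ?case using eq[of e] by (simp only:)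
  qed
  ultimately have "((\<lambda>e. integral {t. e \<le> \<bar>t\<bar>} gi - 2 * A / of_real e) \<longlongrightarrow> integral UNIV w - (J 0 - J 0) - 0) (at_right 0)"
    by (rule Lim_transform_eventually)
  hence "Lim (at_right 0) (\<lambda>e. integral {t. e \<le> \<bar>t\<bar>} gi - 2 * A / of_real e) = integral UNIV w"
    by (intro tendsto_Lim) auto
  moreover have "Lim (at 0) (\<lambda>t. of_real (t\<^sup>2) * gi t) = A"
    using A by (intro tendsto_Lim) auto
  ultimately show ?thesis unfolding fp_integral_def Let_def by simp
qed

section \<open>The finite part along a thimble\<close>

definition phase_deriv_quot :: "nat \<Rightarrow> nat \<Rightarrow> (int \<Rightarrow> complex) \<Rightarrow> complex \<Rightarrow> complex" where
  "phase_deriv_quot m r c v = (\<Sum>l\<in>{- int m..int r}. c l * of_int l ^ 2 * exp_quot (of_int l * v))"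

text \<open>The derivative of the phase has a simple zero at \<open>0\<close>.\<close>

lemma phase_deriv_quot_mult:
  "v * phase_deriv_quot m r c v = (\<Sum>l\<in>{- int m..int r}. c l * (of_int l * exp (of_int l * v) - of_int l))"
  unfolding phase_deriv_quot_def sum_distrib_left
proof (intro sum.cong refl)
  fix l :: int
  have "c l * (of_int l * exp (of_int l * v) - of_int l) = c l * of_int l * (exp (of_int l * v) - 1)"
    by (simp add: algebra_simps)
  also have "\<dots> = c l * of_int l * ((of_int l * v) * exp_quot (of_int l * v))"
    by (simp only: exp_quot_mult)
  finally show "v * (c l * of_int l ^ 2 * exp_quot (of_int l * v)) = c l * (of_int l * exp (of_int l * v) - of_int l)"
    by (simp add: power2_eq_square algebra_simps)
qed

lemma phase_has_derivative:
  "(phase m r c has_field_derivative v * phase_deriv_quot m r c v) (at v)"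
  unfolding phase_def phase_deriv_quot_mult
  by (auto intro!: derivative_eq_intros sum.cong simp: algebra_simps)

lemma phase_deriv_quot_0: "phase_deriv_quot m r c 0 = 2 * phase_quot m r c 0"
  by (simp add: phase_deriv_quot_def phase_quot_def exp_quot_def exp_quot2_def sum_distrib_left)

lemma tendsto_phase_deriv_quot:
  assumes "\<And>l. ((\<lambda>x. c x l) \<longlongrightarrow> e l) F" "(f \<longlongrightarrow> a) F"
  shows "((\<lambda>x. phase_deriv_quot m r (c x) (f x)) \<longlongrightarrow> phase_deriv_quot m r e a) F"
  unfolding phase_deriv_quot_def by (intro tendsto_intros assms)

lemma has_vector_derivative_quotient:
  fixes f :: "real \<Rightarrow> complex"
  assumes "(f has_vector_derivative D) (at 0)"
  shows "((\<lambda>t. (f t - f 0) / of_real t) \<longlongrightarrow> D) (at 0)"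
proof -
  have "((\<lambda>t. norm (f (0 + t) - f 0 - t *\<^sub>R D) / norm t) \<longlongrightarrow> 0) (at 0)"
    using assms unfolding has_vector_derivative_def has_derivative_at by blast
  moreover have "eventually (\<lambda>t. norm (f (0 + t) - f 0 - t *\<^sub>R D) / norm t = norm ((f t - f 0) / of_real t - D)) (at 0)"
    unfolding eventually_at_filter
  proof (intro always_eventually allI impI)
    fix t :: real assume t: "t \<noteq> 0"
    have "(f t - f 0) / of_real t - D = (f t - f 0 - t *\<^sub>R D) / of_real t"
      using t by (simp add: scaleR_conv_of_real diff_divide_distrib)
    thus "norm (f (0 + t) - f 0 - t *\<^sub>R D) / norm t = norm ((f t - f 0) / of_real t - D)"
      by (simp add: norm_divide)
  qed
  ultimately have "((\<lambda>t. norm ((f t - f 0) / of_real t - D)) \<longlongrightarrow> 0) (at 0)"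
    by (rule Lim_transform_eventually)
  hence "((\<lambda>t. (f t - f 0) / of_real t - D) \<longlongrightarrow> 0) (at 0)"
    by (rule tendsto_norm_zero_cancel)
  thus ?thesis by (rule LIM_zero_cancel)
qed

locale single_thimble =
  fixes m r :: nat and c :: "int \<Rightarrow> complex" and g :: "real \<Rightarrow> complex"
  assumes thimble: "normal_thimble m r c g"
begin

definition d :: complex where "d = vector_derivative g (at 0)"

lemma g_0: "g 0 = 0"
  and g_deriv: "(g has_vector_derivative vector_derivative g (at t)) (at t)"
  and d_nz: "d \<noteq> 0"
  and g_phase: "phase m r c (g t) = - of_real (t\<^sup>2)"
  using thimble vector_derivative_works unfolding normal_thimble_def d_def by auto

lemma g_cont: "isCont g t"
  using g_deriv by (rule has_vector_derivative_continuous)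

lemma g_tendsto_0: "(g \<longlongrightarrow> 0) (at 0)"
  using g_cont[of 0] by (simp add: isCont_def g_0)

lemma g_quot: "((\<lambda>t. g t / of_real t) \<longlongrightarrow> d) (at 0)"
  using has_vector_derivative_quotient[OF g_deriv[of 0]] by (simp add: g_0 d_def)

lemma g_eq: "g t ^ 2 * phase_quot m r c (g t) = - of_real (t\<^sup>2)"
  using g_phase[of t] by (simp only: phase_eq)

lemma g_nz: "t \<noteq> 0 \<Longrightarrow> g t \<noteq> 0"
  using g_eq[of t] by auto

lemma phase_quot_lim: "((\<lambda>t. phase_quot m r c (g t)) \<longlongrightarrow> phase_quot m r c 0) (at 0)"
  by (intro tendsto_phase_quot tendsto_const g_tendsto_0)

lemma d_sq: "d ^ 2 * phase_quot m r c 0 = -1"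
proof -
  have "((\<lambda>t. (g t / of_real t) ^ 2 * phase_quot m r c (g t)) \<longlongrightarrow> d ^ 2 * phase_quot m r c 0) (at 0)"
    by (intro tendsto_intros g_quot phase_quot_lim)
  moreover have "eventually (\<lambda>t. (g t / of_real t) ^ 2 * phase_quot m r c (g t) = -1) (at 0)"
    unfolding eventually_at_filter
  proof (intro always_eventually allI impI)
    fix t :: real assume "t \<noteq> 0"
    thus "(g t / of_real t) ^ 2 * phase_quot m r c (g t) = -1"
      using g_eq[of t] by (simp add: power_divide)
  qed
  ultimately have "((\<lambda>t::real. - 1 :: complex) \<longlongrightarrow> d ^ 2 * phase_quot m r c 0) (at 0)"
    by (rule Lim_transform_eventually)
  thus ?thesis by (simp add: tendsto_const_iff)
qed

text \<open>The derivative of a thimble is continuous at its base point: differentiate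
  \<open>phase (g t) = - t\<^sup>2\<close> and divide by \<open>t\<close>.  Mere differentiability is part of the definition of a
  thimble, so this has to be derived from the equation.\<close>

lemma deriv_lim: "((\<lambda>t. vector_derivative g (at t)) \<longlongrightarrow> d) (at 0)"
proof -
  define q where "q = phase_quot m r c 0"
  have q: "q \<noteq> 0" "d ^ 2 * q = -1" using d_sq by (auto simp: q_def)
  have "((\<lambda>t. - 2 / ((g t / of_real t) * phase_deriv_quot m r c (g t))) \<longlongrightarrow> - 2 / (d * phase_deriv_quot m r c 0)) (at 0)"
    using d_nz q by (intro tendsto_intros g_quot tendsto_phase_deriv_quot g_tendsto_0) (auto simp: phase_deriv_quot_0 q_def)
  also have "- 2 / (d * phase_deriv_quot m r c 0) = d"
  proof -
    have "d * (d * phase_deriv_quot m r c 0) = 2 * (d ^ 2 * q)"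
      by (simp add: phase_deriv_quot_0 q_def[symmetric] power2_eq_square)
    also have "\<dots> = - 2" unfolding q(2) by simp
    finally have eq: "d * (d * phase_deriv_quot m r c 0) = - 2" .
    hence "d * phase_deriv_quot m r c 0 \<noteq> 0" by auto
    thus ?thesis unfolding eq[symmetric] by simp
  qed
  finally have lim: "((\<lambda>t. - 2 / ((g t / of_real t) * phase_deriv_quot m r c (g t))) \<longlongrightarrow> d) (at 0)" .
  have "eventually (\<lambda>t. - 2 / ((g t / of_real t) * phase_deriv_quot m r c (g t)) = vector_derivative g (at t)) (at 0)"
    unfolding eventually_at_filter
  proof (intro always_eventually allI impI)
    fix t :: real assume t: "t \<noteq> 0"
    have "((phase m r c \<circ> g) has_vector_derivative vector_derivative g (at t) * (g t * phase_deriv_quot m r c (g t))) (at t)"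
      by (rule field_vector_diff_chain_at[OF g_deriv phase_has_derivative])
    moreover have "((\<lambda>t. - complex_of_real (t\<^sup>2)) has_vector_derivative - of_real (2 * t)) (at t)"
    proof -
      have "((\<lambda>t. - (t\<^sup>2)) has_real_derivative - (2 * t)) (at t)" by (auto intro!: derivative_eq_intros)
      hence "((\<lambda>t. complex_of_real (- (t\<^sup>2))) has_vector_derivative of_real (- (2 * t))) (at t)"
        unfolding has_real_derivative_iff_has_vector_derivative
        by (rule bounded_linear.has_vector_derivative[OF bounded_linear_of_real])
      thus ?thesis by simp
    qed
    moreover have "phase m r c \<circ> g = (\<lambda>t. - complex_of_real (t\<^sup>2))" by (auto simp: g_phase)
    ultimately have eq: "vector_derivative g (at t) * (g t * phase_deriv_quot m r c (g t)) = - of_real (2 * t)"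
      using vector_derivative_unique_at by metis
    hence nz: "g t * phase_deriv_quot m r c (g t) \<noteq> 0" using t by auto
    have "- 2 / ((g t / of_real t) * phase_deriv_quot m r c (g t)) = - of_real (2 * t) / (g t * phase_deriv_quot m r c (g t))"
      using t by simp
    also have "\<dots> = vector_derivative g (at t)" unfolding eq[symmetric] using nz by simp
    finally show "- 2 / ((g t / of_real t) * phase_deriv_quot m r c (g t)) = vector_derivative g (at t)" .
  qed
  from Lim_transform_eventually[OF lim this] show ?thesis .
qed

text \<open>The vanishing of the residue in analytic terms.  From \<open>(t / g)\<^sup>2 = - phase_quot g\<close> one gets
  \<open>t / g = \<kappa> (g t)\<close> with a holomorphic branch \<open>\<kappa>\<close> of the square root, so
  \<open>t / (exp (g t) - 1)\<close> is a holomorphic function \<open>\<Phi>\<close> of \<open>g t\<close> and inherits a derivative at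
  \<open>0\<close>.\<close>

lemma inverse_expansion:
  obtains D where "((\<lambda>t. (of_real t / (exp (g t) - 1) - 1 / d) / of_real t) \<longlongrightarrow> D) (at 0)"
proof -
  define q where "q = phase_quot m r c 0"
  have q: "q \<noteq> 0" "d ^ 2 * q = -1" using d_sq by (auto simp: q_def)
  \<comment> \<open>Dividing by the value at \<open>0\<close> moves the argument of the square root to \<open>1\<close>, away from the cut.\<close>
  define \<kappa> where "\<kappa> = (\<lambda>v. csqrt (phase_quot m r c v / q) / d)"
  define \<Phi> where "\<Phi> = (\<lambda>v. \<kappa> v / exp_quot v)"
  have k0: "\<kappa> 0 = 1 / d" using q by (simp add: \<kappa>_def q_def[symmetric])
  have k_sq: "\<kappa> v ^ 2 = - phase_quot m r c v" for v
  proof -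
    have "\<kappa> v ^ 2 = phase_quot m r c v / (d ^ 2 * q)" by (simp add: \<kappa>_def power_divide mult.commute)
    thus ?thesis by (simp add: q(2))
  qed
  have "phase_quot m r c field_differentiable (at 0)"
    using holomorphic_phase_quot[of m r c UNIV] by (simp add: holomorphic_on_def)
  then obtain D1 where D1: "(phase_quot m r c has_field_derivative D1) (at 0)" by (auto simp: field_differentiable_def)
  have "exp_quot field_differentiable (at 0)"
    using holomorphic_exp_quot[of UNIV] by (simp add: holomorphic_on_def)
  then obtain D2 where D2: "(exp_quot has_field_derivative D2) (at 0)" by (auto simp: field_differentiable_def)
  have "((\<lambda>v. phase_quot m r c v / q) has_field_derivative D1 / q) (at 0)"
    by (rule DERIV_cdivide[OF D1])
  hence "((\<lambda>v. csqrt (phase_quot m r c v / q)) has_field_derivative inverse (2 * csqrt (phase_quot m r c 0 / q)) * (D1 / q)) (at 0)"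
  proof (rule DERIV_chain2[OF has_field_derivative_csqrt, rotated])
    have "phase_quot m r c 0 / q = 1" using q(1) by (simp add: q_def)
    thus "phase_quot m r c 0 / q \<notin> \<real>\<^sub>\<le>\<^sub>0" by simp
  qed
  from DERIV_cdivide[OF this, of d] have "\<exists>D3. (\<kappa> has_field_derivative D3) (at 0)"
    unfolding \<kappa>_def by blast
  then obtain D3 where D3: "(\<kappa> has_field_derivative D3) (at 0)" by blast
  have "\<exists>D4. (\<Phi> has_field_derivative D4) (at 0)"
    unfolding \<Phi>_def using DERIV_divide[OF D3 D2] by (auto simp: exp_quot_def)
  then obtain D4 where D4: "(\<Phi> has_field_derivative D4) (at (g 0))" by (auto simp: g_0)
  have der: "((\<Phi> \<circ> g) has_vector_derivative d * D4) (at 0)"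
    unfolding d_def by (rule field_vector_diff_chain_at[OF g_deriv D4])
  have Phi0: "(\<Phi> \<circ> g) 0 = 1 / d" by (simp add: g_0 \<Phi>_def k0 exp_quot_def)
  have Phi_lim: "((\<lambda>t. ((\<Phi> \<circ> g) t - 1 / d) / of_real t) \<longlongrightarrow> d * D4) (at 0)"
    using has_vector_derivative_quotient[OF der] unfolding Phi0 .
  have k_lim: "((\<lambda>t. \<kappa> (g t)) \<longlongrightarrow> 1 / d) (at 0)"
    using isCont_tendsto_compose[OF DERIV_isCont[OF D3] g_tendsto_0] k0 by simp
  have gt_lim: "((\<lambda>t. of_real t / g t) \<longlongrightarrow> 1 / d) (at 0)"
  proof -
    have "((\<lambda>t. 1 / (g t / of_real t)) \<longlongrightarrow> 1 / d) (at 0)"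
      using d_nz by (intro tendsto_intros g_quot)
    thus ?thesis by simp
  qed
  have "((\<lambda>t. of_real t / g t + \<kappa> (g t)) \<longlongrightarrow> 1 / d + 1 / d) (at 0)"
    by (intro tendsto_intros gt_lim k_lim)
  moreover have "1 / d + 1 / d \<noteq> 0" using d_nz by simp
  ultimately have "eventually (\<lambda>t. of_real t / g t + \<kappa> (g t) \<noteq> 0) (at 0)"
    by (rule tendsto_imp_eventually_ne)
  hence "eventually (\<lambda>t. of_real t / (exp (g t) - 1) = \<Phi> (g t)) (at 0)"
    using eventually_neq_at_within[of 0]
  proof eventually_elim
    case (elim t)
    have "(of_real t / g t) ^ 2 = - phase_quot m r c (g t)"
      using g_eq[of t] g_nz[OF elim(2)] by (simp add: power_divide field_simps)
    hence "(of_real t / g t - \<kappa> (g t)) * (of_real t / g t + \<kappa> (g t)) = 0"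
      by (simp add: k_sq[symmetric] power2_eq_square algebra_simps)
    hence k: "of_real t / g t = \<kappa> (g t)" using elim by simp
    have "of_real t / (exp (g t) - 1) = (of_real t / g t) / exp_quot (g t)"
      unfolding exp_quot_mult[symmetric] by simp
    thus ?case unfolding k \<Phi>_def .
  qed
  hence "eventually (\<lambda>t. ((\<Phi> \<circ> g) t - 1 / d) / of_real t = (of_real t / (exp (g t) - 1) - 1 / d) / of_real t) (at 0)"
    by eventually_elim simp
  from that[OF Lim_transform_eventually[OF Phi_lim this]] show ?thesis .
qed

text \<open>Either there is no pole at \<open>t = 0\<close>, and \<open>L = 0\<close>, or \<open>\<rho> = 1\<close> and the residue \<open>L\<close> is the inverse
  of the velocity \<open>d\<close> of the thimble.  In both cases \<open>t\<close> times the kernel has a derivative at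
  \<open>0\<close>.\<close>

lemma pole_expansion:
  obtains L D where "L = 0 \<or> \<rho> = 1 \<and> d * L = 1"
    "((\<lambda>t. (of_real t / (exp (g t) - \<rho>) - L) / of_real t) \<longlongrightarrow> D) (at 0)"
proof (cases "\<rho> = 1")
  case True
  obtain D where "((\<lambda>t. (of_real t / (exp (g t) - 1) - 1 / d) / of_real t) \<longlongrightarrow> D) (at 0)"
    by (rule inverse_expansion)
  thus ?thesis using True d_nz by (intro that[of "1 / d" D]) auto
next
  case False
  have "((\<lambda>t. 1 / (exp (g t) - \<rho>)) \<longlongrightarrow> 1 / (exp 0 - \<rho>)) (at 0)"
    using False by (intro tendsto_intros g_tendsto_0) auto
  moreover have "eventually (\<lambda>t. 1 / (exp (g t) - \<rho>) = (of_real t / (exp (g t) - \<rho>) - 0) / of_real t) (at 0)"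
    unfolding eventually_at_filter by (intro always_eventually) auto
  ultimately have "((\<lambda>t. (of_real t / (exp (g t) - \<rho>) - 0) / of_real t) \<longlongrightarrow> 1 / (exp 0 - \<rho>)) (at 0)"
    by (rule Lim_transform_eventually)
  thus ?thesis by (intro that[of 0]) auto
qed

text \<open>In terms of \<open>u t = t / (exp (g t) - \<rho>)\<close> the boundary term is a multiple of
  \<open>e(t) (u t + u (- t)) / t\<close>, and the finite part subtracts \<open>2 L / t\<close>.  Differentiability of \<open>u\<close> at
  \<open>0\<close> makes the difference vanish in the limit, the one-sided slopes of \<open>u\<close> being equal.\<close>

lemma fp_integral_thimble:
  assumes z: "z < 0" and nz: "\<And>t. t \<noteq> 0 \<Longrightarrow> exp (g t) \<noteq> \<rho>"
    and bd: "\<And>t. norm (of_real t * (\<rho> / (exp (g t) - \<rho>))) \<le> C * (1 + \<bar>t\<bar>)"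
  shows "fp_integral (\<lambda>t. exp (of_real (t\<^sup>2) / of_real z) *
            vector_derivative (\<lambda>s. k * (\<rho> / (exp (g s) - \<rho>))) (at t)) =
         k * integral UNIV (\<lambda>t. of_real (gauss_weight z t) * (\<rho> / (exp (g t) - \<rho>)))"
proof -
  obtain L D where L: "L = 0 \<or> \<rho> = 1 \<and> d * L = 1"
    and D: "((\<lambda>t. (of_real t / (exp (g t) - \<rho>) - L) / of_real t) \<longlongrightarrow> D) (at 0)"
    using pole_expansion by metis
  define f where "f = (\<lambda>t. \<rho> / (exp (g t) - \<rho>))"
  define e where "e = (\<lambda>t::real. exp (of_real (t\<^sup>2) / complex_of_real z))"
  define f' where "f' = (\<lambda>t. - \<rho> * (vector_derivative g (at t) * exp (g t)) / (exp (g t) - \<rho>) ^ 2)"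
  define u where "u = (\<lambda>t. of_real t / (exp (g t) - \<rho>))"
  have e_real: "e t = of_real (exp (t\<^sup>2 / z))" for t
    by (simp only: e_def of_real_divide[symmetric] exp_of_real)
  have f_deriv: "(f has_vector_derivative f' t) (at t)" if "t \<noteq> 0" for t
  proof -
    have "((\<lambda>v. \<rho> / (exp v - \<rho>)) has_field_derivative - \<rho> * exp (g t) / (exp (g t) - \<rho>) ^ 2) (at (g t))"
      using nz[OF that] by (auto intro!: derivative_eq_intros simp: power2_eq_square)
    from field_vector_diff_chain_at[OF g_deriv this] show ?thesis
      by (simp add: f_def f'_def o_def mult_ac)
  qed
  have e_deriv: "(e has_vector_derivative - of_real (gauss_weight z t)) (at t)" for t
  proof -
    have "((\<lambda>t. exp (t\<^sup>2 / z)) has_real_derivative - gauss_weight z t) (at t)"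
      using z by (auto intro!: derivative_eq_intros simp: gauss_weight_def)
    hence "((\<lambda>t. complex_of_real (exp (t\<^sup>2 / z))) has_vector_derivative of_real (- gauss_weight z t)) (at t)"
      unfolding has_real_derivative_iff_has_vector_derivative
      by (rule bounded_linear.has_vector_derivative[OF bounded_linear_of_real])
    thus ?thesis by (simp add: e_real[abs_def])
  qed
  have C: "C \<ge> 0" using bd[of 0] by simp
  have g_c: "continuous_on UNIV g" using g_cont by (simp add: continuous_at_imp_continuous_on)
  have f_meas: "f \<in> borel_measurable borel"
  proof (rule borel_measurable_continuous_countable_exceptions[of "{0}"])
    show "continuous_on (- {0}) f"
      unfolding f_def using nz by (intro continuous_intros continuous_on_subset[OF g_c]) auto
  qed simp
  define w where "w = (\<lambda>t. k * (of_real (gauss_weight z t) * f t))"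
  have w_int: "w absolutely_integrable_on UNIV"
  proof -
    have "(\<lambda>t. of_real (gauss_weight z t) * f t) absolutely_integrable_on UNIV"
      using z bd C f_meas by (intro gauss_weight_integrable) (auto simp: f_def)
    from absolutely_integrable_linear[OF this bounded_linear_mult_right[of k]]
    show ?thesis by (simp add: w_def o_def)
  qed
  define G where "G = (\<lambda>t. k * (e t * f t))"
  define G' where "G' = (\<lambda>t. k * (e t * f' t + (- of_real (gauss_weight z t)) * f t))"
  have G_deriv: "(G has_vector_derivative G' t) (at t)" if "t \<noteq> 0" for t
    unfolding G_def G'_def
    by (intro has_vector_derivative_mult_right has_vector_derivative_mult e_deriv f_deriv that)
  define gi where "gi = (\<lambda>t. e t * vector_derivative (\<lambda>s. k * f s) (at t))"
  have gi_eq: "gi t = k * (e t * f' t)" if "t \<noteq> 0" for t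
  proof -
    have "((\<lambda>s. k * f s) has_vector_derivative k * f' t) (at t)"
      by (intro has_vector_derivative_mult_right f_deriv that)
    thus ?thesis unfolding gi_def by (simp add: vector_derivative_at)
  qed
  have G_bound: "norm (G t) \<le> norm k * (2 * C) * exp (- \<bar>t\<bar>) * exp (- z)" if t: "\<bar>t\<bar> \<ge> 1" for t
  proof -
    have "norm (f t) \<le> norm (of_real t * f t)"
      using t mult_right_mono[of 1 "\<bar>t\<bar>" "norm (f t)"] by (simp add: norm_mult)
    also have "\<dots> \<le> C * (1 + \<bar>t\<bar>)" using bd by (simp add: f_def)
    finally have "norm (G t) \<le> norm k * (exp (t\<^sup>2 / z) * (C * (1 + \<bar>t\<bar>)))"
      by (simp add: G_def e_real norm_mult mult_left_mono)
    also have "\<dots> = norm k * C * ((1 + \<bar>t\<bar>) * exp (t\<^sup>2 / z))" by simp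
    also have "\<dots> \<le> norm k * C * (exp (- z) * exp (- \<bar>t\<bar>))"
      using C by (intro mult_left_mono gauss_bound z) auto
    also have "\<dots> \<le> norm k * (2 * C) * (exp (- z) * exp (- \<bar>t\<bar>))"
      using C by (intro mult_right_mono mult_left_mono) auto
    finally show ?thesis by (simp add: mult_ac)
  qed
  have top: "(G \<longlongrightarrow> 0) at_top"
  proof (rule Lim_null_comparison)
    show "eventually (\<lambda>t. norm (G t) \<le> norm k * (2 * C) * exp (- \<bar>t\<bar>) * exp (- z)) at_top"
      using eventually_ge_at_top[of 1] by eventually_elim (intro G_bound, simp)
    have "((\<lambda>t::real. exp (- \<bar>t\<bar>)) \<longlongrightarrow> 0) at_top" by real_asymp
    thus "((\<lambda>t. norm k * (2 * C) * exp (- \<bar>t\<bar>) * exp (- z)) \<longlongrightarrow> 0) at_top"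
      by (intro tendsto_mult_left_zero tendsto_mult_right_zero)
  qed
  have bot: "(G \<longlongrightarrow> 0) at_bot"
  proof (rule Lim_null_comparison)
    show "eventually (\<lambda>t. norm (G t) \<le> norm k * (2 * C) * exp (- \<bar>t\<bar>) * exp (- z)) at_bot"
      using eventually_le_at_bot[of "- 1"] by eventually_elim (intro G_bound, simp)
    have "((\<lambda>t::real. exp (- \<bar>t\<bar>)) \<longlongrightarrow> 0) at_bot" by real_asymp
    thus "((\<lambda>t. norm k * (2 * C) * exp (- \<bar>t\<bar>) * exp (- z)) \<longlongrightarrow> 0) at_bot"
      by (intro tendsto_mult_left_zero tendsto_mult_right_zero)
  qed
  have e_lim: "(e \<longlongrightarrow> 1) (at 0)"
    using has_vector_derivative_continuous[OF e_deriv[of 0]] by (simp add: isCont_def e_def)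
  have e_quot: "((\<lambda>t. (e t - 1) / of_real t) \<longlongrightarrow> 0) (at 0)"
    using has_vector_derivative_quotient[OF e_deriv[of 0]] by (simp add: e_def gauss_weight_def)
  have u_lim: "(u \<longlongrightarrow> L) (at 0)"
  proof -
    have "((\<lambda>t. (u t - L) / of_real t * of_real t + L) \<longlongrightarrow> D * of_real 0 + L) (at 0)"
      unfolding u_def by (intro tendsto_intros D)
    moreover have "eventually (\<lambda>t. (u t - L) / of_real t * of_real t + L = u t) (at 0)"
      unfolding eventually_at_filter by (intro always_eventually) auto
    ultimately have "(u \<longlongrightarrow> D * of_real 0 + L) (at 0)" by (rule Lim_transform_eventually)
    thus ?thesis by simp
  qed
  \<comment> \<open>Minus the value at \<open>0\<close> of \<open>t\<close> times the boundary term.\<close>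
  define A where "A = - k * \<rho> * L"
  have A_lim: "((\<lambda>t. of_real (t\<^sup>2) * gi t) \<longlongrightarrow> A) (at 0)"
  proof -
    have "((\<lambda>t. k * (e t * (- \<rho> * (vector_derivative g (at t) * exp (g t)) * u t ^ 2))) \<longlongrightarrow>
        k * (1 * (- \<rho> * (d * exp 0) * L ^ 2))) (at 0)"
      by (intro tendsto_intros e_lim deriv_lim g_tendsto_0 u_lim)
    also have "k * (1 * (- \<rho> * (d * exp 0) * L ^ 2)) = A"
      using L by (auto simp: A_def power2_eq_square)
    finally have lim: "((\<lambda>t. k * (e t * (- \<rho> * (vector_derivative g (at t) * exp (g t)) * u t ^ 2))) \<longlongrightarrow> A) (at 0)" .
    have "eventually (\<lambda>t. k * (e t * (- \<rho> * (vector_derivative g (at t) * exp (g t)) * u t ^ 2)) = of_real (t\<^sup>2) * gi t) (at 0)"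
      unfolding eventually_at_filter
      by (intro always_eventually allI impI) (simp add: gi_eq f'_def u_def power_divide)
    from Lim_transform_eventually[OF lim this] show ?thesis .
  qed
  have odd: "((\<lambda>t. G t - G (- t) + 2 * A / of_real t) \<longlongrightarrow> 0) (at_right 0)"
  proof -
    define v where "v = (\<lambda>t. (u t - L) / of_real t)"
    have v1: "(v \<longlongrightarrow> D) (at_right 0)"
      using D unfolding v_def u_def by (rule tendsto_mono[rotated]) (simp add: at_le)
    have v2: "((\<lambda>t. v (- t)) \<longlongrightarrow> D) (at_right 0)"
    proof (rule filterlim_compose[of v])
      show "(v \<longlongrightarrow> D) (at 0)" using D by (simp only: v_def u_def)
      show "filterlim uminus (at 0) (at_right (0::real))"
        unfolding filterlim_at by (auto intro!: tendsto_eq_intros simp: eventually_at_filter)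
    qed
    have e1: "(e \<longlongrightarrow> 1) (at_right 0)" "((\<lambda>t. (e t - 1) / of_real t) \<longlongrightarrow> 0) (at_right 0)"
      by (rule tendsto_mono[OF _ e_lim], simp add: at_le) (rule tendsto_mono[OF _ e_quot], simp add: at_le)
    have "((\<lambda>t. k * \<rho> * (e t * (v t - v (- t)) + 2 * L * ((e t - 1) / of_real t))) \<longlongrightarrow>
        k * \<rho> * (1 * (D - D) + 2 * L * 0)) (at_right 0)"
      by (intro tendsto_intros v1 v2 e1)
    hence lim: "((\<lambda>t. k * \<rho> * (e t * (v t - v (- t)) + 2 * L * ((e t - 1) / of_real t))) \<longlongrightarrow> 0) (at_right 0)"
      by simp
    have "eventually (\<lambda>t. k * \<rho> * (e t * (v t - v (- t)) + 2 * L * ((e t - 1) / of_real t)) =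
       G t - G (- t) + 2 * A / of_real t) (at_right 0)"
      using eventually_at_right_less[of 0]
    proof eventually_elim
      case (elim t)
      have f_eq: "f s = \<rho> * (u s / of_real s)" if "s \<noteq> 0" for s using that by (simp add: f_def u_def)
      have "e (- t) = e t" by (simp add: e_def)
      thus ?case
        using elim by (simp add: G_def A_def f_eq v_def field_simps)
    qed
    from Lim_transform_eventually[OF lim this] show ?thesis .
  qed
  have "fp_integral gi = integral UNIV w"
    by (rule fp_integral_eq[OF G_deriv top bot w_int _ A_lim odd])
       (simp_all add: gi_eq G'_def w_def algebra_simps)
  also have "\<dots> = k * integral UNIV (\<lambda>t. of_real (gauss_weight z t) * f t)"
    unfolding w_def by simp
  finally show ?thesis by (simp only: gi_def e_def f_def)
qed

end

section \<open>Dominated convergence and the limit integral\<close>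

context thimble_sequence
begin

lemma X_0: "X 0 = 0"
proof -
  have "sgn (T 0) = 0" using T_sgn[of 0] by simp
  hence "T 0 = 0" by (simp add: sgn_0_0)
  thus ?thesis using XT[of 0] by simp
qed

lemma X_eq_0_iff: "X t = 0 \<longleftrightarrow> t = 0"
  using TX[of t] TX[of 0] X_0 by metis

text \<open>Dominated convergence; at \<open>t = 0\<close>, where the kernel may have a pole, the weight vanishes.  The
  bound that dominates the kernels is also what integration by parts requires of each of them, which
  therefore applies for all large \<open>n\<close>.\<close>

lemma kernel_integral_tendsto:
  fixes \<rho> :: "nat \<Rightarrow> complex" and \<omega> :: complex
  assumes z: "z < 0" and \<rho>: "\<rho> \<longlonglongrightarrow> \<omega>" and \<omega>: "norm \<omega> = 1"
    and cases: "(\<forall>n. \<rho> n = 1) \<or> (\<forall>x. \<omega> \<noteq> exp (of_real x))"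
  shows "(\<lambda>n. integral UNIV (\<lambda>t. of_real (gauss_weight z t) * (\<rho> n / (exp (g n t) - \<rho> n)))) \<longlonglongrightarrow>
          integral UNIV (\<lambda>t. of_real (gauss_weight z t) * (\<omega> / (exp (of_real (X t)) - \<omega>)))"
    and "eventually (\<lambda>n. fp_integral (\<lambda>t. exp (of_real (t\<^sup>2) / of_real z) *
            vector_derivative (\<lambda>s. k n * (\<rho> n / (exp (g n s) - \<rho> n))) (at t)) =
         k n * integral UNIV (\<lambda>t. of_real (gauss_weight z t) * (\<rho> n / (exp (g n t) - \<rho> n)))) sequentially"
proof -
  obtain C where C: "C > 0" "eventually (\<lambda>n. \<forall>t. (t \<noteq> 0 \<longrightarrow> exp (g n t) \<noteq> \<rho> n) \<and>
     norm (of_real t * (\<rho> n / (exp (g n t) - \<rho> n))) \<le> C * (1 + \<bar>t\<bar>)) sequentially"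
    by (rule eventually_kernel_bound[OF \<rho> \<omega> cases])
  then obtain N where N: "\<And>n t. n \<ge> N \<Longrightarrow> t \<noteq> 0 \<Longrightarrow> exp (g n t) \<noteq> \<rho> n"
      "\<And>n t. n \<ge> N \<Longrightarrow> norm (of_real t * (\<rho> n / (exp (g n t) - \<rho> n))) \<le> C * (1 + \<bar>t\<bar>)"
    unfolding eventually_sequentially by metis
  show "eventually (\<lambda>n. fp_integral (\<lambda>t. exp (of_real (t\<^sup>2) / of_real z) *
            vector_derivative (\<lambda>s. k n * (\<rho> n / (exp (g n s) - \<rho> n))) (at t)) =
         k n * integral UNIV (\<lambda>t. of_real (gauss_weight z t) * (\<rho> n / (exp (g n t) - \<rho> n)))) sequentially"
    using eventually_ge_at_top[of N]
  proof eventually_elim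
    case (elim n)
    interpret single_thimble m r "c n" "g n" by unfold_locales (rule thimble)
    show ?case by (rule fp_integral_thimble[OF z N(1)[OF elim] N(2)[OF elim]])
  qed
  have meas: "(\<lambda>t. \<rho> n / (exp (g n t) - \<rho> n)) \<in> borel_measurable borel" if "n \<ge> N" for n
  proof (rule borel_measurable_continuous_countable_exceptions[of "{0}"])
    show "continuous_on (- {0}) (\<lambda>t. \<rho> n / (exp (g n t) - \<rho> n))"
      using N(1)[OF that] by (intro continuous_intros g_cont) auto
  qed simp
  have "(\<lambda>n. integral UNIV (\<lambda>t. of_real (gauss_weight z t) * (\<rho> (n + N) / (exp (g (n + N) t) - \<rho> (n + N))))) \<longlonglongrightarrow>
          integral UNIV (\<lambda>t. of_real (gauss_weight z t) * (\<omega> / (exp (of_real (X t)) - \<omega>)))"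
  proof (rule dominated_convergence(2))
    show "(\<lambda>t. of_real (gauss_weight z t) * (\<rho> (n + N) / (exp (g (n + N) t) - \<rho> (n + N)))) integrable_on UNIV" for n
      by (rule set_lebesgue_integral_eq_integral(1), rule gauss_weight_integrable(1)[OF z N(2) less_imp_le[OF C(1)] meas]) auto
    show "(\<lambda>t. 2 / - z * C * exp (- z) * exp (- \<bar>t\<bar>)) integrable_on UNIV"
      by (intro integrable_on_mult_right exp_minus_abs_integrable)
    show "norm (of_real (gauss_weight z t) * (\<rho> (n + N) / (exp (g (n + N) t) - \<rho> (n + N)))) \<le> 2 / - z * C * exp (- z) * exp (- \<bar>t\<bar>)" for n t
      by (rule gauss_weight_integrable(2)[OF z N(2) less_imp_le[OF C(1)] meas]) auto
    show "(\<lambda>n. of_real (gauss_weight z t) * (\<rho> (n + N) / (exp (g (n + N) t) - \<rho> (n + N)))) \<longlonglongrightarrow>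
       of_real (gauss_weight z t) * (\<omega> / (exp (of_real (X t)) - \<omega>))" for t
    proof (cases "t = 0")
      case True
      thus ?thesis by (simp add: gauss_weight_def)
    next
      case False
      have "exp (of_real (X t)) \<noteq> \<omega>"
        using cases
      proof
        assume "\<forall>n. \<rho> n = 1"
        hence "\<rho> = (\<lambda>_. 1)" by auto
        hence "\<omega> = 1" using \<rho> by (simp add: LIMSEQ_const_iff)
        moreover have "exp (X t) \<noteq> 1" using False X_eq_0_iff by simp
        hence "complex_of_real (exp (X t)) \<noteq> 1" by (metis of_real_eq_1_iff)
        ultimately show ?thesis by (simp add: exp_of_real)
      qed metis
      thus ?thesis
        by (intro tendsto_intros LIMSEQ_ignore_initial_segment[OF \<rho>] LIMSEQ_ignore_initial_segment[OF g_tendsto]) auto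
    qed
  qed
  thus "(\<lambda>n. integral UNIV (\<lambda>t. of_real (gauss_weight z t) * (\<rho> n / (exp (g n t) - \<rho> n)))) \<longlonglongrightarrow>
          integral UNIV (\<lambda>t. of_real (gauss_weight z t) * (\<omega> / (exp (of_real (X t)) - \<omega>)))"
    by (rule LIMSEQ_offset)
qed

text \<open>The substitution \<open>t = T x\<close>, under which \<open>X t\<close> becomes \<open>x\<close>.\<close>

lemma kernel_limit_substitution:
  fixes \<omega> :: complex
  assumes "(\<lambda>x. \<bar>T' x\<bar> *\<^sub>R (of_real (gauss_weight z (T x)) * (\<omega> / (exp (of_real x) - \<omega>)))) absolutely_integrable_on UNIV"
  shows "integral UNIV (\<lambda>t. of_real (gauss_weight z t) * (\<omega> / (exp (of_real (X t)) - \<omega>))) =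
     integral UNIV (\<lambda>x. \<bar>T' x\<bar> *\<^sub>R (of_real (gauss_weight z (T x)) * (\<omega> / (exp (of_real x) - \<omega>))))"
proof -
  have "range T = UNIV" using TX by (metis surj_def)
  moreover have "inj T" using XT by (metis injI)
  ultimately show ?thesis
    using has_absolute_integral_change_of_variables_real[of UNIV T T' "\<lambda>t. of_real (gauss_weight z t) * (\<omega> / (exp (of_real (X t)) - \<omega>))"
        "integral UNIV (\<lambda>x. \<bar>T' x\<bar> *\<^sub>R (of_real (gauss_weight z (T x)) * (\<omega> / (exp (of_real x) - \<omega>))))"]
      T_deriv assms by (simp add: XT)
qed

end

text \<open>Euler's integral after the substitution \<open>s = \<mu> exp (r x)\<close>.\<close>

lemma exp_Gamma_integral:
  fixes \<mu> a :: real
  assumes "r > 0" "\<mu> > 0" "a > 0"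
  shows "(\<lambda>x. exp (r * a * x) * exp (- \<mu> * exp (r * x))) absolutely_integrable_on UNIV"
    and "integral UNIV (\<lambda>x. exp (r * a * x) * exp (- \<mu> * exp (r * x))) = Gamma a * \<mu> powr (- a) / r"
proof -
  define \<phi> where "\<phi> = (\<lambda>x. \<mu> * exp (r * x))"
  define f where "f = (\<lambda>t. t powr (a - 1) / exp t)"
  have "(f has_integral Gamma a) {0<..}"
  proof -
    have "(f has_integral Gamma a) {0..}" unfolding f_def by (rule Gamma_integral_real[OF assms(3)])
    moreover have "negligible ({0..} - {0<..} \<union> ({0<..} - {0::real..}))"
      by (rule negligible_subset[of "{0}"]) auto
    ultimately show ?thesis by (subst has_integral_spike_set_eq[of _ "{0..}"]) (auto elim: negligible_subset)
  qed
  hence f1: "f integrable_on {0<..}" "integral {0<..} f = Gamma a" by (auto simp: has_integral_iff)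
  hence f2: "f absolutely_integrable_on {0<..}"
    by (intro nonnegative_absolutely_integrable_1) (auto simp: f_def)
  have img: "range \<phi> = {0<..}"
  proof (intro set_eqI iffI)
    fix y :: real assume y: "y \<in> {0<..}"
    hence "y = \<phi> (ln (y / \<mu>) / r)" using assms by (simp add: \<phi>_def)
    thus "y \<in> range \<phi>" by blast
  qed (use assms in \<open>auto simp: \<phi>_def\<close>)
  have inj: "inj \<phi>" using assms by (auto simp: \<phi>_def inj_def)
  have der: "(\<phi> has_field_derivative (r * \<mu> * exp (r * x))) (at x within UNIV)" for x
    unfolding \<phi>_def by (auto intro!: derivative_eq_intros)
  have eq: "\<bar>r * \<mu> * exp (r * x)\<bar> * f (\<phi> x) = r * \<mu> powr a * (exp (r * a * x) * exp (- \<mu> * exp (r * x)))" for x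
  proof -
    have "\<phi> x powr (a - 1) = \<mu> powr (a - 1) * exp ((a - 1) * (r * x))"
      using assms by (simp add: \<phi>_def powr_mult exp_powr_real mult_ac)
    moreover have "\<mu> * \<mu> powr (a - 1) = \<mu> powr a" using assms by (simp add: powr_diff)
    moreover have "exp (r * x) * exp ((a - 1) * (r * x)) = exp (r * a * x)"
      unfolding exp_add[symmetric] by (simp add: algebra_simps)
    moreover have "\<bar>r * \<mu> * exp (r * x)\<bar> * f (\<phi> x) =
        r * (\<mu> * \<mu> powr (a - 1)) * (exp (r * x) * exp ((a - 1) * (r * x))) / exp (\<phi> x)"
      using assms unfolding f_def calculation(1) by (simp add: abs_mult)
    ultimately show ?thesis by (simp add: \<phi>_def exp_minus divide_inverse)
  qed
  have cv: "(\<lambda>x. \<bar>r * \<mu> * exp (r * x)\<bar> * f (\<phi> x)) absolutely_integrable_on UNIV \<and>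
      integral UNIV (\<lambda>x. \<bar>r * \<mu> * exp (r * x)\<bar> * f (\<phi> x)) = Gamma a"
    using has_absolute_integral_change_of_variables_1'[OF _ der inj, of f "Gamma a"] f1 f2 by (simp add: img)
  have c: "r * \<mu> powr a \<noteq> 0" using assms by simp
  have "(\<lambda>x. inverse (r * \<mu> powr a) * (r * \<mu> powr a * (exp (r * a * x) * exp (- \<mu> * exp (r * x))))) absolutely_integrable_on UNIV"
    using absolutely_integrable_linear[OF conjunct1[OF cv] bounded_linear_mult_right[of "inverse (r * \<mu> powr a)"]]
    unfolding o_def eq .
  moreover have "inverse (r * \<mu> powr a) * (r * \<mu> powr a * y) = y" for y
    using c by (simp add: field_simps)
  ultimately show "(\<lambda>x. exp (r * a * x) * exp (- \<mu> * exp (r * x))) absolutely_integrable_on UNIV"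
    by (simp only:)
  have "r * \<mu> powr a * integral UNIV (\<lambda>x. exp (r * a * x) * exp (- \<mu> * exp (r * x))) = Gamma a"
    using conjunct2[OF cv] unfolding eq by simp
  thus "integral UNIV (\<lambda>x. exp (r * a * x) * exp (- \<mu> * exp (r * x))) = Gamma a * \<mu> powr (- a) / r"
    using assms by (simp add: powr_minus field_simps)
qed

context thimble_sequence
begin

text \<open>Both sides are the derivative of \<open>T\<^sup>2\<close>.\<close>

lemma T_T': "2 * T x * T' x = - p * (exp (real r * x) - 1)"
proof -
  have "((\<lambda>x. T x ^ 2) has_real_derivative 2 * T x * T' x) (at x)"
    using T_deriv by (auto intro!: derivative_eq_intros)
  moreover have "((\<lambda>x. - p / real r * (exp (real r * x) - 1 - real r * x)) has_real_derivative
      - p / real r * (exp (real r * x) * real r - real r)) (at x)"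
    using r by (auto intro!: derivative_eq_intros)
  ultimately have "2 * T x * T' x = - p / real r * (exp (real r * x) * real r - real r)"
    unfolding T_sq by (rule DERIV_unique)
  also have "\<dots> = - p * (exp (real r * x) - 1)"
  proof -
    have "real r \<noteq> 0" using r by simp
    thus ?thesis by (simp add: field_simps)
  qed
  finally show ?thesis .
qed

text \<open>Since \<open>\<omega>\<^sup>r = 1\<close>, the numerator is \<open>(exp x)\<^sup>r - \<omega>\<^sup>r\<close>, and \<open>\<omega>\<^sup>r\<^sup>-\<^sup>h = \<omega>\<^sup>-\<^sup>h\<close>.  This is the
  origin of the sum over \<open>h\<close> in the block.\<close>

lemma kernel_geometric_sum:
  fixes \<omega> :: complex
  assumes \<omega>: "\<omega> ^ r = 1" "exp (of_real x) \<noteq> \<omega>"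
  shows "complex_of_real (exp (real r * x) - 1) * (\<omega> / (exp (of_real x) - \<omega>)) =
     (\<Sum>h<r. \<omega> powi (- int h) * of_real (exp (real h * x)))"
proof -
  obtain r' where r': "r = Suc r'" using r by (cases r) auto
  have \<omega>0: "\<omega> \<noteq> 0" using \<omega>(1) r by (metis power_0_left zero_neq_one not_one_le_zero)
  define e where "e = exp (complex_of_real x)"
  have ek: "of_real (exp (real h * x)) = e ^ h" for h
    by (simp add: e_def exp_of_nat_mult exp_of_real[symmetric])
  have "complex_of_real (exp (real r * x) - 1) = e ^ Suc r' - \<omega> ^ Suc r'"
    using ek[of r] \<omega>(1) by (simp add: r')
  also have "\<dots> = (e - \<omega>) * (\<Sum>h<Suc r'. e ^ h * \<omega> ^ (r' - h))"
    by (rule diff_power_eq_sum)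
  finally have "complex_of_real (exp (real r * x) - 1) * (\<omega> / (e - \<omega>)) = (\<Sum>h<Suc r'. e ^ h * \<omega> ^ (r' - h)) * \<omega>"
    using \<omega>(2) by (simp add: e_def)
  also have "\<dots> = (\<Sum>h<r. \<omega> powi (- int h) * e ^ h)"
    unfolding sum_distrib_right r'
  proof (intro sum.cong refl)
    fix h assume h: "h \<in> {..<Suc r'}"
    have "\<omega> ^ (r' - h) * \<omega> * \<omega> ^ h = \<omega> ^ r" using h unfolding r' by (simp flip: power_Suc2 power_add)
    hence "\<omega> ^ (r' - h) * \<omega> = \<omega> powi (- int h)"
      using \<omega>(1) \<omega>0 by (simp add: power_int_minus field_simps)
    thus "e ^ h * \<omega> ^ (r' - h) * \<omega> = \<omega> powi (- int h) * e ^ h" by (simp add: mult_ac)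
  qed
  finally show ?thesis by (simp add: ek e_def)
qed

lemma kernel_limit_integral:
  fixes \<omega> :: complex
  assumes z: "z < 0" and \<omega>: "\<omega> ^ r = 1" and cases: "\<omega> = 1 \<or> (\<forall>x. \<omega> \<noteq> exp (of_real x))"
    and \<mu>: "\<mu> = p / (real r * z)"
  shows "integral UNIV (\<lambda>t. of_real (gauss_weight z t) * (\<omega> / (exp (of_real (X t)) - \<omega>))) =
     of_real (\<mu> * exp \<mu>) * (\<Sum>h<r. \<omega> powi (- int h) * of_real (Gamma (\<mu> + real h / real r) * \<mu> powr (- (\<mu> + real h / real r))))"
proof -
  define a where "a = (\<lambda>h. \<mu> + real h / real r)"
  have \<mu>_pos: "\<mu> > 0" using p z r unfolding \<mu> by (intro divide_neg_neg mult_pos_neg) auto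
  have a_pos: "a h > 0" for h using \<mu>_pos by (simp add: a_def add_pos_nonneg)
  have rp: "real r > 0" using r by simp
  define F where "F = (\<lambda>h x. exp (real r * a h * x) * exp (- \<mu> * exp (real r * x)))"
  define S where "S = (\<lambda>x. of_real (real r * \<mu> * exp \<mu>) * (\<Sum>h<r. \<omega> powi (- int h) * complex_of_real (F h x)))"
  have F: "F h absolutely_integrable_on UNIV" "integral UNIV (F h) = Gamma (a h) * \<mu> powr (- a h) / real r" for h
    unfolding F_def by (rule exp_Gamma_integral[OF rp \<mu>_pos a_pos])+
  have Fc: "(\<lambda>x. complex_of_real (F h x)) absolutely_integrable_on UNIV" for h
    using absolutely_integrable_linear[OF F(1) bounded_linear_of_real[where ?'a = complex]] by (simp add: o_def)
  have Fi: "integral UNIV (\<lambda>x. complex_of_real (F h x)) = of_real (Gamma (a h) * \<mu> powr (- a h) / real r)" for h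
    using integral_linear[OF set_lebesgue_integral_eq_integral(1)[OF F(1)] bounded_linear_of_real[where ?'a = complex]] F(2)
    by (simp add: o_def)
  have S_int: "S absolutely_integrable_on UNIV"
    unfolding S_def
    by (intro absolutely_integrable_sum set_integrable_mult_right Fc finite_lessThan)
  have S_val: "integral UNIV S = of_real (\<mu> * exp \<mu>) * (\<Sum>h<r. \<omega> powi (- int h) * of_real (Gamma (a h) * \<mu> powr (- a h)))"
  proof -
    have Fi': "(\<lambda>x. complex_of_real (F h x)) integrable_on UNIV" for h
      using Fc set_lebesgue_integral_eq_integral(1) by blast
    have "integral UNIV S = of_real (real r * \<mu> * exp \<mu>) * (\<Sum>h<r. \<omega> powi (- int h) * integral UNIV (\<lambda>x. complex_of_real (F h x)))"
      unfolding S_def by (subst integral_mult_right, subst integral_sum) (auto intro!: integrable_on_mult_right Fi')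
    also have "\<dots> = of_real (\<mu> * exp \<mu>) * (\<Sum>h<r. \<omega> powi (- int h) * of_real (Gamma (a h) * \<mu> powr (- a h)))"
      unfolding Fi using rp by (simp add: sum_distrib_left field_simps)
    finally show ?thesis .
  qed
  define Q where "Q = (\<lambda>x. \<bar>T' x\<bar> *\<^sub>R (of_real (gauss_weight z (T x)) * (\<omega> / (exp (of_real x) - \<omega>))))"
  have QS: "Q x = S x" if x: "x \<noteq> 0" for x
  proof -
    have ne: "exp (of_real x) \<noteq> \<omega>"
      using cases
    proof
      assume "\<omega> = 1"
      moreover have "exp x \<noteq> 1" using x by simp
      hence "complex_of_real (exp x) \<noteq> 1" by (metis of_real_eq_1_iff)
      ultimately show ?thesis by (simp add: exp_of_real)
    qed metis
    have "\<bar>T' x\<bar> * gauss_weight z (T x) = - (2 * T x * T' x) / z * exp ((T x)\<^sup>2 / z)"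
      using T'_pos[of x] by (simp add: gauss_weight_def)
    also have "\<dots> = p / z * (exp (real r * x) - 1) * exp ((T x)\<^sup>2 / z)"
      unfolding T_T' by simp
    also have "(T x)\<^sup>2 / z = - \<mu> * exp (real r * x) + \<mu> + real r * \<mu> * x"
      unfolding T_sq \<mu> using z rp by (simp add: field_simps)
    also have "p / z = real r * \<mu>" using rp by (simp add: \<mu>)
    finally have "\<bar>T' x\<bar> * gauss_weight z (T x) =
       (real r * \<mu> * exp \<mu>) * (exp (- \<mu> * exp (real r * x)) * exp (real r * \<mu> * x)) * (exp (real r * x) - 1)"
      by (simp only: exp_add mult_ac)
    hence "Q x = of_real ((real r * \<mu> * exp \<mu>) * (exp (- \<mu> * exp (real r * x)) * exp (real r * \<mu> * x))) *
       (complex_of_real (exp (real r * x) - 1) * (\<omega> / (exp (of_real x) - \<omega>)))"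
      unfolding Q_def scaleR_conv_of_real mult.assoc[symmetric] of_real_mult[symmetric]
      by (simp only: of_real_mult mult.assoc)
    also have "\<dots> = of_real (real r * \<mu> * exp \<mu>) * (\<Sum>h<r. of_real (exp (- \<mu> * exp (real r * x)) * exp (real r * \<mu> * x)) *
        (\<omega> powi (- int h) * of_real (exp (real h * x))))"
      unfolding kernel_geometric_sum[OF \<omega> ne] sum_distrib_left of_real_mult by (simp only: mult.assoc)
    also have "\<dots> = S x"
      unfolding S_def
    proof (rule arg_cong[of _ _ "(*) (of_real (real r * \<mu> * exp \<mu>))"], rule sum.cong[OF refl])
      fix h
      have "F h x = exp (- \<mu> * exp (real r * x)) * exp (real r * \<mu> * x) * exp (real h * x)"
        unfolding F_def a_def using rp by (simp add: exp_add[symmetric] field_simps)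
      thus "of_real (exp (- \<mu> * exp (real r * x)) * exp (real r * \<mu> * x)) * (\<omega> powi (- int h) * of_real (exp (real h * x)))
         = \<omega> powi (- int h) * complex_of_real (F h x)" by simp
    qed
    finally show ?thesis .
  qed
  have "Q absolutely_integrable_on UNIV"
    using absolutely_integrable_spike[OF S_int, of "{0}" Q] QS by simp
  moreover have "integral UNIV Q = integral UNIV S"
    by (rule integral_spike[of "{0}"]) (use QS in auto)
  ultimately show ?thesis
    using kernel_limit_substitution[of z \<omega>] S_val unfolding Q_def a_def by simp
qed

end

section \<open>From the superpotential to the normalised phase\<close>

lemma W_deriv:
  "(W m r w q has_field_derivative ((\<Sum>l\<in>{- int m..int r}. of_int l * q l * exp (of_int l * y)) - p_of m r w)) (at y)"
  unfolding W_def p_of_def by (auto intro!: derivative_eq_intros sum.cong simp: algebra_simps sum_subtractf)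

lemma deriv_W: "deriv (W m r w q) = (\<lambda>y. (\<Sum>l\<in>{- int m..int r}. of_int l * q l * exp (of_int l * y)) - p_of m r w)"
  using DERIV_imp_deriv[OF W_deriv] by (intro ext)

lemma deriv2_W: "(deriv ^^ 2) (W m r w q) y = (\<Sum>l\<in>{- int m..int r}. of_int l ^ 2 * q l * exp (of_int l * y))"
proof -
  have "((\<lambda>y. (\<Sum>l\<in>{- int m..int r}. of_int l * q l * exp (of_int l * y)) - p_of m r w) has_field_derivative
     (\<Sum>l\<in>{- int m..int r}. of_int l ^ 2 * q l * exp (of_int l * y))) (at y)"
    by (auto intro!: derivative_eq_intros sum.cong simp: power2_eq_square algebra_simps)
  thus ?thesis by (simp add: numeral_2_eq_2 deriv_W DERIV_imp_deriv)
qed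

lemma exp_of_int_mult_eq_power_int: "exp (of_int l * y) = exp y powi l" for y :: complex
  by (simp add: exp_power_int mult.commute)

lemma in_crit_points_iff:
  "P \<in> crit_points m r w q \<longleftrightarrow> P \<noteq> 0 \<and> (\<Sum>l\<in>{- int m..int r}. of_int l * q l * P powi l) = p_of m r w"
proof
  assume "P \<in> crit_points m r w q"
  then obtain y where "P = exp y" "deriv (W m r w q) y = 0" by (auto simp: crit_points_def)
  thus "P \<noteq> 0 \<and> (\<Sum>l\<in>{- int m..int r}. of_int l * q l * P powi l) = p_of m r w"
    by (simp add: deriv_W exp_of_int_mult_eq_power_int)
next
  assume A: "P \<noteq> 0 \<and> (\<Sum>l\<in>{- int m..int r}. of_int l * q l * P powi l) = p_of m r w"
  hence "P = exp (Ln P)" by simp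
  moreover have "deriv (W m r w q) (Ln P) = 0"
    using A by (simp add: deriv_W exp_of_int_mult_eq_power_int)
  ultimately show "P \<in> crit_points m r w q" unfolding crit_points_def by blast
qed

text \<open>Criticality expresses \<open>p\<close> by the \<open>q l\<close>, and the linear terms combine.\<close>

lemma W_shift:
  assumes "exp y0 \<in> crit_points m r w q"
  shows "W m r w q (y0 + v) - W m r w q y0 = phase m r (\<lambda>l. q l * exp y0 powi l) v"
proof -
  have p: "p_of m r w = (\<Sum>l\<in>{- int m..int r}. of_int l * (q l * exp y0 powi l))"
    using assms by (simp add: in_crit_points_iff mult.assoc)
  have "W m r w q (y0 + v) - W m r w q y0 =
     (\<Sum>l\<in>{- int m..int r}. q l * exp y0 powi l * (exp (of_int l * v) - 1)) - p_of m r w * v"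
    unfolding W_def p_of_def sum_distrib_right exp_of_int_mult_eq_power_int[symmetric] sum_subtractf[symmetric]
    by (intro sum.cong refl) (simp add: distrib_left exp_add algebra_simps)
  thus ?thesis
    unfolding p phase_def sum_distrib_right by (simp add: sum_subtractf[symmetric] algebra_simps)
qed

lemma normal_thimble_of_thimble:
  assumes z: "z < 0" and crit: "P_crit m r w q \<beta> \<in> crit_points m r w q" and th: "thimble m r w z q \<beta> \<gamma>"
  shows "normal_thimble m r (\<lambda>l. q l * P_crit m r w q \<beta> powi l) (\<lambda>t. \<gamma> t - \<gamma> 0)"
proof -
  have e: "exp (\<gamma> 0) = P_crit m r w q \<beta>" and diff: "\<gamma> differentiable (at t)"
    and d0: "Re (vector_derivative \<gamma> (at 0)) > 0"
    and W: "W m r w q (\<gamma> t) = W m r w q (\<gamma> 0) + of_real (sgn z * t\<^sup>2)" for t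
    using th unfolding thimble_def by blast+
  have "phase m r (\<lambda>l. q l * P_crit m r w q \<beta> powi l) (\<gamma> t - \<gamma> 0) = - of_real (t\<^sup>2)" for t
  proof -
    have "phase m r (\<lambda>l. q l * P_crit m r w q \<beta> powi l) (\<gamma> t - \<gamma> 0) = W m r w q (\<gamma> t) - W m r w q (\<gamma> 0)"
      using W_shift[of "\<gamma> 0" m r w q "\<gamma> t - \<gamma> 0"] crit unfolding e by simp
    also have "\<dots> = of_real (sgn z * t\<^sup>2)" unfolding W[of t] by simp
    finally show ?thesis using z by simp
  qed
  moreover have d: "((\<lambda>t. \<gamma> t - \<gamma> 0) has_vector_derivative vector_derivative \<gamma> (at t)) (at t)" for t
  proof -
    have "(\<gamma> has_vector_derivative vector_derivative \<gamma> (at t)) (at t)"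
      using diff vector_derivative_works by blast
    from has_vector_derivative_diff[OF this has_vector_derivative_const[of "\<gamma> 0"]] show ?thesis by simp
  qed
  hence "Re (vector_derivative (\<lambda>t. \<gamma> t - \<gamma> 0) (at 0)) > 0"
    using d0 unfolding vector_derivative_at[OF d[of 0]] by simp
  moreover have "(\<lambda>t. \<gamma> t - \<gamma> 0) differentiable (at t)" for t
    using d differentiableI_vector by blast
  ultimately show ?thesis by (simp add: normal_thimble_def)
qed

lemma thimble_of_normal_thimble:
  assumes z: "z < 0" and crit: "exp y0 \<in> crit_points m r w q" "P_crit m r w q \<beta> = exp y0"
    and g: "normal_thimble m r (\<lambda>l. q l * exp y0 powi l) g"
  shows "thimble m r w z q \<beta> (\<lambda>t. y0 + g t)"
proof -
  have d: "((\<lambda>t. y0 + g t) has_vector_derivative vector_derivative g (at t)) (at t)" for t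
  proof -
    have "(g has_vector_derivative vector_derivative g (at t)) (at t)"
      using g vector_derivative_works unfolding normal_thimble_def by blast
    from has_vector_derivative_add[OF has_vector_derivative_const[of y0] this] show ?thesis by simp
  qed
  hence "Re (vector_derivative (\<lambda>t. y0 + g t) (at 0)) > 0"
    using g by (simp add: normal_thimble_def vector_derivative_at)
  moreover have "(\<lambda>t. y0 + g t) differentiable (at t)" for t
    using d differentiableI_vector by blast
  moreover have "W m r w q (y0 + g t) = W m r w q (y0 + g 0) + of_real (sgn z * t\<^sup>2)" for t
    using W_shift[OF crit(1), of "g t"] g z by (simp add: normal_thimble_def algebra_simps)
  ultimately show ?thesis using crit g by (simp add: thimble_def normal_thimble_def)
qed

definition "thimble_prefactor z = complex_of_real (sqrt (- z) / (2 * sqrt pi))"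

text \<open>The R-matrix is defined by some choice of a thimble.  All that is retained of this choice is that
  its centred lift is a normalised thimble; the limit is the same for all of these.\<close>

lemma R_matrix_eq:
  assumes z: "z < 0" and crit: "P_crit m r w q \<beta> \<in> crit_points m r w q" and th: "\<exists>\<gamma>. thimble m r w z q \<beta> \<gamma>"
  obtains g where "normal_thimble m r (\<lambda>l. q l * P_crit m r w q \<beta> powi l) g"
    "R_matrix m r w z q \<alpha> \<beta> = thimble_prefactor z * fp_integral (\<lambda>t. exp (of_real (t\<^sup>2) / of_real z) *
      vector_derivative (\<lambda>s. csqrt (- (2 / Delta m r w q \<alpha>)) *
        ((P_crit m r w q \<alpha> / P_crit m r w q \<beta>) / (exp (g s) - P_crit m r w q \<alpha> / P_crit m r w q \<beta>))) (at t))"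
proof -
  define \<gamma> where "\<gamma> = (SOME \<gamma>. thimble m r w z q \<beta> \<gamma>)"
  have g: "thimble m r w z q \<beta> \<gamma>" unfolding \<gamma>_def using th by (rule someI_ex)
  define g where "g = (\<lambda>t. \<gamma> t - \<gamma> 0)"
  have nz: "P_crit m r w q \<beta> \<noteq> 0" using crit by (simp add: in_crit_points_iff)
  have e0: "exp (\<gamma> 0) = P_crit m r w q \<beta>" using g unfolding thimble_def by blast
  have e: "exp (\<gamma> s) = P_crit m r w q \<beta> * exp (g s)" for s
    using nz by (simp add: g_def exp_diff e0)
  have xi: "xi m r w q \<alpha> (exp (\<gamma> s)) = csqrt (- (2 / Delta m r w q \<alpha>)) *
        ((P_crit m r w q \<alpha> / P_crit m r w q \<beta>) / (exp (g s) - P_crit m r w q \<alpha> / P_crit m r w q \<beta>))" for s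
  proof -
    have "P_crit m r w q \<beta> * exp (g s) - P_crit m r w q \<alpha> =
       P_crit m r w q \<beta> * (exp (g s) - P_crit m r w q \<alpha> / P_crit m r w q \<beta>)"
      using nz by (simp add: right_diff_distrib)
    hence "P_crit m r w q \<alpha> / (P_crit m r w q \<beta> * exp (g s) - P_crit m r w q \<alpha>) =
       (P_crit m r w q \<alpha> / P_crit m r w q \<beta>) / (exp (g s) - P_crit m r w q \<alpha> / P_crit m r w q \<beta>)"
      by simp
    thus ?thesis unfolding xi_def e by simp
  qed
  have ex: "(W m r w q (\<gamma> 0) - W m r w q (\<gamma> t)) / of_real z = of_real (t\<^sup>2) / of_real z" for t
  proof -
    have "W m r w q (\<gamma> t) = W m r w q (\<gamma> 0) + of_real (sgn z * t\<^sup>2)"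
      using g unfolding thimble_def by blast
    hence "W m r w q (\<gamma> 0) - W m r w q (\<gamma> t) = of_real (t\<^sup>2)" using z by simp
    thus ?thesis by (simp only:)
  qed
  have "R_matrix m r w z q \<alpha> \<beta> = thimble_prefactor z * fp_integral (\<lambda>t. exp (of_real (t\<^sup>2) / of_real z) *
      vector_derivative (\<lambda>s. csqrt (- (2 / Delta m r w q \<alpha>)) *
        ((P_crit m r w q \<alpha> / P_crit m r w q \<beta>) / (exp (g s) - P_crit m r w q \<alpha> / P_crit m r w q \<beta>))) (at t))"
    unfolding R_matrix_def Let_def \<gamma>_def[symmetric] thimble_prefactor_def by (simp only: ex xi)
  moreover have "normal_thimble m r (\<lambda>l. q l * P_crit m r w q \<beta> powi l) g"
    unfolding g_def by (rule normal_thimble_of_thimble[OF z crit g])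
  ultimately show ?thesis using that by blast
qed

lemma P_crit_is_nearest:
  assumes "finite (crit_points m r w q)" "crit_points m r w q \<noteq> {}"
  shows "P_crit m r w q \<beta> \<in> crit_points m r w q"
    "P \<in> crit_points m r w q \<Longrightarrow> dist (P_crit m r w q \<beta>) (P_lim m r w \<beta>) \<le> dist P (P_lim m r w \<beta>)"
proof -
  have "\<exists>P. is_arg_min (\<lambda>P. dist P (P_lim m r w \<beta>)) (\<lambda>P. P \<in> crit_points m r w q) P"
    using ex_is_arg_min_if_finite[OF assms, of "\<lambda>P. dist P (P_lim m r w \<beta>)"] .
  hence "is_arg_min (\<lambda>P. dist P (P_lim m r w \<beta>)) (\<lambda>P. P \<in> crit_points m r w q) (P_crit m r w q \<beta>)"
    unfolding P_crit_def arg_min_def by (rule someI_ex)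
  thus "P_crit m r w q \<beta> \<in> crit_points m r w q"
    "P \<in> crit_points m r w q \<Longrightarrow> dist (P_crit m r w q \<beta>) (P_lim m r w \<beta>) \<le> dist P (P_lim m r w \<beta>)"
    by (auto simp: is_arg_min_def not_less)
qed

lemma P_lim_nonzero: "p_of m r w \<noteq> 0 \<Longrightarrow> r \<ge> 1 \<Longrightarrow> P_lim m r w \<beta> \<noteq> 0"
  by (simp add: P_lim_def)

lemma P_lim_power:
  assumes "p_of m r w \<noteq> 0" "r \<ge> 1"
  shows "P_lim m r w \<beta> ^ r = p_of m r w / of_nat r"
proof -
  have r: "(of_nat r :: complex) \<noteq> 0" using assms by simp
  have "((p_of m r w / of_nat r) powr (1 / of_nat r)) ^ r = p_of m r w / of_nat r"
    using assms r by (simp add: powr_def exp_of_nat_mult[symmetric])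
  moreover have "exp (2 * of_real pi * \<i> * of_nat \<beta> / of_nat r) ^ r = (1 :: complex)"
  proof -
    have "exp (2 * of_real pi * \<i> * of_nat \<beta> / of_nat r) ^ r = exp (2 * of_real pi * \<i> * of_nat \<beta> :: complex)"
      using r by (simp add: exp_of_nat_mult[symmetric])
    also have "\<dots> = exp (2 * of_real pi * \<i>) ^ \<beta>"
      by (simp add: exp_of_nat_mult[symmetric] mult_ac)
    finally show ?thesis by (simp add: exp_two_pi_i)
  qed
  ultimately show ?thesis by (simp add: P_lim_def power_mult_distrib)
qed

lemma P_lim_quotient:
  assumes "p_of m r w \<noteq> 0" "r \<ge> 1"
  shows "P_lim m r w \<alpha> / P_lim m r w \<beta> = root_omega r \<alpha> \<beta>"
proof -
  have "(p_of m r w / of_nat r) powr (1 / of_nat r) \<noteq> 0" using assms by simp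
  thus ?thesis unfolding P_lim_def root_omega_def
    by (simp add: exp_diff[symmetric] diff_divide_distrib right_diff_distrib)
qed

lemma root_omega_power: "r \<ge> 1 \<Longrightarrow> root_omega r \<alpha> \<beta> ^ r = 1"
proof -
  assume r: "r \<ge> 1"
  have "root_omega r \<alpha> \<beta> ^ r = exp (2 * of_real pi * \<i> * (of_nat \<alpha> - of_nat \<beta>))"
    using r by (simp add: root_omega_def exp_of_nat_mult[symmetric])
  also have "\<dots> = exp (of_int (int \<alpha> - int \<beta>) * (2 * of_real pi * \<i>))" by (simp add: mult_ac)
  also have "\<dots> = 1" unfolding exp_of_int_mult_eq_power_int exp_two_pi_i by simp
  finally show ?thesis .
qed

lemma norm_root_omega: "r \<ge> 1 \<Longrightarrow> norm (root_omega r \<alpha> \<beta>) = 1"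
  by (simp add: root_omega_def norm_exp_eq_Re Re_divide_of_nat)

text \<open>A real exponential of modulus one is \<open>1\<close>, and \<open>\<alpha> - \<beta>\<close> is not a multiple of \<open>r\<close>.\<close>

lemma root_omega_not_exp:
  assumes "\<alpha> < r" "\<beta> < r" "\<alpha> \<noteq> \<beta>"
  shows "root_omega r \<alpha> \<beta> \<noteq> exp (of_real x)"
proof
  assume eq: "root_omega r \<alpha> \<beta> = exp (of_real x)"
  have "norm (exp (complex_of_real x)) = 1" using norm_root_omega[of r \<alpha> \<beta>] eq assms by simp
  hence "x = 0" by (simp add: norm_exp_eq_Re)
  hence "root_omega r \<alpha> \<beta> = 1" using eq by simp
  hence "\<exists>n::int. Im (2 * of_real pi * \<i> * (of_nat \<alpha> - of_nat \<beta>) / of_nat r) = of_int (2 * n) * pi"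
    unfolding root_omega_def exp_eq_1 by blast
  then obtain n :: int where "Im (2 * of_real pi * \<i> * (of_nat \<alpha> - of_nat \<beta>) / of_nat r) = of_int (2 * n) * pi" ..
  hence "2 * pi * (real \<alpha> - real \<beta>) / real r = 2 * of_int n * pi" by (simp add: Im_divide_of_nat)
  moreover have "2 * pi * (real \<alpha> - real \<beta>) / real r = 2 * (pi * ((real \<alpha> - real \<beta>) / real r))" by simp
  moreover have "2 * of_int n * pi = 2 * (pi * of_int n)" by simp
  ultimately have "pi * ((real \<alpha> - real \<beta>) / real r) = pi * of_int n" by linarith
  hence "(real \<alpha> - real \<beta>) / real r = of_int n"
    by (simp only: mult_cancel_left pi_neq_zero simp_thms)
  hence "real \<alpha> - real \<beta> = of_int n * real r" using assms by (simp add: field_simps)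
  hence "real_of_int (int \<alpha> - int \<beta>) = real_of_int (n * int r)" by simp
  hence "int \<alpha> - int \<beta> = n * int r" by (simp only: of_int_eq_iff)
  moreover have "\<bar>int \<alpha> - int \<beta>\<bar> < int r" using assms by auto
  ultimately have "\<bar>n\<bar> * int r < 1 * int r" by (simp add: abs_mult)
  hence "\<bar>n\<bar> < 1" by (rule mult_right_less_imp_less) simp
  hence "int \<alpha> = int \<beta>" using \<open>int \<alpha> - int \<beta> = n * int r\<close> by simp
  thus False using assms by simp
qed

lemma sequence_componentwise:
  "X \<longlonglongrightarrow> (q0 :: int \<Rightarrow> complex) \<longleftrightarrow> (\<forall>l. (\<lambda>n. X n l) \<longlonglongrightarrow> q0 l)"
  using limitin_componentwise[of "\<lambda>_. euclidean" UNIV X q0 sequentially]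
  by (simp add: euclidean_product_topology)

lemma uniform_limit_sum_mult:
  fixes a :: "nat \<Rightarrow> 'b \<Rightarrow> complex" and h :: "'b \<Rightarrow> complex \<Rightarrow> complex"
  assumes a: "\<And>l. l \<in> I \<Longrightarrow> (\<lambda>n. a n l) \<longlonglongrightarrow> b l" and K: "compact K"
    and h: "\<And>l. l \<in> I \<Longrightarrow> continuous_on K (h l)"
  shows "uniform_limit K (\<lambda>n y. \<Sum>l\<in>I. a n l * h l y) (\<lambda>y. \<Sum>l\<in>I. b l * h l y) sequentially"
  using a h
proof (induction I rule: infinite_finite_induct)
  case (insert l I)
  have bd: "bounded (h l ` K)"
    using insert.prems K by (intro compact_imp_bounded compact_continuous_image) auto
  have "(\<lambda>n. a n l) \<longlonglongrightarrow> b l" using insert.prems by auto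
  hence "uniform_limit K (\<lambda>n _. a n l) (\<lambda>_. b l) sequentially"
    by (auto simp: uniform_limit_iff tendsto_iff elim: eventually_mono)
  hence "uniform_limit K (\<lambda>n y. a n l * h l y) (\<lambda>y. b l * h l y) sequentially"
    by (rule uniform_lim_mult[OF _ uniform_limit_const _ bd])
       (rule bounded_subset[of "{b l}"], auto)
  moreover have "uniform_limit K (\<lambda>n y. \<Sum>l\<in>I. a n l * h l y) (\<lambda>y. \<Sum>l\<in>I. b l * h l y) sequentially"
    by (rule insert.IH) (use insert.prems in auto)
  ultimately show ?case using insert.hyps by (simp add: uniform_limit_add)
qed (simp_all add: uniform_limit_const)

text \<open>By Hurwitz's theorem, applied to the derivatives of \<open>W\<close> in the logarithmic coordinate, there are
  critical points close to \<open>P\<^sub>\<beta>\<close> at the limit; the nearest one, being nearer still, converges.\<close>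

lemma P_crit_tendsto:
  assumes q: "\<And>l. (\<lambda>n. q n l) \<longlonglongrightarrow> q_lim r l" and r: "r \<ge> 1" and p: "p_of m r w \<noteq> 0"
    and fin: "\<And>n. finite (crit_points m r w (q n))" "\<And>n. crit_points m r w (q n) \<noteq> {}"
  shows "(\<lambda>n. P_crit m r w (q n) \<beta>) \<longlonglongrightarrow> P_lim m r w \<beta>"
proof (rule ccontr)
  assume "\<not> ?thesis"
  then obtain e where e: "e > 0" "\<not> eventually (\<lambda>n. dist (P_crit m r w (q n) \<beta>) (P_lim m r w \<beta>) < e) sequentially"
    by (auto simp: tendsto_iff)
  then obtain s :: "nat \<Rightarrow> nat" where s: "strict_mono s" "\<forall>k. \<not> dist (P_crit m r w (q (s k)) \<beta>) (P_lim m r w \<beta>) < e"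
    by (auto dest!: not_eventually_sequentiallyD)
  define y0 where "y0 = Ln (P_lim m r w \<beta>)"
  have y0: "exp y0 = P_lim m r w \<beta>" using P_lim_nonzero[OF p r] by (simp add: y0_def)
  have "isCont exp y0" by simp
  then obtain d where d: "d > 0" "\<And>y. dist y y0 < d \<Longrightarrow> dist (exp y) (exp y0) < e"
    using e(1) unfolding continuous_at_eps_delta by blast
  define f where "f = (\<lambda>k y. (\<Sum>l\<in>{- int m..int r}. of_int l * q (s k) l * exp (of_int l * y)) - p_of m r w)"
  define h where "h = (\<lambda>y. (\<Sum>l\<in>{- int m..int r}. of_int l * q_lim r l * exp (of_int l * y)) - p_of m r w)"
  have h_eq: "h y = of_nat r * exp y ^ r - p_of m r w" for y
  proof -
    have "(\<Sum>l\<in>{- int m..int r}. of_int l * q_lim r l * exp (of_int l * y)) =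
      (\<Sum>l\<in>{- int m..int r}. if l = int r then of_nat r * exp y ^ r else 0)"
      by (intro sum.cong refl) (auto simp: q_lim_def exp_of_nat_mult)
    thus ?thesis by (simp add: h_def)
  qed
  have "h y0 \<noteq> 0"
  proof (rule Hurwitz_no_zeros[of "ball y0 d" f h])
    show "f n holomorphic_on ball y0 d" for n unfolding f_def by (intro holomorphic_intros)
    show "h holomorphic_on ball y0 d" unfolding h_def by (intro holomorphic_intros)
    show "uniform_limit K f h sequentially" if K: "compact K" "K \<subseteq> ball y0 d" for K
      unfolding f_def h_def
    proof (intro uniform_limit_minus uniform_limit_const uniform_limit_sum_mult K)
      fix l :: int
      have "(\<lambda>k. q (s k) l) \<longlonglongrightarrow> q_lim r l"
        using LIMSEQ_subseq_LIMSEQ[OF q s(1)] by (simp add: o_def)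
      thus "(\<lambda>k. of_int l * q (s k) l) \<longlonglongrightarrow> of_int l * q_lim r l" by (intro tendsto_intros)
      show "continuous_on K (\<lambda>y. exp (of_int l * y))" by (intro continuous_intros)
    qed
    show "\<not> h constant_on ball y0 d"
    proof
      assume "h constant_on ball y0 d"
      then obtain c where c: "\<And>y. y \<in> ball y0 d \<Longrightarrow> h y = c" unfolding constant_on_def by blast
      have "(h has_field_derivative 0) (at y0)"
        using c d(1) by (intro has_field_derivative_transform_within_open[of "\<lambda>_. c" 0 y0 "ball y0 d" h]) auto
      moreover have "(h has_field_derivative of_nat r * of_nat r * exp y0 ^ r) (at y0)"
      proof -
        obtain r' where r': "r = Suc r'" using r by (cases r) auto
        show ?thesis unfolding h_eq[abs_def] r'
          by (rule derivative_eq_intros refl)+ (simp add: algebra_simps)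
      qed
      ultimately have "0 = of_nat r * of_nat r * exp y0 ^ r" by (rule DERIV_unique)
      thus False using r by simp
    qed
    show "f n y \<noteq> 0" if y: "y \<in> ball y0 d" for n y
    proof
      assume "f n y = 0"
      hence "exp y \<in> crit_points m r w (q (s n))"
        unfolding in_crit_points_iff f_def by (simp add: exp_of_int_mult_eq_power_int)
      hence "dist (P_crit m r w (q (s n)) \<beta>) (P_lim m r w \<beta>) \<le> dist (exp y) (P_lim m r w \<beta>)"
        by (intro P_crit_is_nearest fin)
      also have "\<dots> < e" using d(2)[of y] y by (simp add: y0 dist_commute)
      finally show False using s(2) by blast
    qed
  qed (use d in auto)
  moreover have "h y0 = 0"
    unfolding h_eq y0 P_lim_power[OF p r] using r by simp
  ultimately show False by contradiction
qed

section \<open>The limit of the R-matrix\<close>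

lemma prefactor_eq:
  fixes p z :: real
  assumes "p < 0" "z < 0" "r \<ge> 1" "\<mu> = p / (real r * z)"
  shows "sqrt (- z) / (2 * sqrt pi) * sqrt (2 / (real r * - p)) = 1 / (real r * sqrt (2 * pi * \<mu>))"
proof -
  have r: "real r > 0" using assms by simp
  have \<mu>: "\<mu> > 0" using assms r by (auto intro!: divide_neg_neg mult_pos_neg)
  have "sqrt (- z) / (2 * sqrt pi) * sqrt (2 / (real r * - p)) = sqrt (- z / (4 * pi) * (2 / (real r * - p)))"
    by (simp only: real_sqrt_mult real_sqrt_divide real_sqrt_four)
  also have "- z / (4 * pi) * (2 / (real r * - p)) = 1 / ((real r)\<^sup>2 * (2 * pi * \<mu>))"
    unfolding assms(4) using assms(1,2) r by (simp add: power2_eq_square field_simps)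
  also have "sqrt \<dots> = 1 / (real r * sqrt (2 * pi * \<mu>))"
    using r by (simp add: real_sqrt_divide real_sqrt_mult)
  finally show ?thesis .
qed

lemma P_block_eq_limit:
  fixes p z :: real
  assumes p: "p < 0" and z: "z < 0" and r: "r \<ge> 1" and \<mu>: "\<mu> = p / (real r * z)"
  shows "thimble_prefactor z * (csqrt (- (2 / of_real (real r * p))) * (of_real (\<mu> * exp \<mu>) *
     (\<Sum>h<r. root_omega r \<alpha> \<beta> powi (- int h) * of_real (Gamma (\<mu> + real h / real r) * \<mu> powr (- (\<mu> + real h / real r))))))
     = P_block r (of_real \<mu>) \<alpha> \<beta>"
proof -
  have rp: "real r > 0" using r by simp
  have \<mu>_pos: "\<mu> > 0" using p z rp unfolding \<mu> by (intro divide_neg_neg mult_pos_neg) auto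
  have pos: "2 / (real r * - p) \<ge> 0" using rp p by (intro divide_nonneg_nonneg mult_nonneg_nonneg) auto
  have "- (2 / complex_of_real (real r * p)) = of_real (2 / (real r * - p))" by simp
  hence cs1: "csqrt (- (2 / complex_of_real (real r * p))) = of_real (sqrt (2 / (real r * - p)))"
    using of_real_sqrt[OF pos] by simp
  have "2 * complex_of_real pi * of_real \<mu> = of_real (2 * pi * \<mu>)" by simp
  hence cs2: "csqrt (2 * complex_of_real pi * of_real \<mu>) = of_real (sqrt (2 * pi * \<mu>))"
    using of_real_sqrt[of "2 * pi * \<mu>"] \<mu>_pos by simp
  have term_eq: "Gamma (complex_of_real \<mu> + of_nat h / of_nat r) * of_real \<mu> powr (1 - of_real \<mu> - of_nat h / of_nat r)
     = of_real (\<mu> * (Gamma (\<mu> + real h / real r) * \<mu> powr (- (\<mu> + real h / real r))))" for h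
  proof -
    have 1: "complex_of_real \<mu> + of_nat h / of_nat r = of_real (\<mu> + real h / real r)" by simp
    have 2: "1 - complex_of_real \<mu> - of_nat h / of_nat r = of_real (1 + - (\<mu> + real h / real r))" by simp
    have "\<mu> powr (1 + - (\<mu> + real h / real r)) = \<mu> * \<mu> powr (- (\<mu> + real h / real r))"
      unfolding powr_add using \<mu>_pos by simp
    thus ?thesis unfolding 1 2 using \<mu>_pos
      by (simp only: Gamma_complex_of_real powr_of_real[OF less_imp_le[OF \<mu>_pos]] of_real_mult mult_ac)
  qed
  have "P_block r (of_real \<mu>) \<alpha> \<beta> = of_real (exp \<mu> / (real r * sqrt (2 * pi * \<mu>))) *
     (\<Sum>h<r. root_omega r \<alpha> \<beta> powi (- int h) * of_real (\<mu> * (Gamma (\<mu> + real h / real r) * \<mu> powr (- (\<mu> + real h / real r)))))"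
    unfolding P_block_def cs2 unfolding mult.assoc term_eq by (simp add: exp_of_real)
  also have "\<dots> = of_real (1 / (real r * sqrt (2 * pi * \<mu>))) * (of_real (\<mu> * exp \<mu>) *
     (\<Sum>h<r. root_omega r \<alpha> \<beta> powi (- int h) * of_real (Gamma (\<mu> + real h / real r) * \<mu> powr (- (\<mu> + real h / real r)))))"
    by (simp add: sum_distrib_left sum_distrib_right mult_ac)
  finally show ?thesis
    unfolding prefactor_eq[OF p z r \<mu>, symmetric] thimble_prefactor_def cs1 by (simp only: of_real_mult mult.assoc)
qed

lemma card_crit_imp:
  "q \<in> q_domain m r w z \<beta> \<Longrightarrow> r \<ge> 1 \<Longrightarrow> finite (crit_points m r w q) \<and> crit_points m r w q \<noteq> {}"
  unfolding q_domain_def by (cases "finite (crit_points m r w q)") auto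

text \<open>The large radius limit along an arbitrary sequence.  The cases \<open>\<alpha> = \<beta>\<close>, where \<open>\<rho> = 1\<close> holds
  identically, and \<open>\<alpha> \<noteq> \<beta>\<close>, where the limit of \<open>\<rho>\<close> is a nontrivial root of unity, are exactly the
  two cases in which the kernel was bounded.\<close>

lemma R_matrix_sequence:
  fixes m r \<alpha> \<beta> :: nat and w :: "int \<Rightarrow> complex" and p z :: real
  assumes r: "r \<ge> 1" and pw: "p_of m r w = of_real p" and p: "p < 0" and z: "z < 0"
    and \<alpha>: "\<alpha> < r" and \<beta>: "\<beta> < r"
    and dom: "\<And>n. q n \<in> q_domain m r w z \<beta>" and q: "\<And>l. (\<lambda>n. q n l) \<longlonglongrightarrow> q_lim r l"
  shows "(\<lambda>n. R_matrix m r w z (q n) \<alpha> \<beta>) \<longlonglongrightarrow> P_block r (of_real (p / (real r * z))) \<alpha> \<beta>"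
proof -
  have p0: "p_of m r w \<noteq> 0" using pw p by simp
  have fin: "finite (crit_points m r w (q n))" "crit_points m r w (q n) \<noteq> {}" for n
    using card_crit_imp[OF dom r] by auto
  have crit: "P_crit m r w (q n) \<gamma> \<in> crit_points m r w (q n)" for n \<gamma>
    by (rule P_crit_is_nearest(1)[OF fin])
  have nz: "P_crit m r w (q n) \<gamma> \<noteq> 0" for n \<gamma> using crit by (simp add: in_crit_points_iff)
  have P_tendsto: "(\<lambda>n. P_crit m r w (q n) \<gamma>) \<longlonglongrightarrow> P_lim m r w \<gamma>" for \<gamma>
    by (rule P_crit_tendsto[OF q r p0 fin])
  define c where "c = (\<lambda>n l. q n l * P_crit m r w (q n) \<beta> powi l)"
  define \<rho> where "\<rho> = (\<lambda>n. P_crit m r w (q n) \<alpha> / P_crit m r w (q n) \<beta>)"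
  define k where "k = (\<lambda>n. csqrt (- (2 / Delta m r w (q n) \<alpha>)))"
  define \<omega> where "\<omega> = root_omega r \<alpha> \<beta>"
  have th: "\<exists>\<gamma>. thimble m r w z (q n) \<beta> \<gamma>" for n using dom[of n] by (simp add: q_domain_def)
  have "\<forall>n. \<exists>g. normal_thimble m r (c n) g \<and> R_matrix m r w z (q n) \<alpha> \<beta> =
    thimble_prefactor z * fp_integral (\<lambda>t. exp (of_real (t\<^sup>2) / of_real z) *
      vector_derivative (\<lambda>s. k n * (\<rho> n / (exp (g s) - \<rho> n))) (at t))"
  proof
    fix n
    obtain g where "normal_thimble m r (c n) g" "R_matrix m r w z (q n) \<alpha> \<beta> =
      thimble_prefactor z * fp_integral (\<lambda>t. exp (of_real (t\<^sup>2) / of_real z) *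
      vector_derivative (\<lambda>s. k n * (\<rho> n / (exp (g s) - \<rho> n))) (at t))"
      unfolding c_def k_def \<rho>_def by (rule R_matrix_eq[OF z crit th])
    thus "\<exists>g. normal_thimble m r (c n) g \<and> R_matrix m r w z (q n) \<alpha> \<beta> =
      thimble_prefactor z * fp_integral (\<lambda>t. exp (of_real (t\<^sup>2) / of_real z) *
      vector_derivative (\<lambda>s. k n * (\<rho> n / (exp (g s) - \<rho> n))) (at t))" by blast
  qed
  from choice[OF this] obtain g where g: "\<And>n. normal_thimble m r (c n) (g n)"
    and R: "\<And>n. R_matrix m r w z (q n) \<alpha> \<beta> =
      thimble_prefactor z * fp_integral (\<lambda>t. exp (of_real (t\<^sup>2) / of_real z) *
      vector_derivative (\<lambda>s. k n * (\<rho> n / (exp (g n s) - \<rho> n))) (at t))"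
    by blast
  \<comment> \<open>The limiting deformation, with the sign for which the real phase is non-negative.\<close>
  define a where "a = (\<lambda>l::int. if l = int r then - p / real r else 0)"
  have "- p / real r > 0" using p r by (intro divide_pos_pos) auto
  hence a_r: "a (int r) > 0" and a_nn: "a l \<ge> 0" for l by (auto simp: a_def)
  obtain T T' X :: "real \<Rightarrow> real" where T:
    "\<And>x. (T has_real_derivative T' x) (at x)" "\<And>x. T' x > 0"
    "\<And>x. T x ^ 2 = (\<Sum>l\<in>{- int m..int r}. a l * (exp (of_int l * x) - 1 - of_int l * x))"
    "\<And>x. sgn (T x) = sgn x" "\<And>t. T (X t) = t" "\<And>x. X (T x) = x"
    "\<And>t. (X has_real_derivative (1 / T' (X t))) (at t)"
    by (rule real_phase_coordinate[of a r m, OF a_nn a_r r]) blast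
  have T_sq: "T x ^ 2 = - p / real r * (exp (real r * x) - 1 - real r * x)" for x
  proof -
    have "T x ^ 2 = (\<Sum>l\<in>{- int m..int r}. if l = int r then - p / real r * (exp (real r * x) - 1 - real r * x) else 0)"
      unfolding T(3) a_def by (intro sum.cong refl) auto
    thus ?thesis by simp
  qed
  have c_lim: "(\<lambda>n. c n l) \<longlonglongrightarrow> lim_coeff r p l" for l
  proof -
    have "(\<lambda>n. c n l) \<longlonglongrightarrow> q_lim r l * P_lim m r w \<beta> powi l"
      unfolding c_def by (intro tendsto_intros q P_tendsto P_lim_nonzero p0 r)
    also have "q_lim r l * P_lim m r w \<beta> powi l = lim_coeff r p l"
      using P_lim_power[OF p0 r] by (simp add: q_lim_def lim_coeff_def pw)
    finally show ?thesis .
  qed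
  interpret thimble_sequence m r p c g T T' X
  proof
    show "(\<Sum>l\<in>{- int m..int r}. of_int l * c n l) = of_real p" for n
      using crit[of n \<beta>] by (simp add: in_crit_points_iff c_def pw mult.assoc)
  qed (fact r p c_lim g T T_sq)+
  have \<rho>_lim: "\<rho> \<longlonglongrightarrow> \<omega>"
    unfolding \<rho>_def \<omega>_def P_lim_quotient[OF p0 r, of \<alpha> \<beta>, symmetric]
    by (intro tendsto_intros P_tendsto P_lim_nonzero p0 r)
  have cases: "(\<forall>n. \<rho> n = 1) \<or> (\<forall>x. \<omega> \<noteq> exp (of_real x))"
  proof (cases "\<alpha> = \<beta>")
    case True
    thus ?thesis using nz by (simp add: \<rho>_def)
  next
    case False
    thus ?thesis using root_omega_not_exp[OF \<alpha> \<beta>] by (simp add: \<omega>_def)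
  qed
  have cases': "\<omega> = 1 \<or> (\<forall>x. \<omega> \<noteq> exp (of_real x))"
  proof (cases "\<alpha> = \<beta>")
    case True
    thus ?thesis by (simp add: \<omega>_def root_omega_def)
  next
    case False
    thus ?thesis using root_omega_not_exp[OF \<alpha> \<beta>] by (simp add: \<omega>_def)
  qed
  have \<omega>: "norm \<omega> = 1" "\<omega> ^ r = 1" unfolding \<omega>_def by (rule norm_root_omega[OF r] root_omega_power[OF r])+
  have k_lim: "k \<longlonglongrightarrow> csqrt (- (2 / of_real (real r * p)))"
  proof -
    have "Delta m r w (q n) \<alpha> = (\<Sum>l\<in>{- int m..int r}. of_int l ^ 2 * q n l * P_crit m r w (q n) \<alpha> powi l)" for n
      unfolding Delta_def deriv2_W exp_of_int_mult_eq_power_int using nz by simp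
    moreover have "(\<lambda>n. \<Sum>l\<in>{- int m..int r}. of_int l ^ 2 * q n l * P_crit m r w (q n) \<alpha> powi l) \<longlonglongrightarrow>
      (\<Sum>l\<in>{- int m..int r}. of_int l ^ 2 * q_lim r l * P_lim m r w \<alpha> powi l)"
      by (intro tendsto_intros q P_tendsto P_lim_nonzero p0 r)
    moreover have "(\<Sum>l\<in>{- int m..int r}. of_int l ^ 2 * q_lim r l * P_lim m r w \<alpha> powi l) = of_real (real r * p)"
    proof -
      have "(\<Sum>l\<in>{- int m..int r}. of_int l ^ 2 * q_lim r l * P_lim m r w \<alpha> powi l) =
        (\<Sum>l\<in>{- int m..int r}. if l = int r then of_nat r ^ 2 * P_lim m r w \<alpha> ^ r else 0)"
        by (intro sum.cong refl) (auto simp: q_lim_def)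
      also have "\<dots> = of_nat r ^ 2 * P_lim m r w \<alpha> ^ r" by simp
      finally show ?thesis unfolding P_lim_power[OF p0 r] pw using r by (simp add: power2_eq_square)
    qed
    ultimately have D: "(\<lambda>n. Delta m r w (q n) \<alpha>) \<longlonglongrightarrow> of_real (real r * p)" by simp
    have "real r * p \<noteq> 0" using r p by simp
    hence "complex_of_real (real r * p) \<noteq> 0" by (simp only: of_real_eq_0_iff not_False_eq_True)
    hence "(\<lambda>n. - (2 / Delta m r w (q n) \<alpha>)) \<longlonglongrightarrow> - (2 / of_real (real r * p))"
      by (intro tendsto_intros D)
    moreover have "isCont csqrt (- (2 / of_real (real r * p)))"
    proof (rule continuous_at_csqrt)
      have "2 / (real r * - p) > 0" using r p by (intro divide_pos_pos mult_pos_pos) auto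
      moreover have "- (2 / complex_of_real (real r * p)) = of_real (2 / (real r * - p))" by simp
      ultimately show "- (2 / complex_of_real (real r * p)) \<notin> \<real>\<^sub>\<le>\<^sub>0"
        by (metis complex_nonpos_Reals_iff Re_complex_of_real not_le)
    qed
    ultimately show ?thesis unfolding k_def by (rule isCont_tendsto_compose[rotated])
  qed
  define I where "I = integral UNIV (\<lambda>t. of_real (gauss_weight z t) * (\<omega> / (exp (of_real (X t)) - \<omega>)))"
  have "(\<lambda>n. thimble_prefactor z * (k n * integral UNIV (\<lambda>t. of_real (gauss_weight z t) * (\<rho> n / (exp (g n t) - \<rho> n)))))
      \<longlonglongrightarrow> thimble_prefactor z * (csqrt (- (2 / of_real (real r * p))) * I)"
    unfolding I_def by (intro tendsto_intros k_lim kernel_integral_tendsto(1)[OF z \<rho>_lim \<omega>(1) cases])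
  moreover have "eventually (\<lambda>n. thimble_prefactor z * (k n * integral UNIV (\<lambda>t. of_real (gauss_weight z t) * (\<rho> n / (exp (g n t) - \<rho> n))))
     = R_matrix m r w z (q n) \<alpha> \<beta>) sequentially"
    using kernel_integral_tendsto(2)[OF z \<rho>_lim \<omega>(1) cases, of k]
    by eventually_elim (simp only: R)
  ultimately have "(\<lambda>n. R_matrix m r w z (q n) \<alpha> \<beta>) \<longlonglongrightarrow> thimble_prefactor z * (csqrt (- (2 / of_real (real r * p))) * I)"
    by (rule Lim_transform_eventually)
  also have "thimble_prefactor z * (csqrt (- (2 / of_real (real r * p))) * I) = P_block r (of_real (p / (real r * z))) \<alpha> \<beta>"
    unfolding I_def kernel_limit_integral[OF z \<omega>(2) cases' refl] unfolding \<omega>_def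
    by (rule P_block_eq_limit[OF p z r refl])
  finally show ?thesis .
qed

section \<open>The limit point is approached\<close>

lemma card_roots_rsquarefree:
  fixes f :: "complex poly"
  assumes "rsquarefree f"
  shows "card {a. poly f a = 0} = degree f"
proof -
  have f0: "f \<noteq> 0" using assms by (simp add: rsquarefree_def)
  have "degree f = degree (smult (lead_coeff f) (\<Prod>a|poly f a = 0. [:- a, 1:]))"
    using complex_poly_decompose_rsquarefree[OF assms] by simp
  also have "\<dots> = degree (\<Prod>a|poly f a = 0. [:- a, 1:])" using f0 by simp
  also have "\<dots> = (\<Sum>a|poly f a = 0. degree [:- a, 1:])"
    by (rule degree_prod_eq_sum_degree) auto
  also have "\<dots> = card {a. poly f a = 0}" by simp
  finally show ?thesis by simp
qed

text \<open>The critical points are the roots of a polynomial of degree \<open>m + r\<close> in which \<open>q (- m)\<close> occurs only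
  in the constant term.  Its derivative \<open>D\<close> is independent of \<open>\<delta>\<close>, and a multiple root lies among the
  finitely many roots of \<open>D\<close>, each of which determines \<open>\<delta>\<close>.  The condition \<open>\<delta> \<noteq> 0\<close> keeps \<open>0\<close> from
  being a root.\<close>

lemma finite_coincident_critical_points:
  fixes q :: "int \<Rightarrow> complex" and b :: complex
  assumes m: "m \<ge> 1" and r: "r \<ge> 1" and q: "q (int r) = 1" and b: "b \<noteq> 0"
  shows "finite {\<delta>::real. \<delta> \<noteq> 0 \<and> card (crit_points m r w (q(- int m := - of_real \<delta> * b))) \<noteq> m + r}"
proof -
  define F where "F = (\<lambda>\<delta>::real. (\<Sum>l\<in>{- int m..int r}. monom (of_int l * (q(- int m := - of_real \<delta> * b)) l) (nat (l + int m)))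
      - monom (p_of m r w) m)"
  have F_shift: "F \<delta> = F 0 + [: of_nat m * of_real \<delta> * b :]" for \<delta>
  proof -
    have split: "{- int m..int r} = insert (- int m) {- int m + 1..int r}" by auto
    show ?thesis unfolding F_def split by (simp add: monom_0)
  qed
  have F_poly: "poly (F \<delta>) a = a ^ m * ((\<Sum>l\<in>{- int m..int r}. of_int l * (q(- int m := - of_real \<delta> * b)) l * a powi l) - p_of m r w)"
    if "a \<noteq> 0" for \<delta> a
  proof -
    have "a ^ nat (l + int m) = a ^ m * a powi l" if "l \<in> {- int m..int r}" for l
    proof -
      have "a ^ nat (l + int m) = a powi (l + int m)"
        using that by (simp add: power_int_def)
      thus ?thesis using \<open>a \<noteq> 0\<close> by (simp add: power_int_add)
    qed
    thus ?thesis unfolding F_def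
      by (simp add: poly_sum poly_monom right_diff_distrib sum_distrib_left mult_ac)
  qed
  have deg: "degree (F 0) = m + r"
  proof (rule antisym)
    show "degree (F 0) \<le> m + r"
      unfolding F_def
      by (intro degree_diff_le degree_sum_le order.trans[OF degree_monom_le]) auto
    have "coeff (F 0) (m + r) = (\<Sum>l\<in>{- int m..int r}. if l = int r then of_nat r else 0)"
    proof -
      have ne: "int r \<noteq> - int m" using r by simp
      have "(if nat (l + int m) = m + r then of_int l * (q(- int m := - of_real 0 * b)) l else 0) = (if l = int r then of_nat r else 0)"
        if "l \<in> {- int m..int r}" for l
        using that q ne by auto
      note eq = sum.cong[OF refl this]
      have "coeff (F 0) (m + r) = (\<Sum>l\<in>{- int m..int r}. if nat (l + int m) = m + r then of_int l * (q(- int m := - of_real 0 * b)) l else 0)"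
        unfolding F_def using r by (simp add: coeff_sum del: fun_upd_apply cong: if_cong)
      thus ?thesis by (simp only: eq)
    qed
    hence "coeff (F 0) (m + r) \<noteq> 0" using r by simp
    thus "m + r \<le> degree (F 0)" by (rule le_degree)
  qed
  define D where "D = pderiv (F 0)"
  have "D \<noteq> 0" unfolding D_def using deg m r by (simp add: pderiv_eq_0_iff)
  hence fin: "finite {a. poly D a = 0}" by (rule poly_roots_finite)
  have D: "pderiv (F \<delta>) = D" for \<delta> unfolding F_shift[of \<delta>] D_def by (simp add: pderiv_add pderiv_pCons)
  have deg': "degree (F \<delta>) = m + r" for \<delta>
    unfolding F_shift[of \<delta>] using deg m by (subst degree_add_eq_left) auto
  have "{\<delta>::real. \<delta> \<noteq> 0 \<and> card (crit_points m r w (q(- int m := - of_real \<delta> * b))) \<noteq> m + r}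
     \<subseteq> (\<lambda>a. Re (- poly (F 0) a / (of_nat m * b))) ` {a. poly D a = 0}"
  proof
    fix \<delta> :: real assume "\<delta> \<in> {\<delta>. \<delta> \<noteq> 0 \<and> card (crit_points m r w (q(- int m := - of_real \<delta> * b))) \<noteq> m + r}"
    hence \<delta>: "\<delta> \<noteq> 0" "card (crit_points m r w (q(- int m := - of_real \<delta> * b))) \<noteq> m + r" by auto
    have mb: "of_nat m * b \<noteq> 0" using m b by simp
    have "poly (F 0) 0 = 0"
    proof -
      have "(\<Sum>l\<in>{- int m..int r}. poly (monom (of_int l * (q(- int m := - of_real 0 * b)) l) (nat (l + int m))) 0) = 0"
      proof (intro sum.neutral ballI)
        fix l assume "l \<in> {- int m..int r}"
        thus "poly (monom (of_int l * (q(- int m := - of_real 0 * b)) l) (nat (l + int m))) 0 = 0"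
          by (cases "l = - int m") (auto simp: poly_monom power_0_left)
      qed
      moreover have "poly (monom (p_of m r w) m) 0 = 0" using m by (simp add: poly_monom power_0_left)
      ultimately show ?thesis unfolding F_def poly_diff poly_sum by (simp only: diff_zero)
    qed
    hence F0: "poly (F \<delta>) 0 \<noteq> 0" unfolding F_shift[of \<delta>] using \<delta>(1) mb by simp
    have "crit_points m r w (q(- int m := - of_real \<delta> * b)) = {a. poly (F \<delta>) a = 0}"
    proof (rule set_eqI)
      fix a
      show "a \<in> crit_points m r w (q(- int m := - of_real \<delta> * b)) \<longleftrightarrow> a \<in> {a. poly (F \<delta>) a = 0}"
      proof (cases "a = 0")
        case True
        thus ?thesis using F0 unfolding in_crit_points_iff by blast
      next
        case False
        hence "a ^ m \<noteq> 0" by simp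
        thus ?thesis using False
          unfolding in_crit_points_iff mem_Collect_eq F_poly[OF False] mult_eq_0_iff right_minus_eq by blast
      qed
    qed
    hence "\<not> rsquarefree (F \<delta>)" using card_roots_rsquarefree[of "F \<delta>"] \<delta>(2) deg' by auto
    then obtain a where a: "poly (F \<delta>) a = 0" "poly D a = 0" unfolding rsquarefree_roots D by blast
    have "of_nat m * of_real \<delta> * b = - poly (F 0) a"
      using a(1) unfolding F_shift[of \<delta>] by (simp add: add_eq_0_iff2)
    hence "complex_of_real \<delta> = - poly (F 0) a / (of_nat m * b)" using mb by (simp add: field_simps)
    hence "\<delta> = Re (- poly (F 0) a / (of_nat m * b))" by (metis Re_complex_of_real)
    thus "\<delta> \<in> (\<lambda>a. Re (- poly (F 0) a / (of_nat m * b))) ` {a. poly D a = 0}" using a(2) by blast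
  qed
  thus ?thesis by (rule finite_subset) (intro finite_imageI fin)
qed

lemma normal_thimble_real:
  fixes a :: "int \<Rightarrow> real"
  assumes r: "r \<ge> 1" and a: "\<And>l. a l \<ge> 0" and ar: "a (int r) > 0"
  shows "\<exists>g. normal_thimble m r (\<lambda>l. - of_real (a l)) g"
proof -
  obtain T T' X :: "real \<Rightarrow> real" where T:
    "\<And>x. (T has_real_derivative T' x) (at x)" "\<And>x. T' x > 0"
    "\<And>x. T x ^ 2 = (\<Sum>l\<in>{- int m..int r}. a l * (exp (of_int l * x) - 1 - of_int l * x))"
    "\<And>x. sgn (T x) = sgn x" "\<And>t. T (X t) = t" "\<And>x. X (T x) = x"
    "\<And>t. (X has_real_derivative (1 / T' (X t))) (at t)"
    by (rule real_phase_coordinate[of a r m, OF a ar r]) blast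
  have "sgn (T 0) = 0" using T(4)[of 0] by simp
  hence "T 0 = 0" by (simp add: sgn_0_0)
  hence X0: "X 0 = 0" using T(6)[of 0] by simp
  define g where "g = (\<lambda>t. complex_of_real (X t))"
  have d: "(g has_vector_derivative of_real (1 / T' (X t))) (at t)" for t
    unfolding g_def using T(7)[of t] unfolding has_real_derivative_iff_has_vector_derivative
    by (rule bounded_linear.has_vector_derivative[OF bounded_linear_of_real])
  have "g differentiable (at t)" for t using d differentiableI_vector by blast
  moreover have "Re (vector_derivative g (at 0)) > 0"
    unfolding vector_derivative_at[OF d[of 0]] Re_complex_of_real using T(2) by simp
  moreover have "phase m r (\<lambda>l. - of_real (a l)) (g t) = - of_real (t\<^sup>2)" for t
  proof -
    have "phase m r (\<lambda>l. - of_real (a l)) (g t) = - (\<Sum>l\<in>{- int m..int r}. of_real (a l * (exp (of_int l * X t) - 1 - of_int l * X t)))"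
      unfolding phase_def g_def by (simp add: exp_of_real[symmetric] sum_negf[symmetric])
    also have "\<dots> = - of_real (T (X t) ^ 2)" unfolding T(3) by simp
    finally show ?thesis by (simp add: T(5))
  qed
  ultimately have "normal_thimble m r (\<lambda>l. - of_real (a l)) g"
    using X0 by (simp add: normal_thimble_def g_def)
  thus ?thesis by blast
qed

text \<open>Dividing the difference of the two critical equations by the displacement \<open>d\<close> leaves
  \<open>phase_deriv_quot\<close>, whose limit is \<open>p r \<noteq> 0\<close>.  So near the limit there is only one critical point
  close to each \<open>P\<^sub>\<beta>\<close>.\<close>

lemma critical_point_unique:
  fixes c :: "nat \<Rightarrow> int \<Rightarrow> complex"
  assumes c: "\<And>l. (\<lambda>n. c n l) \<longlonglongrightarrow> lim_coeff r p l" and r: "r \<ge> 1" and p: "p \<noteq> 0"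
    and d: "d \<longlonglongrightarrow> 0"
    and eq: "\<And>n. (\<Sum>l\<in>{- int m..int r}. of_int l * c n l * exp (of_int l * d n)) = (\<Sum>l\<in>{- int m..int r}. of_int l * c n l)"
  shows "eventually (\<lambda>n. d n = 0) sequentially"
proof -
  have "(\<lambda>n. phase_deriv_quot m r (c n) (d n)) \<longlonglongrightarrow> phase_deriv_quot m r (lim_coeff r p) 0"
    by (intro tendsto_phase_deriv_quot c d)
  moreover have "phase_deriv_quot m r (lim_coeff r p) 0 \<noteq> 0"
    using r p by (simp add: phase_deriv_quot_0 phase_quot_lim_coeff_0)
  ultimately have "eventually (\<lambda>n. phase_deriv_quot m r (c n) (d n) \<noteq> 0) sequentially"
    by (rule tendsto_imp_eventually_ne)
  thus ?thesis
  proof eventually_elim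
    case (elim n)
    have "d n * phase_deriv_quot m r (c n) (d n) = 0"
      unfolding phase_deriv_quot_mult using eq[of n]
      by (simp add: right_diff_distrib sum_subtractf mult_ac)
    thus ?case using elim by simp
  qed
qed

text \<open>On the ray the critical equation is strictly monotone, and its limit \<open>p (exp (r x) - 1) = 0\<close>
  changes sign at \<open>0\<close>.\<close>

lemma real_critical_point:
  fixes b :: "nat \<Rightarrow> int \<Rightarrow> real"
  assumes b: "\<And>l. (\<lambda>n. b n l) \<longlonglongrightarrow> (if l = int r then p / real r else 0)" and r: "r \<ge> 1" and p: "p < 0"
    and nonpos: "\<And>n l. b n l \<le> 0" and neg: "\<And>n. b n (int r) < 0"
  obtains x :: "nat \<Rightarrow> real" where "x \<longlonglongrightarrow> 0"
    "eventually (\<lambda>n. (\<Sum>l\<in>{- int m..int r}. of_int l * b n l * exp (of_int l * x n)) = p) sequentially"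
proof -
  define h where "h = (\<lambda>n x. (\<Sum>l\<in>{- int m..int r}. of_int l * b n l * exp (of_int l * x)) - p)"
  have r_in: "int r \<in> {- int m..int r}" by simp
  have h_dec: "h n y < h n x" if "x < y" for n x y
  proof (rule DERIV_neg_imp_decreasing[OF that])
    fix u
    define D where "D = (\<Sum>l\<in>{- int m..int r}. of_int l * b n l * (of_int l * exp (of_int l * u)))"
    have "(h n has_real_derivative D) (at u)"
      unfolding h_def D_def by (auto intro!: derivative_eq_intros sum.cong simp: mult_ac)
    moreover have "D < 0"
    proof -
      have "0 < (\<Sum>l\<in>{- int m..int r}. - (of_int l * b n l * (of_int l * exp (of_int l * u))))"
      proof (rule sum_pos2[OF _ r_in])
        have "(real r * real r * exp (real r * u)) * - b n (int r) > 0"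
          using r neg[of n] by (intro mult_pos_pos) auto
        thus "0 < - (of_int (int r) * b n (int r) * (of_int (int r) * exp (of_int (int r) * u)))"
          by (simp add: mult_ac)
        fix l :: int
        have "((of_int l)\<^sup>2 * exp (of_int l * u)) * - b n l \<ge> 0"
          using nonpos[of n l] by (intro mult_nonneg_nonneg) auto
        thus "0 \<le> - (of_int l * b n l * (of_int l * exp (of_int l * u)))"
          by (simp add: power2_eq_square mult_ac)
      qed simp
      thus ?thesis by (simp add: D_def sum_negf)
    qed
    ultimately show "\<exists>y. (h n has_real_derivative y) (at u) \<and> y < 0" by blast
  qed
  have h_lim: "(\<lambda>n. h n x) \<longlonglongrightarrow> p * (exp (real r * x) - 1)" for x
  proof -
    have "(\<lambda>n. h n x) \<longlonglongrightarrow> (\<Sum>l\<in>{- int m..int r}. of_int l * (if l = int r then p / real r else 0) * exp (of_int l * x)) - p"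
      unfolding h_def by (intro tendsto_intros b)
    also have "(\<Sum>l\<in>{- int m..int r}. of_int l * (if l = int r then p / real r else 0) * exp (of_int l * x)) =
        (\<Sum>l\<in>{- int m..int r}. if l = int r then p * exp (real r * x) else 0)"
      using r by (intro sum.cong refl) auto
    also have "\<dots> - p = p * (exp (real r * x) - 1)" by (simp add: algebra_simps)
    finally show ?thesis .
  qed
  have ex: "eventually (\<lambda>n. \<exists>x. \<bar>x\<bar> < e \<and> h n x = 0) sequentially" if e: "e > 0" for e
  proof -
    have r0: "real r > 0" using r by simp
    have "exp (real r * (e / 2)) > 1" using r0 e by simp
    hence "p * (exp (real r * (e / 2)) - 1) < 0" using p by (intro mult_neg_pos) auto
    from order_tendstoD(2)[OF h_lim this] have ev1: "eventually (\<lambda>n. h n (e / 2) < 0) sequentially" .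
    have "exp (real r * (- e / 2)) < 1" using r0 e by simp
    hence "p * (exp (real r * (- e / 2)) - 1) > 0" using p by (intro mult_neg_neg) auto
    from order_tendstoD(1)[OF h_lim this] have ev2: "eventually (\<lambda>n. h n (- e / 2) > 0) sequentially" .
    from ev1 ev2 show ?thesis
    proof eventually_elim
      case (elim n)
      have "continuous_on {- e / 2..e / 2} (h n)" unfolding h_def by (intro continuous_intros)
      then obtain x where "- e / 2 \<le> x" "x \<le> e / 2" "h n x = 0"
        using IVT2'[of "h n" "e / 2" 0 "- e / 2"] elim e by auto
      thus ?case using e by (intro exI[of _ x]) auto
    qed
  qed
  define x where "x = (\<lambda>n. SOME x. h n x = 0)"
  have x_eq: "h n (x n) = 0" "x n = y" if "h n y = 0" for n y
  proof -
    show *: "h n (x n) = 0" unfolding x_def using that by (rule someI)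
    show "x n = y" using h_dec[of "x n" y n] h_dec[of y "x n" n] * that by (cases "x n" y rule: linorder_cases) auto
  qed
  have "x \<longlonglongrightarrow> 0"
  proof (rule tendstoI)
    fix e :: real assume "e > 0"
    from ex[OF this] show "eventually (\<lambda>n. dist (x n) 0 < e) sequentially"
    proof eventually_elim
      case (elim n)
      then obtain y where "\<bar>y\<bar> < e" "h n y = 0" by blast
      thus ?case using x_eq(2)[of n y] by simp
    qed
  qed
  moreover have "eventually (\<lambda>n. (\<Sum>l\<in>{- int m..int r}. of_int l * b n l * exp (of_int l * x n)) = p) sequentially"
    using ex[of 1, simplified]
  proof eventually_elim
    case (elim n)
    then obtain y where "h n y = 0" by blast
    from x_eq(1)[OF this] show ?case by (simp add: h_def)
  qed
  ultimately show ?thesis by (rule that)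
qed

text \<open>All \<open>q\<^sub>l P\<^sup>l\<close>, where \<open>P\<close> is the limiting critical point, are chosen real and negative, and small for
  \<open>l \<noteq> r\<close>.  Then there is a critical point on the ray through \<open>P\<close>, it is the nearest one to \<open>P\<close> by
  uniqueness, and its thimble is the ray, parametrised by \<open>real_phase_coordinate\<close>.\<close>

lemma q_lim_islimpt_q_domain:
  fixes p z :: real
  assumes m: "m \<ge> 1" and r: "r \<ge> 1" and pw: "p_of m r w = of_real p" and p: "p < 0" and z: "z < 0"
  shows "q_lim r islimpt q_domain m r w z \<beta>"
proof -
  have p0: "p_of m r w \<noteq> 0" using pw p by simp
  define P where "P = P_lim m r w \<beta>"
  have P0: "P \<noteq> 0" unfolding P_def by (rule P_lim_nonzero[OF p0 r])
  have P_r: "P ^ r = of_real (p / real r)" unfolding P_def P_lim_power[OF p0 r] pw by simp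
  define e where "e = (\<lambda>n. 1 / real (Suc n))"
  have e_pos: "e n > 0" for n by (simp add: e_def)
  have e_lim: "e \<longlonglongrightarrow> 0" unfolding e_def by (rule LIMSEQ_Suc) (rule lim_1_over_n)
  define q0 where "q0 = (\<lambda>n l. if l \<notin> {- int m..int r} then 0 else if l = int r then 1 else - of_real (e n) * P powi (- l))"
  \<comment> \<open>The coefficient of index \<open>- m\<close> is left free to avoid multiple critical points.\<close>
  have "\<exists>\<delta>>0. \<delta> < e n \<and> card (crit_points m r w ((q0 n)(- int m := - of_real \<delta> * P ^ m))) = m + r" for n
  proof -
    have q0r: "q0 n (int r) = 1" by (simp add: q0_def)
    have Pm: "P ^ m \<noteq> 0" using P0 by simp
    have "infinite ({0<..<e n} - {\<delta>::real. \<delta> \<noteq> 0 \<and> card (crit_points m r w ((q0 n)(- int m := - of_real \<delta> * P ^ m))) \<noteq> m + r})"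
      using e_pos[of n] by (intro Diff_infinite_finite finite_coincident_critical_points[where q = "q0 n" and b = "P ^ m", OF m r q0r Pm]) auto
    from infinite_imp_nonempty[OF this] show ?thesis by auto
  qed
  then obtain \<delta> where \<delta>: "\<And>n. \<delta> n > 0" "\<And>n. \<delta> n < e n"
      "\<And>n. card (crit_points m r w ((q0 n)(- int m := - of_real (\<delta> n) * P ^ m))) = m + r" by metis
  have \<delta>_lim: "\<delta> \<longlonglongrightarrow> 0"
    by (rule tendsto_sandwich[OF _ _ tendsto_const e_lim]) (intro always_eventually allI less_imp_le \<delta>)+
  define q where "q = (\<lambda>n. (q0 n)(- int m := - of_real (\<delta> n) * P ^ m))"
  define b where "b = (\<lambda>n l. if l \<notin> {- int m..int r} then 0 else if l = int r then p / real r else if l = - int m then - \<delta> n else - e n)"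
  have mr: "- int m \<noteq> int r" using m by simp
  have q_eq: "q n l * P powi l = of_real (b n l)" for n l
    using P0 mr by (auto simp: q_def q0_def b_def P_r[unfolded of_real_divide] power_int_minus)
  have q_nz: "q n l \<noteq> 0 \<longleftrightarrow> l \<in> {- int m..int r}" for n l
    using P0 mr e_pos[of n] \<delta>(1)[of n] by (auto simp: q_def q0_def)
  have q_r: "q n (int r) = 1" for n
    unfolding q_def fun_upd_other[OF not_sym[OF mr]] by (simp add: q0_def)
  have q_lim: "(\<lambda>n. q n l) \<longlonglongrightarrow> q_lim r l" for l
  proof -
    consider "l = - int m" | "l = int r" | "l \<noteq> - int m" "l \<noteq> int r" by blast
    thus ?thesis
    proof cases
      case 1
      have "(\<lambda>n. - of_real (\<delta> n) * P ^ m) \<longlonglongrightarrow> - of_real 0 * P ^ m" by (intro tendsto_intros \<delta>_lim)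
      thus ?thesis unfolding q_def q_lim_def 1 fun_upd_same if_not_P[OF mr] by simp
    next
      case 2
      thus ?thesis by (simp add: q_r q_lim_def)
    next
      case 3
      have "(\<lambda>n. - of_real (e n) * P powi (- l)) \<longlonglongrightarrow> - of_real 0 * P powi (- l)" by (intro tendsto_intros e_lim)
      thus ?thesis using 3 by (cases "l \<in> {- int m..int r}") (simp_all add: q_def q0_def q_lim_def)
    qed
  qed
  have b_lim: "(\<lambda>n. b n l) \<longlonglongrightarrow> (if l = int r then p / real r else 0)" for l
    unfolding b_def using tendsto_minus[OF e_lim] tendsto_minus[OF \<delta>_lim]
    by (cases "l \<in> {- int m..int r}"; cases "l = - int m") auto
  have pr: "p / real r < 0" using p r by (intro divide_neg_pos) auto
  have b_nonpos: "b n l \<le> 0" and b_neg: "b n (int r) < 0" for n l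
    using pr less_imp_le[OF e_pos[of n]] less_imp_le[OF \<delta>(1)[of n]] by (auto simp: b_def)
  obtain x where x: "x \<longlonglongrightarrow> 0"
    "eventually (\<lambda>n. (\<Sum>l\<in>{- int m..int r}. of_int l * b n l * exp (of_int l * x n)) = p) sequentially"
    by (rule real_critical_point[OF b_lim r p b_nonpos b_neg])
  then obtain N where N: "\<And>n. n \<ge> N \<Longrightarrow> (\<Sum>l\<in>{- int m..int r}. of_int l * b n l * exp (of_int l * x n)) = p"
    unfolding eventually_sequentially by blast
  define y where "y = (\<lambda>n. Ln P + of_real (x n))"
  have ey: "exp (y n) = P * of_real (exp (x n))" for n using P0 by (simp add: y_def exp_add exp_of_real)
  have ey_lim: "(\<lambda>n. exp (y n)) \<longlonglongrightarrow> P"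
  proof -
    have "(\<lambda>n. P * of_real (exp (x n))) \<longlonglongrightarrow> P * of_real (exp 0)" by (intro tendsto_intros x)
    thus ?thesis by (simp add: ey)
  qed
  have c_eq: "q n l * exp (y n) powi l = of_real (b n l * exp (of_int l * x n))" for n l
  proof -
    have "of_real (exp (x n)) powi l = complex_of_real (exp (of_int l * x n))"
      using exp_of_int_mult_eq_power_int[of l "complex_of_real (x n)"]
      by (simp add: exp_of_real[symmetric])
    thus ?thesis unfolding ey power_int_mult_distrib by (simp add: q_eq[symmetric])
  qed
  have crit: "exp (y n) \<in> crit_points m r w (q n)" if "n \<ge> N" for n
  proof -
    have "(\<Sum>l\<in>{- int m..int r}. of_int l * q n l * exp (y n) powi l) =
       of_real (\<Sum>l\<in>{- int m..int r}. of_int l * b n l * exp (of_int l * x n))"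
      unfolding mult.assoc c_eq by simp
    thus ?thesis unfolding in_crit_points_iff N[OF that] pw by simp
  qed
  have card: "card (crit_points m r w (q n)) = m + r" for n using \<delta>(3) by (simp add: q_def)
  have fin: "finite (crit_points m r w (q n))" "crit_points m r w (q n) \<noteq> {}" for n
    using card[of n] r by (auto intro: card_ge_0_finite)
  define Q where "Q = (\<lambda>n. P_crit m r w (q n) \<beta>)"
  have Q_crit: "Q n \<in> crit_points m r w (q n)" for n
    unfolding Q_def by (rule P_crit_is_nearest(1)[OF fin])
  have Q_lim: "Q \<longlonglongrightarrow> P" unfolding Q_def P_def by (rule P_crit_tendsto[OF q_lim r p0 fin])
  define d where "d = (\<lambda>n. Ln (Q n / exp (y n)))"
  have ed: "exp (y n) * exp (d n) = Q n" for n
    using Q_crit[of n] by (simp add: d_def in_crit_points_iff)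
  have d_lim: "d \<longlonglongrightarrow> 0"
  proof -
    have "(\<lambda>n. Q n / exp (y n)) \<longlonglongrightarrow> P / P" by (intro tendsto_intros Q_lim ey_lim P0)
    hence "(\<lambda>n. Q n / exp (y n)) \<longlonglongrightarrow> 1" using P0 by simp
    hence "d \<longlonglongrightarrow> Ln 1" unfolding d_def by (intro tendsto_Ln) auto
    thus ?thesis by simp
  qed
  define c where "c = (\<lambda>n l. q n l * exp (y n) powi l)"
  have c_lim: "(\<lambda>n. c n l) \<longlonglongrightarrow> lim_coeff r p l" for l
  proof -
    have "(\<lambda>n. c n l) \<longlonglongrightarrow> q_lim r l * P powi l"
      unfolding c_def by (intro tendsto_intros q_lim ey_lim P0)
    also have "q_lim r l * P powi l = lim_coeff r p l"
      by (simp add: q_lim_def lim_coeff_def P_r)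
    finally show ?thesis .
  qed
  have "eventually (\<lambda>n. d (n + N) = 0) sequentially"
  proof (rule critical_point_unique[of "\<lambda>n. c (n + N)" r p "\<lambda>n. d (n + N)" m])
    show "(\<lambda>n. c (n + N) l) \<longlonglongrightarrow> lim_coeff r p l" for l by (rule LIMSEQ_ignore_initial_segment[OF c_lim])
    show "(\<lambda>n. d (n + N)) \<longlonglongrightarrow> 0" by (rule LIMSEQ_ignore_initial_segment[OF d_lim])
    show "(\<Sum>l\<in>{- int m..int r}. of_int l * c (n + N) l * exp (of_int l * d (n + N))) = (\<Sum>l\<in>{- int m..int r}. of_int l * c (n + N) l)" for n
    proof -
      have "(\<Sum>l\<in>{- int m..int r}. of_int l * c (n + N) l) = p_of m r w"
        using crit[of "n + N"] by (simp add: in_crit_points_iff c_def mult.assoc)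
      moreover have "(\<Sum>l\<in>{- int m..int r}. of_int l * c (n + N) l * exp (of_int l * d (n + N))) =
          (\<Sum>l\<in>{- int m..int r}. of_int l * q (n + N) l * Q (n + N) powi l)"
        unfolding c_def exp_of_int_mult_eq_power_int ed[symmetric] power_int_mult_distrib by (simp add: mult_ac)
      ultimately show ?thesis using Q_crit[of "n + N"] by (simp add: in_crit_points_iff)
    qed
  qed (use r p in auto)
  hence ev: "eventually (\<lambda>n. d n = 0) sequentially"
    by (rule eventually_sequentially_seg[of "\<lambda>n. d n = 0" N, THEN iffD1])
  have dom: "eventually (\<lambda>n. q n \<in> q_domain m r w z \<beta>) sequentially"
    using ev eventually_ge_at_top[of N]
  proof eventually_elim
    case (elim n)
    have Q_eq: "P_crit m r w (q n) \<beta> = exp (y n)" using ed[of n] elim by (simp add: Q_def)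
    define a where "a = (\<lambda>l. - (b n l * exp (of_int l * x n)))"
    have "\<exists>g. normal_thimble m r (\<lambda>l. - of_real (a l)) g"
      using b_nonpos[of n] b_neg[of n]
      by (intro normal_thimble_real r) (auto simp: a_def mult_nonpos_nonneg mult_neg_pos)
    then obtain g where "normal_thimble m r (\<lambda>l. q n l * exp (y n) powi l) g"
      unfolding c_eq a_def by auto
    from thimble_of_normal_thimble[OF z crit[OF elim(2)] Q_eq this]
    show ?case using q_r q_nz card by (auto simp: q_domain_def)
  qed
  then obtain N' where N': "\<And>n. n \<ge> N' \<Longrightarrow> q n \<in> q_domain m r w z \<beta>"
    unfolding eventually_sequentially by blast
  have ne: "q n \<noteq> q_lim r" for n
  proof
    assume "q n = q_lim r"
    moreover have "q n (- int m) \<noteq> 0" using q_nz[of n "- int m"] by simp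
    moreover have "q_lim r (- int m) = 0" unfolding q_lim_def by (rule if_not_P[OF mr])
    ultimately show False by simp
  qed
  have "q \<longlonglongrightarrow> q_lim r" using q_lim by (simp add: sequence_componentwise)
  hence "(\<lambda>n. q (n + N')) \<longlonglongrightarrow> q_lim r" by (rule LIMSEQ_ignore_initial_segment)
  thus ?thesis unfolding islimpt_sequential using N' ne by (intro exI[of _ "\<lambda>n. q (n + N')"]) auto
qed

section \<open>Equality of the blocks\<close>

theorem proposition3p1:
  fixes m r \<alpha> \<beta> :: nat and w :: "int \<Rightarrow> complex" and p z :: real and u1 u2 lam \<mu> :: complex
  assumes "m \<ge> 1" and "r \<ge> 1"
    and "p_of m r w = of_real p" and "p < 0" and "z < 0"
    and "\<mu> = of_real (p / (of_nat r * z))"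
    and "lam = chart_weight m r u1 u2 / of_real z"
    and "lam = \<mu>"
    and "\<alpha> < r" and "\<beta> < r"
  shows "(at (q_lim r) within q_domain m r w z \<beta>) \<noteq> bot \<and>
         ((\<lambda>q. R_matrix m r w z q \<alpha> \<beta>) \<longlongrightarrow> R_block m r w z \<alpha> \<beta>)
           (at (q_lim r) within q_domain m r w z \<beta>) \<and>
         R_block m r w z \<alpha> \<beta> = P_block r lam \<alpha> \<beta> \<and>
         (\<forall>N. (\<lambda>x::real. P_block r (of_real x) \<alpha> \<beta>
                 - (\<Sum>k<N. fps_nth (P_series r \<alpha> \<beta>) k / of_real x ^ k))
             \<in> O[at_top](\<lambda>x. 1 / of_real x ^ N))"
proof -
  define F where "F = at (q_lim r) within q_domain m r w z \<beta>"
  have nontrivial: "F \<noteq> bot"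
    unfolding F_def trivial_limit_within[unfolded trivial_limit_def]
    using q_lim_islimpt_q_domain[OF assms(1-5)] by (simp add: trivial_limit_within)
  have lam: "lam = of_real (p / (real r * z))" using assms(6,8) by simp
  have tendsto: "((\<lambda>q. R_matrix m r w z q \<alpha> \<beta>) \<longlongrightarrow> P_block r lam \<alpha> \<beta>) F"
    unfolding F_def tendsto_at_iff_sequentially comp_def lam
    using R_matrix_sequence[OF assms(2-5,9,10)] by (simp add: sequence_componentwise)
  have block: "R_block m r w z \<alpha> \<beta> = P_block r lam \<alpha> \<beta>"
    unfolding R_block_def F_def[symmetric] by (rule tendsto_Lim[OF nontrivial tendsto])
  show ?thesis
    using nontrivial tendsto P_block_expansion[OF assms(2)] unfolding F_def block by blast
qed

end
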